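(* Let $a,b>0$ and $\gamma,\widetilde\gamma\in\mathbb{R}$. Call a gap of $\sigma(\mathscr{H}_\gamma)$ any connected component of $\mathbb{R}\setminus\sigma(\mathscr{H}_\gamma)$. Then: (i) If $\gamma<0$ and $\widetilde\gamma<\gamma$, then no gap $J$ of $\sigma(\mathscr{H}_\gamma)$ with $J\subset(\inf\sigma(\mathscr{H}_\gamma),\infty)$ meets $\sigma(\mathscr{H}_{\gamma,\widetilde\gamma})$, while the semi-infinite gap $(-\infty,\inf\sigma(\mathscr{H}_\gamma))$ always contains a new (negative) spectral band of $\mathscr{H}_{\gamma,\widetilde\gamma}$, i.e. $(-\infty,\inf\sigma(\mathscr{H}_\gamma))\cap\sigma(\mathscr{H}_{\gamma,\widetilde\gamma})\neq\emptyset$. (ii) If $\gamma<0$ and $\widetilde\gamma>\gamma$, then $(-\infty,\inf\sigma(\mathscr{H}_\gamma))\cap\sigma(\mathscr{H}_{\gamma,\widetilde\gamma})=\emptyset$, while every gap $J$ of $\sigma(\mathscr{H}_\gamma)$ with $J\subset(\inf\sigma(\mathscr{H}_\gamma),\infty)$ contains a new spectral band, i.e. $J\cap\sigma(\mathscr{H}_{\gamma,\widetilde\gamma})\neq\emptyset$. (iii) If $\gamma>0$ and $\widetilde\gamma<\gamma$, then every gap $J$ of $\sigma(\mathscr{H}_\gamma)$ contains a new spectral band, i.e. $J\cap\sigma(\mathscr{H}_{\gamma,\widetilde\gamma})\neq\emptyset$. (iv) If $\gamma>0$ and $\widetilde\gamma>\gamma$, then no gap of $\sigma(\mathscr{H}_\gamma)$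 meets $\sigma(\mathscr{H}_{\gamma,\widetilde\gamma})$; the spectrum is unchanged: $\sigma(\mathscr{H}_{\gamma,\widetilde\gamma})=\sigma(\mathscr{H}_\gamma)$.
   Context: Let $\Gamma$ be the rectangular lattice quantum graph in $\mathbb{R}^2$ with vertex set $\{(ma,nb):m,n\in\mathbb{Z}\}$, horizontal edges of length $a$ joining $(ma,nb)$ and $((m+1)a,nb)$, and vertical edges of length $b$ joining $(ma,nb)$ and $(ma,(n+1)b)$. For $\gamma\in\mathbb{R}$, $\mathscr{H}_\gamma$ is the self-adjoint operator in $L^2(\Gamma)$ acting as $-\frac{d^2}{dx^2}$ on each edge (functions in $H^2$ on each edge) with a $\delta$-coupling of strength $\gamma$ at every vertex $v$: $\psi$ is continuous at $v$ and the sum of the derivatives of $\psi$ at $v$ taken in the outward directions of the edges emanating from $v$ equals $\gamma\psi(v)$. For $\gamma,\widetilde\gamma\in\mathbb{R}$, $\mathscr{H}_{\gamma,\widetilde\gamma}$ is defined in the same way except that at the vertices $(0,nb)$, $n\in\mathbb{Z}$ (an infinite straight chain of vertices), the coupling strength $\gamma$ is replaced by $\widetilde\gamma$. *)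

theory Defs
  imports "HOL-Analysis.Analysis"
begin

text \<open>Edges of the rectangular lattice graph. Hor (m,n) joins (ma,nb) [parameter 0]
  to ((m+1)a,nb) [parameter a]; Ver (m,n) joins (ma,nb) [parameter 0] to (ma,(n+1)b)
  [parameter b]. A function on the graph is a family psi e t, t in [0, length e].\<close>

datatype edge = Hor "int \<times> int" | Ver "int \<times> int"

definition elen :: "real \<Rightarrow> real \<Rightarrow> edge \<Rightarrow> real" where
  "elen a b e = (case e of Hor _ \<Rightarrow> a | Ver _ \<Rightarrow> b)"

definition sq_int :: "real \<Rightarrow> (real \<Rightarrow> complex) \<Rightarrow> bool" where
  "sq_int L f \<longleftrightarrow> set_borel_measurable lborel {0..L} f \<and>
     set_integrable lborel {0..L} (\<lambda>t. (cmod (f t))^2)"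

definition edge_norm2 :: "real \<Rightarrow> (real \<Rightarrow> complex) \<Rightarrow> real" where
  "edge_norm2 L f = (LINT t:{0..L}|lborel. (cmod (f t))^2)"

definition in_L2 :: "real \<Rightarrow> real \<Rightarrow> (edge \<Rightarrow> real \<Rightarrow> complex) \<Rightarrow> bool" where
  "in_L2 a b \<psi> \<longleftrightarrow> (\<forall>e. sq_int (elen a b e) (\<psi> e)) \<and>
     (\<lambda>e. edge_norm2 (elen a b e) (\<psi> e)) summable_on UNIV"

definition L2_norm :: "real \<Rightarrow> real \<Rightarrow> (edge \<Rightarrow> real \<Rightarrow> complex) \<Rightarrow> real" where
  "L2_norm a b \<psi> = sqrt (\<Sum>\<^sub>\<infinity>e. edge_norm2 (elen a b e) (\<psi> e))"

text \<open>f belongs to H^2(0,L) (continuous representative), with first derivative f'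
  and (a.e.) second derivative f'' in L^2(0,L).\<close>
definition H2_edge :: "real \<Rightarrow> (real \<Rightarrow> complex) \<Rightarrow> (real \<Rightarrow> complex) \<Rightarrow> (real \<Rightarrow> complex) \<Rightarrow> bool" where
  "H2_edge L f f' f'' \<longleftrightarrow> sq_int L f'' \<and> set_integrable lborel {0..L} f'' \<and>
     (\<forall>x\<in>{0..L}. (f has_vector_derivative f' x) (at x within {0..L})) \<and>
     (\<forall>x\<in>{0..L}. f' x = f' 0 + (LINT t:{0..x}|lborel. f'' t))"

text \<open>Continuity and delta-coupling of strength alpha m n at vertex (ma,nb).
  Outward derivatives: Hor(m,n) at 0: psi'; Hor(m-1,n) at a: -psi'; Ver(m,n) at 0: psi';
  Ver(m,n-1) at b: -psi'.\<close>
definition vertex_conditions :: "real \<Rightarrow> real \<Rightarrow> (int \<Rightarrow> int \<Rightarrow> real) \<Rightarrow>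
    (edge \<Rightarrow> real \<Rightarrow> complex) \<Rightarrow> (edge \<Rightarrow> real \<Rightarrow> complex) \<Rightarrow> bool" where
  "vertex_conditions a b \<alpha> \<psi> \<psi>' \<longleftrightarrow> (\<forall>m n.
     \<psi> (Hor (m - 1, n)) a = \<psi> (Hor (m, n)) 0 \<and>
     \<psi> (Ver (m, n)) 0 = \<psi> (Hor (m, n)) 0 \<and>
     \<psi> (Ver (m, n - 1)) b = \<psi> (Hor (m, n)) 0 \<and>
     \<psi>' (Hor (m, n)) 0 - \<psi>' (Hor (m - 1, n)) a + \<psi>' (Ver (m, n)) 0 - \<psi>' (Ver (m, n - 1)) b
       = complex_of_real (\<alpha> m n) * \<psi> (Hor (m, n)) 0)"

text \<open>Graph of the operator: lattice_op a b alpha psi phi means psi in the domain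
  and H psi = phi (in L^2, i.e. a.e. on every edge).\<close>
definition lattice_op :: "real \<Rightarrow> real \<Rightarrow> (int \<Rightarrow> int \<Rightarrow> real) \<Rightarrow>
    (edge \<Rightarrow> real \<Rightarrow> complex) \<Rightarrow> (edge \<Rightarrow> real \<Rightarrow> complex) \<Rightarrow> bool" where
  "lattice_op a b \<alpha> \<psi> \<phi> \<longleftrightarrow> in_L2 a b \<psi> \<and> in_L2 a b \<phi> \<and>
     (\<exists>\<psi>' \<psi>''. (\<forall>e. H2_edge (elen a b e) (\<psi> e) (\<psi>' e) (\<psi>'' e)) \<and>
        vertex_conditions a b \<alpha> \<psi> \<psi>' \<and>
        (\<forall>e. AE t in lborel. t \<in> {0..elen a b e} \<longrightarrow> \<phi> e t = - \<psi>'' e t))"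

text \<open>Spectrum (the operators are self-adjoint, so the spectrum is real):
  lam is in the resolvent set iff H - lam is bijective from the domain onto L^2
  (modulo null functions) with bounded inverse.\<close>
definition spectrum_lattice :: "real \<Rightarrow> real \<Rightarrow> (int \<Rightarrow> int \<Rightarrow> real) \<Rightarrow> real set" where
  "spectrum_lattice a b \<alpha> = {lam. \<not> (
     (\<exists>C. \<forall>\<psi> \<phi>. lattice_op a b \<alpha> \<psi> \<phi> \<longrightarrow>
          L2_norm a b \<psi> \<le> C * L2_norm a b (\<lambda>e t. \<phi> e t - complex_of_real lam * \<psi> e t)) \<and>
     (\<forall>f. in_L2 a b f \<longrightarrow> (\<exists>\<psi> \<phi>. lattice_op a b \<alpha> \<psi> \<phi> \<and>
          L2_norm a b (\<lambda>e t. \<phi> e t - complex_of_real lam * \<psi> e t - f e t) = 0)))}"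

definition sigma_H :: "real \<Rightarrow> real \<Rightarrow> real \<Rightarrow> real set" where
  "sigma_H a b \<gamma> = spectrum_lattice a b (\<lambda>m n. \<gamma>)"

definition sigma_H_pert :: "real \<Rightarrow> real \<Rightarrow> real \<Rightarrow> real \<Rightarrow> real set" where
  "sigma_H_pert a b \<gamma> \<gamma>t = spectrum_lattice a b (\<lambda>m n. if m = 0 then \<gamma>t else \<gamma>)"

definition gap :: "real set \<Rightarrow> real set \<Rightarrow> bool" where
  "gap S J \<longleftrightarrow> (\<exists>x. x \<notin> S \<and> J = connected_component_set (- S) x)"

end

theory Submission
  imports Defs
begin

text \<open>
  On an edge of length \<open>L\<close> a solution of \<open>-\<psi>'' = \<lambda>\<psi>\<close> is determined by its end values as soon as
  \<open>S\<^sub>L = sin(kL)/k\<close> (with \<open>k\<^sup>2 = \<lambda>\<close>) does not vanish, so \<open>H - \<lambda>\<close> is then invertible if and only if the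
  difference operator \<open>(\<alpha> + 2C\<^sub>a/S\<^sub>a + 2C\<^sub>b/S\<^sub>b) - A\<close> on \<open>\<ell>\<^sup>2(\<int>\<^sup>2)\<close> is, where \<open>C\<^sub>L = cos(kL)\<close> and \<open>A\<close> is the
  nearest neighbour operator with weights \<open>1/S\<^sub>a\<close>, \<open>1/S\<^sub>b\<close>. If the diagonal exceeds the Schur bound
  \<open>2/\<bar>S\<^sub>a\<bar> + 2/\<bar>S\<^sub>b\<bar>\<close> of \<open>A\<close> in modulus, a Neumann series inverts it; this already covers the perturbed operator
  whenever the perturbation increases the modulus of the diagonal. Otherwise truncated plane waves, or
  a bound state \<open>\<rho>\<^sup>\<bar>\<^sup>m\<^sup>\<bar>\<close> across the chain times a truncated plane wave along it, are approximate null
  vectors; points with \<open>S\<^sub>a S\<^sub>b = 0\<close> always belong to the spectrum. The defect band is then found in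
  each gap by the intermediate value theorem, since the gap conditions are governed by functions
  which between two zeros of \<open>S\<^sub>a S\<^sub>b\<close> are monotone in \<open>\<lambda>\<close>.
\<close>

subsection \<open>Functions on an edge\<close>

text \<open>Off the zeros of \<open>S_a S_b\<close> the Schur bound, call it \<open>M\<close>, is
  attained by plane waves, so with \<open>H0\<close> the sum of the two cotangent terms the
  unperturbed spectrum is given there by \<open>\<bar>\<gamma> + H0\<bar> \<le> M\<close>. This
  fails in two ways, \<open>M - H0 < \<gamma>\<close> and \<open>M + H0 < - \<gamma>\<close>. Both
  left sides are sums of one-edge functions, essentially \<open>k tan\<close> and
  \<open>k cot\<close> of a half angle; the first increases, the second decreases between Dirichlet
  eigenvalues. A gap of the first type thus runs from a Dirichlet eigenvalue or
  \<open>-\<infinity>\<close> up to a band edge, one of the second type from a band edge up to a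
  Dirichlet eigenvalue. The second function is positive and the first is nonnegative for
  \<open>lam \<ge> 0\<close>, so the sign of \<open>\<gamma>\<close> decides which types occur and
  where. The difficulty is the Dirichlet end of a gap, where the matching condition of the defect
  degenerates; there \<open>S_a S_b\<close> is small while the perturbation is fixed. On the edges,
  second derivatives exist only almost everywhere, so pointwise calculus gives way to integral
  identities.\<close>

lemma set_integrable_mult_continuous:
  fixes g q :: "real \<Rightarrow> complex"
  assumes g: "set_integrable lborel {c..d} g" and cq: "continuous_on {c..d} q"
  shows "set_integrable lborel {c..d} (\<lambda>s. g s * q s)"
proof -
  let ?I = "\<lambda>t. indicator {c..d} t :: real"
  obtain B where "\<forall>y\<in>q ` {c..d}. norm y \<le> B"
    using compact_imp_bounded[OF compact_continuous_image[OF cq compact_Icc]]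
    unfolding bounded_iff by blast
  then have B: "\<And>t. t \<in> {c..d} \<Longrightarrow> norm (q t) \<le> B" by blast
  have ig: "integrable lborel (\<lambda>s. ?I s *\<^sub>R g s)" using g by (simp add: set_integrable_def)
  have iq0: "set_integrable lborel {c..d} q" by (rule borel_integrable_atLeastAtMost'[OF cq])
  have [measurable]: "(\<lambda>s. ?I s *\<^sub>R g s) \<in> borel_measurable borel" "(\<lambda>s. ?I s *\<^sub>R q s) \<in> borel_measurable borel"
    using iq0 g by (auto simp: set_integrable_def dest: borel_measurable_integrable)
  have "integrable lborel (\<lambda>s. (?I s *\<^sub>R g s) * (?I s *\<^sub>R q s))"
  proof (rule Bochner_Integration.integrable_bound)
    show "integrable lborel (\<lambda>s. (?I s *\<^sub>R g s) * of_real B)" by (intro integrable_mult_left impI ig)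
    show "AE s in lborel. norm ((?I s *\<^sub>R g s) * (?I s *\<^sub>R q s)) \<le> norm ((?I s *\<^sub>R g s) * of_real B)"
      using B by (intro AE_I2) (auto simp: indicator_def norm_mult intro!: mult_left_mono order_trans[OF _ abs_ge_self])
  qed measurable
  then show ?thesis
    unfolding set_integrable_def
    by (rule Bochner_Integration.integrable_cong[THEN iffD1, rotated 2]) (auto simp: indicator_def)
qed

text \<open>Fubini on the triangle \<open>s \<le> t\<close> inside the square. Since
  \<open>g\<close> is only integrable, its indefinite integral need not be differentiable at every
  point, which rules out the product rule.\<close>

lemma set_integral_by_parts_Icc:
  fixes g q q' :: "real \<Rightarrow> complex"
  assumes x: "0 \<le> x" and g: "set_integrable lborel {0..x} g"
    and q: "\<And>t. t \<in> {0..x} \<Longrightarrow> (q has_vector_derivative q' t) (at t within {0..x})"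
    and q': "continuous_on {0..x} q'"
  shows "(LINT t:{0..x}|lborel. (LINT s:{0..t}|lborel. g s) * q' t) =
    (LINT s:{0..x}|lborel. g s) * q x - (LINT t:{0..x}|lborel. g t * q t)"
proof -
  let ?I = "\<lambda>t. indicator {0..x} t :: real"
  define F where "F = (\<lambda>s t. indicat_real {(s,t). s \<le> t} (s,t) *\<^sub>R ((?I s *\<^sub>R g s) * (?I t *\<^sub>R q' t)))"
  have ig: "integrable lborel (\<lambda>s. ?I s *\<^sub>R g s)"
    using g by (simp add: set_integrable_def)
  have iq: "integrable lborel (\<lambda>s. ?I s *\<^sub>R q' s)"
    using borel_integrable_atLeastAtMost'[OF q'] by (simp add: set_integrable_def)
  have [measurable]: "(\<lambda>s. ?I s *\<^sub>R g s) \<in> borel_measurable borel" "(\<lambda>s. ?I s *\<^sub>R q' s) \<in> borel_measurable borel"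
    using ig iq by (auto dest: borel_measurable_integrable)
  have prod: "integrable (lborel \<Otimes>\<^sub>M lborel) (\<lambda>(s,t). (?I s *\<^sub>R g s) * (?I t *\<^sub>R q' t))"
  proof (rule lborel_pair.Fubini_integrable)
    show "(\<lambda>(s,t). (?I s *\<^sub>R g s) * (?I t *\<^sub>R q' t)) \<in> borel_measurable (lborel \<Otimes>\<^sub>M lborel)"
      by measurable
    show "integrable lborel (\<lambda>s. LINT t|lborel. norm (case (s,t) of (s,t) \<Rightarrow> (?I s *\<^sub>R g s) * (?I t *\<^sub>R q' t)))"
      by (simp only: prod.case norm_mult integral_mult_right_zero) (intro integrable_mult_left integrable_norm ig)
    show "AE s in lborel. integrable lborel (\<lambda>t. case (s,t) of (s,t) \<Rightarrow> (?I s *\<^sub>R g s) * (?I t *\<^sub>R q' t))"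
      by (simp only: prod.case) (intro AE_I2 integrable_mult_right impI iq)
  qed
  have tri: "{(s,t). s \<le> t} \<in> sets (borel \<Otimes>\<^sub>M (borel :: real measure))"
  proof -
    have "{p \<in> space (borel \<Otimes>\<^sub>M (borel :: real measure)). fst p \<le> snd p} \<in> sets (borel \<Otimes>\<^sub>M borel)"
      by measurable
    then show ?thesis by (simp add: space_pair_measure case_prod_unfold)
  qed
  have "integrable (lborel \<Otimes>\<^sub>M lborel) (case_prod F)"
  proof (rule Bochner_Integration.integrable_bound[OF prod])
    show "case_prod F \<in> borel_measurable (lborel \<Otimes>\<^sub>M lborel)"
      unfolding F_def using tri by measurable
    show "AE x in lborel \<Otimes>\<^sub>M lborel. norm (case_prod F x) \<le>
       norm (case x of (s,t) \<Rightarrow> (?I s *\<^sub>R g s) * (?I t *\<^sub>R q' t))"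
      by (auto intro!: AE_I2 simp: F_def indicator_def)
  qed
  then have eq: "(LINT t|lborel. LINT s|lborel. F s t) = (LINT s|lborel. LINT t|lborel. F s t)"
    by (rule lborel_pair.Fubini_integral)
  have "(LINT s|lborel. F s t) = ?I t *\<^sub>R ((LINT s:{0..t}|lborel. g s) * q' t)" for t
  proof -
    have "F s t = (indicat_real {0..t} s *\<^sub>R g s) * (?I t *\<^sub>R q' t)" for s
      by (auto simp: F_def indicator_def)
    then have "(LINT s|lborel. F s t) = (LINT s:{0..t}|lborel. g s) * (?I t *\<^sub>R q' t)"
      by (simp only: integral_mult_left_zero set_lebesgue_integral_def)
    then show ?thesis by simp
  qed
  then have L: "(LINT t|lborel. LINT s|lborel. F s t) = (LINT t:{0..x}|lborel. (LINT s:{0..t}|lborel. g s) * q' t)"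
    by (simp add: set_lebesgue_integral_def)
  have "(LINT t|lborel. F s t) = ?I s *\<^sub>R (g s * (q x - q s))" for s
  proof (cases "s \<in> {0..x}")
    case True
    have "F s t = g s * (indicat_real {s..x} t *\<^sub>R q' t)" for t
      using True by (auto simp: F_def indicator_def)
    then have "(LINT t|lborel. F s t) = g s * (LINT t|lborel. indicat_real {s..x} t *\<^sub>R q' t)"
      by (simp only: integral_mult_right_zero)
    also have "(LINT t|lborel. indicat_real {s..x} t *\<^sub>R q' t) = q x - q s"
    proof (rule integral_FTC_atLeastAtMost)
      show "s \<le> x" using True by simp
      show "continuous_on {s..x} q'" using q' by (rule continuous_on_subset) (use True in auto)
      show "(q has_vector_derivative q' t) (at t within {s..x})" if "s \<le> t" "t \<le> x" for t
        using q[of t] that True by (auto intro: has_vector_derivative_within_subset)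
    qed
    finally show ?thesis using True by simp
  qed (auto simp: F_def indicator_def)
  then have "(LINT s|lborel. LINT t|lborel. F s t) = (LINT s:{0..x}|lborel. g s * q x - g s * q s)"
    by (simp only: set_lebesgue_integral_def right_diff_distrib)
  also have "\<dots> = (LINT s:{0..x}|lborel. g s * q x) - (LINT s:{0..x}|lborel. g s * q s)"
  proof (rule set_integral_diff)
    show "set_integrable lborel {0..x} (\<lambda>s. g s * q x)" using g by simp
    show "set_integrable lborel {0..x} (\<lambda>s. g s * q s)"
      using q by (intro set_integrable_mult_continuous[OF g] continuous_on_vector_derivative) auto
  qed
  finally show ?thesis using eq L by simp
qed

section \<open>Green's identity on an edge\<close>

lemma H2_edge_derivative_continuous:
  assumes "H2_edge L f f' f''" 
  shows "continuous_on {0..L} f'"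
proof -
  have i: "set_integrable lborel {0..L} f''" and e: "\<And>x. x \<in> {0..L} \<Longrightarrow> f' x = f' 0 + (LINT t:{0..x}|lborel. f'' t)"
    using assms unfolding H2_edge_def by blast+
  have "f'' integrable_on {0..L}" using set_borel_integral_eq_integral(1)[OF i] .
  then have "continuous_on {0..L} (\<lambda>x. f' 0 + integral {0..x} f'')"
    by (intro continuous_intros indefinite_integral_continuous_1)
  moreover have "f' x = f' 0 + integral {0..x} f''" if "x \<in> {0..L}" for x
  proof -
    have "set_integrable lborel {0..x} f''"
      by (rule set_integrable_subset[OF i]) (use that in auto)
    from set_borel_integral_eq_integral(2)[OF this] show ?thesis using e[OF that] by metis
  qed
  ultimately show ?thesis by (rule continuous_on_eq[OF _ sym])
qed

text \<open>Integration by parts twice. The first moves a derivative off the merely integrable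
  \<open>f''\<close> and needs the triangle version; the second is the fundamental theorem for
  \<open>f * q'\<close>, which is continuously differentiable.\<close>

lemma H2_edge_Green:
  fixes q q' q'' :: "real \<Rightarrow> complex"
  assumes H: "H2_edge L f f' f''" and x: "x \<in> {0..L}"
    and q: "\<And>t. (q has_vector_derivative q' t) (at t)"
    and q': "\<And>t. (q' has_vector_derivative q'' t) (at t)"
    and q'': "continuous_on UNIV q''"
  shows "(LINT t:{0..x}|lborel. f'' t * q t) - (LINT t:{0..x}|lborel. f t * q'' t) =
    f' x * q x - f' 0 * q 0 - f x * q' x + f 0 * q' 0"
proof -
  have x0: "0 \<le> x" "x \<le> L" using x by auto
  have i: "set_integrable lborel {0..x} f''"
    by (rule set_integrable_subset[of _ "{0..L}"]) (use H x0 in \<open>auto simp: H2_edge_def\<close>)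
  have e: "\<And>t. t \<in> {0..x} \<Longrightarrow> f' t = f' 0 + (LINT t:{0..t}|lborel. f'' t)"
    and df: "\<And>t. t \<in> {0..x} \<Longrightarrow> (f has_vector_derivative f' t) (at t within {0..x})"
  proof -
    fix t assume t: "t \<in> {0..x}"
    then have "t \<in> {0..L}" using x0 by auto
    then show "f' t = f' 0 + (LINT t:{0..t}|lborel. f'' t)" using H unfolding H2_edge_def by blast
    have "(f has_vector_derivative f' t) (at t within {0..L})"
      using H \<open>t \<in> {0..L}\<close> unfolding H2_edge_def by blast
    then show "(f has_vector_derivative f' t) (at t within {0..x})"
      by (rule has_vector_derivative_within_subset) (use x0 in auto)
  qed
  have cf': "continuous_on {0..x} f'"
    using H2_edge_derivative_continuous[OF H] by (rule continuous_on_subset) (use x0 in auto)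
  have cf: "continuous_on {0..x} f" using df by (intro continuous_on_vector_derivative) auto
  have cq': "continuous_on {0..x} q'" and cq'': "continuous_on {0..x} q''"
    using continuous_on_vector_derivative[OF has_vector_derivative_at_within[OF q']]
      continuous_on_subset[OF q''] by auto
  have c1: "set_integrable lborel {0..x} (\<lambda>t. f' t * q' t)"
    and c2: "set_integrable lborel {0..x} (\<lambda>t. f t * q'' t)"
    and c3: "set_integrable lborel {0..x} q'"
    by (intro borel_integrable_atLeastAtMost' continuous_intros cf' cq' cf cq'')+
  have e1: "(LINT t:{0..x}|lborel. (LINT s:{0..t}|lborel. f'' s) * q' t) =
    (LINT s:{0..x}|lborel. f'' s) * q x - (LINT t:{0..x}|lborel. f'' t * q t)"
    by (rule set_integral_by_parts_Icc[OF x0(1) i _ cq']) (use q in \<open>auto intro: has_vector_derivative_at_within\<close>)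
  have e2: "(LINT t:{0..x}|lborel. (LINT s:{0..t}|lborel. f'' s) * q' t) =
     (LINT t:{0..x}|lborel. f' t * q' t - f' 0 * q' t)"
  proof (rule set_lebesgue_integral_cong)
    show "\<forall>t. t \<in> {0..x} \<longrightarrow> (LINT s:{0..t}|lborel. f'' s) * q' t = f' t * q' t - f' 0 * q' t"
    proof (intro allI impI)
      fix t assume "t \<in> {0..x}"
      from e[OF this] have "(LINT s:{0..t}|lborel. f'' s) = f' t - f' 0" by simp
      then show "(LINT s:{0..t}|lborel. f'' s) * q' t = f' t * q' t - f' 0 * q' t"
        by (simp add: left_diff_distrib)
    qed
  qed simp
  have e3: "(LINT t:{0..x}|lborel. f' t * q' t - f' 0 * q' t) = (LINT t:{0..x}|lborel. f' t * q' t) - f' 0 * (LINT t:{0..x}|lborel. q' t)"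
    using c1 c3 by (subst set_integral_diff) auto
  have e4: "(LINT t:{0..x}|lborel. q' t) = q x - q 0"
    unfolding set_lebesgue_integral_def
    by (rule integral_FTC_atLeastAtMost) (use x0 q cq' in \<open>auto intro: has_vector_derivative_at_within\<close>)
  have e5: "(LINT t:{0..x}|lborel. f' t * q' t + f t * q'' t) = f x * q' x - f 0 * q' 0"
    unfolding set_lebesgue_integral_def
  proof (rule integral_FTC_atLeastAtMost)
    show "((\<lambda>t. f t * q' t) has_vector_derivative f' t * q' t + f t * q'' t) (at t within {0..x})"
      if "0 \<le> t" "t \<le> x" for t
      using has_vector_derivative_mult[OF df[of t] has_vector_derivative_at_within[OF q'[of t]]] that
      by (auto simp: add.commute)
  qed (auto intro!: continuous_intros cf' cq' cf cq'' x0)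
  have e6: "(LINT t:{0..x}|lborel. f' t * q' t + f t * q'' t) =
     (LINT t:{0..x}|lborel. f' t * q' t) + (LINT t:{0..x}|lborel. f t * q'' t)"
    by (rule set_integral_add[OF c1 c2])
  have e7: "f' x = f' 0 + (LINT t:{0..x}|lborel. f'' t)" using e[of x] x0 by auto
  have X: "(LINT t:{0..x}|lborel. f'' t * q t) = (LINT s:{0..x}|lborel. f'' s) * q x
     - ((LINT t:{0..x}|lborel. f' t * q' t) - f' 0 * (q x - q 0))"
    using e1 unfolding e2 e3 e4 by simp
  have Z: "(LINT t:{0..x}|lborel. f t * q'' t) = f x * q' x - f 0 * q' 0 - (LINT t:{0..x}|lborel. f' t * q' t)"
    using e5 e6 by (simp add: eq_diff_eq add.commute)
  have P: "(LINT t:{0..x}|lborel. f'' t) = f' x - f' 0" using e7 by simp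
  show ?thesis unfolding X Z P by (simp add: algebra_simps)
qed

section \<open>The homogeneous edge equation\<close>

text \<open>Solutions of \<open>- y'' = lam * y\<close> normalised at \<open>0\<close>: value
  \<open>0\<close> and slope \<open>1\<close> for \<open>sn\<close>, value \<open>1\<close> and
  slope \<open>0\<close> for \<open>cs\<close>. The three branches form one function that is entire
  in \<open>lam\<close>.\<close>

definition sn :: "real \<Rightarrow> real \<Rightarrow> real" where
  "sn lam x = (if lam > 0 then sin (sqrt lam * x) / sqrt lam
     else if lam = 0 then x else sinh (sqrt (- lam) * x) / sqrt (- lam))"

definition cs :: "real \<Rightarrow> real \<Rightarrow> real" where
  "cs lam x = (if lam > 0 then cos (sqrt lam * x)
     else if lam = 0 then 1 else cosh (sqrt (- lam) * x))"

lemma sn_0 [simp]: "sn lam 0 = 0" and cs_0 [simp]: "cs lam 0 = 1"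
  by (auto simp: sn_def cs_def)

lemma sn_has_derivative: "(sn lam has_real_derivative cs lam x) (at x)"
proof -
  consider "lam > 0" | "lam = 0" | "lam < 0" by linarith
  then show ?thesis
  proof cases
    case 1
    then have "sn lam = (\<lambda>x. sin (sqrt lam * x) / sqrt lam)" by (auto simp: sn_def)
    with 1 show ?thesis by (auto simp: cs_def mult.assoc intro!: derivative_eq_intros)
  next
    case 2
    then have "sn lam = (\<lambda>x. x)" by (auto simp: sn_def)
    with 2 show ?thesis by (auto simp: cs_def intro!: derivative_eq_intros)
  next
    case 3
    then have "sn lam = (\<lambda>x. sinh (sqrt (-lam) * x) / sqrt (-lam))" by (auto simp: sn_def)
    with 3 show ?thesis by (auto simp: cs_def mult.assoc intro!: derivative_eq_intros)
  qed
qed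

lemma cs_has_derivative: "(cs lam has_real_derivative - lam * sn lam x) (at x)"
proof -
  consider "lam > 0" | "lam = 0" | "lam < 0" by linarith
  then show ?thesis
  proof cases
    case 1
    then have "cs lam = (\<lambda>x. cos (sqrt lam * x))" by (auto simp: cs_def)
    with 1 show ?thesis
      by (auto simp: sn_def real_div_sqrt mult.commute intro!: derivative_eq_intros)
         (metis less_eq_real_def real_div_sqrt times_divide_eq_left)
  next
    case 2
    then have "cs lam = (\<lambda>x. 1)" by (auto simp: cs_def)
    with 2 show ?thesis by auto
  next
    case 3
    then have "cs lam = (\<lambda>x. cosh (sqrt (-lam) * x))" by (auto simp: cs_def)
    moreover have "- lam * (sinh (sqrt (-lam) * x) / sqrt (-lam)) = sinh (sqrt (-lam) * x) * sqrt (-lam)"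
      using 3 real_div_sqrt[of "-lam"] by (metis less_eq_real_def mult.commute neg_0_less_iff_less times_divide_eq_right)
    ultimately show ?thesis using 3 by (auto simp: sn_def intro!: derivative_eq_intros)
  qed
qed

text \<open>The Wronskian of \<open>cs lam\<close> and \<open>sn lam\<close>, constant in
  \<open>x\<close>. Passing between the data at the two ends of an edge rests on this
  identity.\<close>

lemma cs_sn_square: "(cs lam x)\<^sup>2 + lam * (sn lam x)\<^sup>2 = 1"
proof -
  consider "lam > 0" | "lam = 0" | "lam < 0" by linarith
  then show ?thesis
    by cases (auto simp: sn_def cs_def power_divide cosh_square_eq)
qed

abbreviation csn :: "real \<Rightarrow> real \<Rightarrow> complex" where "csn lam x \<equiv> complex_of_real (sn lam x)"
abbreviation ccs :: "real \<Rightarrow> real \<Rightarrow> complex" where "ccs lam x \<equiv> complex_of_real (cs lam x)"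

lemma csn_has_vector_derivative: "(csn lam has_vector_derivative ccs lam x) (at x)"
  using sn_has_derivative[of lam x]
  by (intro bounded_linear.has_vector_derivative[OF bounded_linear_of_real])
     (simp add: has_real_derivative_iff_has_vector_derivative)

lemma ccs_has_vector_derivative: "(ccs lam has_vector_derivative - complex_of_real lam * csn lam x) (at x)"
proof -
  have "(ccs lam has_vector_derivative complex_of_real (- lam * sn lam x)) (at x)"
    using cs_has_derivative[of lam x]
    by (intro bounded_linear.has_vector_derivative[OF bounded_linear_of_real])
       (simp add: has_real_derivative_iff_has_vector_derivative)
  then show ?thesis by simp
qed

lemma ccs_csn_square: "ccs lam x * ccs lam x + complex_of_real lam * csn lam x * csn lam x = 1"
proof -
  have "complex_of_real ((cs lam x)\<^sup>2 + lam * (sn lam x)\<^sup>2) = 1" by (simp only: cs_sn_square of_real_1)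
  then show ?thesis by (simp add: power2_eq_square algebra_simps)
qed

lemma continuous_csn [continuous_intros]: "continuous_on A (csn lam)"
  and continuous_ccs [continuous_intros]: "continuous_on A (ccs lam)"
  using csn_has_vector_derivative ccs_has_vector_derivative
  by (meson continuous_on_vector_derivative has_vector_derivative_at_within)+

section \<open>Mean-square estimates on an edge\<close>

lemma sq_int_bounded:
  assumes m: "set_borel_measurable lborel {0..L} f" and h: "set_integrable lborel {0..L} h"
    and le: "\<And>t. t \<in> {0..L} \<Longrightarrow> (cmod (f t))\<^sup>2 \<le> h t"
  shows "sq_int L f" "edge_norm2 L f \<le> (LINT t:{0..L}|lborel. h t)"
proof -
  have [measurable]: "(\<lambda>x. indicat_real {0..L} x *\<^sub>R f x) \<in> borel_measurable borel"
    using m by (simp add: set_borel_measurable_def)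
  have "(\<lambda>x. (cmod (indicat_real {0..L} x *\<^sub>R f x))\<^sup>2) \<in> borel_measurable borel" by measurable
  moreover have "(\<lambda>x. (cmod (indicat_real {0..L} x *\<^sub>R f x))\<^sup>2) = (\<lambda>x. indicat_real {0..L} x *\<^sub>R (cmod (f x))\<^sup>2)"
    by (auto simp: indicator_def)
  ultimately have m2: "set_borel_measurable lborel {0..L} (\<lambda>x. (cmod (f x))\<^sup>2)"
    by (simp add: set_borel_measurable_def)
  have i: "set_integrable lborel {0..L} (\<lambda>x. (cmod (f x))\<^sup>2)"
    by (rule set_integrable_bound[OF h m2]) (use le in \<open>auto intro!: AE_I2 order_trans[OF _ abs_ge_self]\<close>)
  then show "sq_int L f" using m by (simp add: sq_int_def)
  show "edge_norm2 L f \<le> (LINT t:{0..L}|lborel. h t)"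
    unfolding edge_norm2_def by (rule set_integral_mono[OF i h le])
qed

lemma cmod_add_square_le: "(cmod (x + y))\<^sup>2 \<le> 2 * (cmod x)\<^sup>2 + 2 * (cmod y)\<^sup>2"
proof -
  have "(cmod (x + y))\<^sup>2 \<le> (cmod x + cmod y)\<^sup>2" by (simp add: norm_triangle_ineq power_mono)
  also have "\<dots> \<le> 2 * (cmod x)\<^sup>2 + 2 * (cmod y)\<^sup>2"
    using sum_squares_bound[of "cmod x" "cmod y"] by (simp add: power2_sum)
  finally show ?thesis .
qed

lemma sq_int_linear_combination:
  assumes f: "sq_int L f" and g: "sq_int L g"
  shows "sq_int L (\<lambda>t. c * f t + d * g t)"
    and "edge_norm2 L (\<lambda>t. c * f t + d * g t) \<le> 2 * (cmod c)\<^sup>2 * edge_norm2 L f + 2 * (cmod d)\<^sup>2 * edge_norm2 L g"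
proof -
  have m: "set_borel_measurable lborel {0..L} (\<lambda>t. c * f t + d * g t)"
  proof -
    have [measurable]: "(\<lambda>x. indicat_real {0..L} x *\<^sub>R f x) \<in> borel_measurable borel"
      "(\<lambda>x. indicat_real {0..L} x *\<^sub>R g x) \<in> borel_measurable borel"
      using f g by (simp_all add: sq_int_def set_borel_measurable_def)
    have "(\<lambda>x. c * (indicat_real {0..L} x *\<^sub>R f x) + d * (indicat_real {0..L} x *\<^sub>R g x)) \<in> borel_measurable borel"
      by measurable
    moreover have "(\<lambda>x. c * (indicat_real {0..L} x *\<^sub>R f x) + d * (indicat_real {0..L} x *\<^sub>R g x))
      = (\<lambda>x. indicat_real {0..L} x *\<^sub>R (c * f x + d * g x))"
      by (auto simp: indicator_def)
    ultimately show ?thesis by (simp add: set_borel_measurable_def)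
  qed
  have i: "set_integrable lborel {0..L} (\<lambda>t. (cmod (f t))\<^sup>2)" "set_integrable lborel {0..L} (\<lambda>t. (cmod (g t))\<^sup>2)"
    using f g by (auto simp: sq_int_def)
  have h: "set_integrable lborel {0..L} (\<lambda>t. 2 * (cmod c)\<^sup>2 * (cmod (f t))\<^sup>2 + 2 * (cmod d)\<^sup>2 * (cmod (g t))\<^sup>2)"
    by (intro set_integral_add set_integrable_mult_right impI i)
  have le: "(cmod (c * f t + d * g t))\<^sup>2 \<le> 2 * (cmod c)\<^sup>2 * (cmod (f t))\<^sup>2 + 2 * (cmod d)\<^sup>2 * (cmod (g t))\<^sup>2" for t
    using cmod_add_square_le[of "c * f t" "d * g t"] by (simp add: norm_mult power_mult_distrib algebra_simps)
  show "sq_int L (\<lambda>t. c * f t + d * g t)" by (rule sq_int_bounded(1)[OF m h le])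
  have "edge_norm2 L (\<lambda>t. c * f t + d * g t) \<le> (LINT t:{0..L}|lborel. 2 * (cmod c)\<^sup>2 * (cmod (f t))\<^sup>2 + 2 * (cmod d)\<^sup>2 * (cmod (g t))\<^sup>2)"
    by (rule sq_int_bounded(2)[OF m h le])
  also have "\<dots> = 2 * (cmod c)\<^sup>2 * edge_norm2 L f + 2 * (cmod d)\<^sup>2 * edge_norm2 L g"
    unfolding edge_norm2_def using i by (subst set_integral_add) auto
  finally show "edge_norm2 L (\<lambda>t. c * f t + d * g t) \<le> 2 * (cmod c)\<^sup>2 * edge_norm2 L f + 2 * (cmod d)\<^sup>2 * edge_norm2 L g" .
qed

lemma set_borel_measurable_continuous_Icc:
  "continuous_on {0..L} f \<Longrightarrow> set_borel_measurable lborel {0..L} f"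
  for f :: "real \<Rightarrow> complex"
  using borel_integrable_atLeastAtMost'[of 0 L f]
  by (auto simp: set_integrable_def set_borel_measurable_def dest: borel_measurable_integrable)

lemma sq_int_continuous:
  assumes c: "continuous_on {0..L} f" and L: "0 \<le> L"
  shows "sq_int L f" and "(\<And>t. t \<in> {0..L} \<Longrightarrow> (cmod (f t))\<^sup>2 \<le> B) \<Longrightarrow> edge_norm2 L f \<le> L * B"
proof -
  show "sq_int L f"
    by (rule sq_int_bounded(1)[OF set_borel_measurable_continuous_Icc[OF c]
          borel_integrable_atLeastAtMost'[of _ _ "\<lambda>t. (cmod (f t))\<^sup>2"]])
       (auto intro!: continuous_intros c)
  assume B: "\<And>t. t \<in> {0..L} \<Longrightarrow> (cmod (f t))\<^sup>2 \<le> B"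
  have "edge_norm2 L f \<le> (LINT t:{0..L}|lborel. B)"
    by (rule sq_int_bounded(2)[OF set_borel_measurable_continuous_Icc[OF c] _ B])
       (auto intro!: borel_integrable_atLeastAtMost')
  also have "\<dots> = L * B" using L by (simp add: set_lebesgue_integral_def)
  finally show "edge_norm2 L f \<le> L * B" .
qed

lemma edge_norm2_nonneg [simp]: "0 \<le> edge_norm2 L f"
  unfolding edge_norm2_def set_lebesgue_integral_def by (rule Bochner_Integration.integral_nonneg) simp

lemma sq_int_set_integrable:
  assumes f: "sq_int L f"
  shows "set_integrable lborel {0..L} f"
proof -
  have "set_integrable lborel {0..L} (\<lambda>t. 1 + (cmod (f t))\<^sup>2)"
    by (rule set_integral_add) (use f in \<open>auto simp: sq_int_def intro!: borel_integrable_atLeastAtMost'\<close>)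
  then show ?thesis
  proof (rule set_integrable_bound)
    show "set_borel_measurable lborel {0..L} f" using f by (simp add: sq_int_def)
    have "cmod (f x) \<le> 1 + (cmod (f x))\<^sup>2" for x
      using sum_squares_bound[of "cmod (f x)" 1] norm_ge_zero[of "f x"] by (simp, smt (verit) zero_le_power2)
    then show "AE x\<in>{0..L} in lborel. norm (f x) \<le> norm (1 + (cmod (f x))\<^sup>2)"
      by (intro AE_I2) (auto intro: order_trans[OF _ abs_ge_self])
  qed
qed

text \<open>Integrate \<open>2 m \<bar>f\<bar> \<le> m\<^sup>2 + \<bar>f\<bar>\<^sup>2\<close>, with \<open>m\<close> the mean of \<open>\<bar>f\<bar>\<close>.\<close>

lemma L1_le_L2:
  assumes f: "sq_int L f" and L: "0 < L"
  shows "(LINT t:{0..L}|lborel. cmod (f t))\<^sup>2 \<le> L * edge_norm2 L f"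
proof -
  define m where "m = (LINT t:{0..L}|lborel. cmod (f t)) / L"
  have i1: "set_integrable lborel {0..L} (\<lambda>t. cmod (f t))"
    using sq_int_set_integrable[OF f] by (simp add: set_integrable_def) (drule integrable_norm, simp)
  have i2: "set_integrable lborel {0..L} (\<lambda>t. (cmod (f t))\<^sup>2)" using f by (simp add: sq_int_def)
  have i3: "set_integrable lborel {0..L} (\<lambda>t. m\<^sup>2)" by (rule borel_integrable_atLeastAtMost') auto
  have "2 * m * (LINT t:{0..L}|lborel. cmod (f t)) = (LINT t:{0..L}|lborel. 2 * m * cmod (f t))" by simp
  also have "\<dots> \<le> (LINT t:{0..L}|lborel. m\<^sup>2 + (cmod (f t))\<^sup>2)"
    by (rule set_integral_mono) (use i1 i2 i3 sum_squares_bound[of m] in auto)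
  also have "\<dots> = (LINT t:{0..L}|lborel. m\<^sup>2) + edge_norm2 L f"
    unfolding edge_norm2_def by (rule set_integral_add[OF i3 i2])
  also have "(LINT t:{0..L}|lborel. m\<^sup>2) = L * m\<^sup>2" using L by (simp add: set_lebesgue_integral_def)
  finally have "2 * m * (L * m) \<le> L * m\<^sup>2 + edge_norm2 L f" using L by (simp add: m_def)
  then have "L * m\<^sup>2 \<le> edge_norm2 L f" by (simp add: power2_eq_square)
  then have "L * (L * m\<^sup>2) \<le> L * edge_norm2 L f" using L by simp
  moreover have "L * (L * m\<^sup>2) = (L * m)\<^sup>2" by (simp add: power2_eq_square)
  moreover have "L * m = (LINT t:{0..L}|lborel. cmod (f t))" using L by (simp add: m_def)
  ultimately show ?thesis by simp
qed

text \<open>Cauchy-Schwarz in the form used for the moments of a source; the bound is uniform in the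
  upper limit \<open>x\<close>, as an estimate over the whole edge requires.\<close>

lemma integral_mult_bounded_square_le:
  assumes f: "sq_int L f" and L: "0 < L" and q: "continuous_on {0..L} q"
    and B: "\<And>t. t \<in> {0..L} \<Longrightarrow> cmod (q t) \<le> B" and x: "x \<in> {0..L}"
  shows "(cmod (LINT t:{0..x}|lborel. f t * q t))\<^sup>2 \<le> B\<^sup>2 * L * edge_norm2 L f"
proof -
  have B0: "0 \<le> B" using B[of 0] L by (auto intro: order_trans[OF norm_ge_zero])
  have fi: "set_integrable lborel {0..L} f" by (rule sq_int_set_integrable[OF f])
  have i1: "set_integrable lborel {0..L} (\<lambda>t. cmod (f t))"
    using fi by (simp add: set_integrable_def) (drule integrable_norm, simp)
  have s: "set_integrable lborel {0..x} (\<lambda>t. f t * q t)"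
    by (rule set_integrable_subset[OF set_integrable_mult_continuous[OF fi q]]) (use x in auto)
  have "cmod (LINT t:{0..x}|lborel. f t * q t) \<le> (LINT t|lborel. cmod (indicat_real {0..x} t *\<^sub>R (f t * q t)))"
    unfolding set_lebesgue_integral_def by (rule integral_norm_bound)
  also have "\<dots> \<le> (LINT t|lborel. indicat_real {0..L} t *\<^sub>R (B * cmod (f t)))"
  proof (rule integral_mono)
    show "integrable lborel (\<lambda>t. cmod (indicat_real {0..x} t *\<^sub>R (f t * q t)))"
      using s by (simp only: set_integrable_def integrable_norm)
    have "set_integrable lborel {0..L} (\<lambda>t. B * cmod (f t))" using i1 by simp
    then show "integrable lborel (\<lambda>t. indicat_real {0..L} t *\<^sub>R (B * cmod (f t)))" by (simp add: set_integrable_def)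
    show "cmod (indicat_real {0..x} t *\<^sub>R (f t * q t)) \<le> indicat_real {0..L} t *\<^sub>R (B * cmod (f t))" for t
      using B[of t] x B0 mult_right_mono[OF B[of t] norm_ge_zero[of "f t"]]
      by (auto simp: indicator_def norm_mult mult.commute)
  qed
  also have "\<dots> = B * (LINT t:{0..L}|lborel. cmod (f t))"
    by (simp only: set_integral_mult_right flip: set_lebesgue_integral_def)
  finally have "(cmod (LINT t:{0..x}|lborel. f t * q t))\<^sup>2 \<le> (B * (LINT t:{0..L}|lborel. cmod (f t)))\<^sup>2"
    by (rule power_mono) simp
  also have "\<dots> \<le> B\<^sup>2 * (L * edge_norm2 L f)"
    unfolding power_mult_distrib by (rule mult_left_mono[OF L1_le_L2[OF f L]]) simp
  finally show ?thesis by (simp add: mult.assoc)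
qed

lemma continuous_Icc_bounded:
  fixes q :: "real \<Rightarrow> complex"
  assumes "continuous_on {0..L} q"
  obtains B where "0 \<le> B" "\<And>t. t \<in> {0..L} \<Longrightarrow> cmod (q t) \<le> B"
proof -
  obtain B where "\<forall>y\<in>q ` {0..L}. norm y \<le> B"
    using compact_imp_bounded[OF compact_continuous_image[OF assms compact_Icc]]
    unfolding bounded_iff by blast
  then show ?thesis by (intro that[of "max 0 B"]) (auto simp: le_max_iff_disj)
qed

lemma H2_edge_continuous:
  assumes "H2_edge L f f' f''"
  shows "continuous_on {0..L} f"
  using assms unfolding H2_edge_def by (intro continuous_on_vector_derivative) blast

section \<open>The inhomogeneous edge equation\<close>

text \<open>\<open>g\<close> is \<open>(H - lam) f\<close> on one edge, an identity that makes sense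
  only almost everywhere; \<open>f'\<close> and \<open>f''\<close> are carried along as
  witnesses.\<close>

definition edge_eq :: "real \<Rightarrow> real \<Rightarrow> (real \<Rightarrow> complex) \<Rightarrow> (real \<Rightarrow> complex) \<Rightarrow> (real \<Rightarrow> complex) \<Rightarrow> (real \<Rightarrow> complex) \<Rightarrow> bool" where
  "edge_eq lam L g f f' f'' \<longleftrightarrow> H2_edge L f f' f'' \<and> sq_int L g \<and>
     (AE t in lborel. t \<in> {0..L} \<longrightarrow> g t = - f'' t - of_real lam * f t)"

lemma edge_eqD:
  assumes "edge_eq lam L g f f' f''"
  shows "H2_edge L f f' f''" "sq_int L g" "AE t in lborel. t \<in> {0..L} \<longrightarrow> g t = - f'' t - of_real lam * f t"
  using assms unfolding edge_eq_def by blast+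

text \<open>Testing against a continuous \<open>q\<close> turns the almost-everywhere equation into
  an exact identity that can be combined with Green's formula.\<close>

lemma integral_residual:
  fixes q :: "real \<Rightarrow> complex"
  assumes E: "edge_eq lam L g f f' f''"
    and q: "continuous_on {0..L} q" and x: "x \<in> {0..L}"
  shows "(LINT t:{0..x}|lborel. f'' t * q t) + of_real lam * (LINT t:{0..x}|lborel. f t * q t)
    = - (LINT t:{0..x}|lborel. g t * q t)"
proof -
  note H = edge_eqD(1)[OF E] and g = edge_eqD(2)[OF E] and ae = edge_eqD(3)[OF E]
  have s: "set_integrable lborel {0..x} h" if "set_integrable lborel {0..L} h" for h :: "real \<Rightarrow> complex"
    by (rule set_integrable_subset[OF that]) (use x in auto)
  have i1: "set_integrable lborel {0..x} (\<lambda>t. f'' t * q t)"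
    by (rule s, rule set_integrable_mult_continuous[OF _ q]) (use H in \<open>simp add: H2_edge_def\<close>)
  have i2: "set_integrable lborel {0..x} (\<lambda>t. f t * q t)"
    by (rule s, intro borel_integrable_atLeastAtMost' continuous_intros q H2_edge_continuous[OF H])
  have i3: "set_integrable lborel {0..x} (\<lambda>t. g t * q t)"
    by (rule s, rule set_integrable_mult_continuous[OF sq_int_set_integrable[OF g] q])
  have i4: "set_integrable lborel {0..x} (\<lambda>t. f'' t * q t + of_real lam * (f t * q t))"
    by (intro set_integral_add(1) i1 set_integrable_mult_right impI i2)
  have "(LINT t:{0..x}|lborel. f'' t * q t) + of_real lam * (LINT t:{0..x}|lborel. f t * q t)
    = (LINT t:{0..x}|lborel. f'' t * q t + of_real lam * (f t * q t))"
    using i1 i2 by (subst set_integral_add(2)) auto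
  also have "\<dots> = (LINT t:{0..x}|lborel. - (g t * q t))"
    unfolding set_lebesgue_integral_def
  proof (rule integral_cong_AE)
    show "(\<lambda>t. indicat_real {0..x} t *\<^sub>R (f'' t * q t + of_real lam * (f t * q t))) \<in> borel_measurable lborel"
      using i4 unfolding set_integrable_def by (rule borel_measurable_integrable)
    have "set_integrable lborel {0..x} (\<lambda>t. (-1) * (g t * q t))"
      by (intro set_integrable_mult_right impI i3)
    then show "(\<lambda>t. indicat_real {0..x} t *\<^sub>R (- (g t * q t))) \<in> borel_measurable lborel"
      unfolding set_integrable_def by (auto dest: borel_measurable_integrable)
    show "AE t in lborel. indicat_real {0..x} t *\<^sub>R (f'' t * q t + of_real lam * (f t * q t))
       = indicat_real {0..x} t *\<^sub>R (- (g t * q t))"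
      using ae
    proof eventually_elim
      case (elim t)
      have "f'' t * q t + of_real lam * (f t * q t) = - (g t * q t)" if "t \<in> {0..x}"
      proof -
        have "g t = - f'' t - of_real lam * f t" using elim that x by simp
        then show ?thesis by (simp only:) (simp add: algebra_simps)
      qed
      then show ?case by (auto simp: indicator_def)
    qed
  qed
  also have "\<dots> = - (LINT t:{0..x}|lborel. g t * q t)" using i3 by (rule set_integral_uminus)
  finally show ?thesis .
qed

lemma continuous_on_mult_of_real [continuous_intros]:
  "continuous_on A (\<lambda>t. c * csn lam t)" "continuous_on A (\<lambda>t. c * ccs lam t)"
  by (intro continuous_intros)+

text \<open>Variation of parameters, read off from Green's identity with the test functions \<open>sn\<close> and \<open>cs\<close>.\<close>

lemma H2_edge_variation_of_parameters:
  assumes E: "edge_eq lam L g f f' f''"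
    and x: "x \<in> {0..L}"
  defines "P \<equiv> (LINT t:{0..x}|lborel. g t * ccs lam t)" and "Q \<equiv> (LINT t:{0..x}|lborel. g t * csn lam t)"
  shows "f x = ccs lam x * (f 0 + Q) + csn lam x * (f' 0 - P)"
    and "f' x = ccs lam x * (f' 0 - P) - of_real lam * csn lam x * (f 0 + Q)"
proof -
  note H = edge_eqD(1)[OF E]
  let ?l = "complex_of_real lam" and ?C = "ccs lam x" and ?S = "csn lam x"
  have dS: "((\<lambda>t. - ?l * csn lam t) has_vector_derivative - ?l * ccs lam t) (at t)" for t
    by (rule has_vector_derivative_mult_right[OF csn_has_vector_derivative])
  have dC: "((\<lambda>t. - ?l * ccs lam t) has_vector_derivative - ?l * (- ?l * csn lam t)) (at t)" for t
    by (rule has_vector_derivative_mult_right[OF ccs_has_vector_derivative])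
  have "(LINT t:{0..x}|lborel. f'' t * csn lam t) - (LINT t:{0..x}|lborel. f t * (- ?l * csn lam t)) =
    f' x * csn lam x - f' 0 * csn lam 0 - f x * ccs lam x + f 0 * ccs lam 0"
    by (rule H2_edge_Green[OF H x csn_has_vector_derivative ccs_has_vector_derivative]) (intro continuous_intros)
  moreover have "(LINT t:{0..x}|lborel. f t * (- ?l * csn lam t)) = - ?l * (LINT t:{0..x}|lborel. f t * csn lam t)"
    by (simp flip: set_integral_mult_right add: mult.left_commute)
  ultimately have "(LINT t:{0..x}|lborel. f'' t * csn lam t) + ?l * (LINT t:{0..x}|lborel. f t * csn lam t) =
    f' x * ?S - f x * ?C + f 0" by simp
  then have 1: "f x * ?C - f' x * ?S = f 0 + Q"
    using integral_residual[OF E continuous_csn x] unfolding Q_def by (simp add: algebra_simps)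
  have "(LINT t:{0..x}|lborel. f'' t * ccs lam t) - (LINT t:{0..x}|lborel. f t * (- ?l * ccs lam t)) =
    f' x * ccs lam x - f' 0 * ccs lam 0 - f x * (- ?l * csn lam x) + f 0 * (- ?l * csn lam 0)"
    by (rule H2_edge_Green[OF H x ccs_has_vector_derivative dS]) (intro continuous_intros)
  moreover have "(LINT t:{0..x}|lborel. f t * (- ?l * ccs lam t)) = - ?l * (LINT t:{0..x}|lborel. f t * ccs lam t)"
    by (simp flip: set_integral_mult_right add: mult.left_commute)
  ultimately have "(LINT t:{0..x}|lborel. f'' t * ccs lam t) + ?l * (LINT t:{0..x}|lborel. f t * ccs lam t) =
    f' x * ?C - f' 0 + ?l * f x * ?S" by simp
  then have 2: "f' x * ?C + ?l * f x * ?S = f' 0 - P"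
    using integral_residual[OF E continuous_ccs x] unfolding P_def by (simp add: algebra_simps)
  have w: "?C * ?C + ?l * ?S * ?S = 1" by (rule ccs_csn_square)
  have "f x = f x * (?C * ?C + ?l * ?S * ?S)" using w by simp
  also have "\<dots> = ?C * (f x * ?C - f' x * ?S) + ?S * (f' x * ?C + ?l * f x * ?S)" by (simp add: algebra_simps)
  finally show "f x = ?C * (f 0 + Q) + ?S * (f' 0 - P)" unfolding 1 2 .
  have "f' x = f' x * (?C * ?C + ?l * ?S * ?S)" using w by simp
  also have "\<dots> = ?C * (f' x * ?C + ?l * f x * ?S) - ?l * ?S * (f x * ?C - f' x * ?S)" by (simp add: algebra_simps)
  finally show "f' x = ?C * (f' 0 - P) - ?l * ?S * (f 0 + Q)" unfolding 1 2 .
qed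

text \<open>The quantifier order matters: one \<open>K\<close> for all functions, so that the
  estimate can be summed over infinitely many edges. It follows from variation of parameters, whose
  coefficients are bounded on the edge.\<close>

lemma H2_edge_norm_bound:
  fixes lam L :: real
  assumes L: "0 < L"
  shows "\<exists>K\<ge>0. \<forall>g f f' f''. edge_eq lam L g f f' f'' \<longrightarrow> edge_norm2 L f \<le> K * ((cmod (f 0))\<^sup>2 + (cmod (f' 0))\<^sup>2 + edge_norm2 L g)"
proof -
  obtain B1 where B1: "0 \<le> B1" "\<And>t. t \<in> {0..L} \<Longrightarrow> cmod (csn lam t) \<le> B1"
    using continuous_Icc_bounded[OF continuous_csn] by blast
  obtain B2 where B2: "0 \<le> B2" "\<And>t. t \<in> {0..L} \<Longrightarrow> cmod (ccs lam t) \<le> B2"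
    using continuous_Icc_bounded[OF continuous_ccs] by blast
  define B where "B = max B1 B2"
  have B: "0 \<le> B" "\<And>t. t \<in> {0..L} \<Longrightarrow> cmod (csn lam t) \<le> B" "\<And>t. t \<in> {0..L} \<Longrightarrow> cmod (ccs lam t) \<le> B"
    using B1 B2 by (auto simp: B_def le_max_iff_disj)
  define K where "K = L * (4 * B\<^sup>2 + 8 * B\<^sup>2 * B\<^sup>2 * L)"
  show ?thesis
  proof (intro exI[of _ K] conjI allI impI)
    show "0 \<le> K" using L by (simp add: K_def)
    fix g f f' f''
    assume E: "edge_eq lam L g f f' f''"
    note H = edge_eqD(1)[OF E] and g = edge_eqD(2)[OF E]
    let ?N = "edge_norm2 L g"
    let ?M = "(cmod (f 0))\<^sup>2 + (cmod (f' 0))\<^sup>2 + ?N"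
    have "(cmod (f x))\<^sup>2 \<le> (4 * B\<^sup>2 + 8 * B\<^sup>2 * B\<^sup>2 * L) * ?M" if x: "x \<in> {0..L}" for x
    proof -
      define P where "P = (LINT t:{0..x}|lborel. g t * ccs lam t)"
      define Q where "Q = (LINT t:{0..x}|lborel. g t * csn lam t)"
      have P: "(cmod P)\<^sup>2 \<le> B\<^sup>2 * L * ?N" unfolding P_def
        by (rule integral_mult_bounded_square_le[OF g L continuous_ccs B(3) x])
      have Q: "(cmod Q)\<^sup>2 \<le> B\<^sup>2 * L * ?N" unfolding Q_def
        by (rule integral_mult_bounded_square_le[OF g L continuous_csn B(2) x])
      have c2: "(cmod (ccs lam x))\<^sup>2 \<le> B\<^sup>2" "(cmod (csn lam x))\<^sup>2 \<le> B\<^sup>2"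
        by (intro power_mono B(2,3) x norm_ge_zero)+
      have fx: "f x = ccs lam x * (f 0 + Q) + csn lam x * (f' 0 - P)"
        unfolding P_def Q_def by (rule H2_edge_variation_of_parameters(1)[OF E x])
      have 1: "(cmod (f 0 + Q))\<^sup>2 \<le> 2 * (cmod (f 0))\<^sup>2 + 2 * (B\<^sup>2 * L * ?N)"
        using cmod_add_square_le[of "f 0" Q] Q by linarith
      have 2: "(cmod (f' 0 - P))\<^sup>2 \<le> 2 * (cmod (f' 0))\<^sup>2 + 2 * (B\<^sup>2 * L * ?N)"
        using cmod_add_square_le[of "f' 0" "-P"] P by simp
      have "(cmod (f x))\<^sup>2 \<le> 2 * ((cmod (ccs lam x))\<^sup>2 * (cmod (f 0 + Q))\<^sup>2) + 2 * ((cmod (csn lam x))\<^sup>2 * (cmod (f' 0 - P))\<^sup>2)"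
        unfolding fx using cmod_add_square_le[of "ccs lam x * (f 0 + Q)" "csn lam x * (f' 0 - P)"]
        by (simp only: norm_mult power_mult_distrib)
      also have "\<dots> \<le> 2 * (B\<^sup>2 * (2 * (cmod (f 0))\<^sup>2 + 2 * (B\<^sup>2 * L * ?N))) + 2 * (B\<^sup>2 * (2 * (cmod (f' 0))\<^sup>2 + 2 * (B\<^sup>2 * L * ?N)))"
        by (intro add_mono mult_left_mono mult_mono c2 1 2) auto
      also have "\<dots> = 4 * B\<^sup>2 * ((cmod (f 0))\<^sup>2 + (cmod (f' 0))\<^sup>2) + 8 * B\<^sup>2 * B\<^sup>2 * L * ?N"
        by (simp add: algebra_simps)
      also have "\<dots> \<le> 4 * B\<^sup>2 * ?M + 8 * B\<^sup>2 * B\<^sup>2 * L * ?M"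
        by (rule add_mono; rule mult_left_mono) (use L in auto)
      also have "\<dots> = (4 * B\<^sup>2 + 8 * B\<^sup>2 * B\<^sup>2 * L) * ?M" by (rule distrib_right[symmetric])
      finally show ?thesis .
    qed
    then have "edge_norm2 L f \<le> L * ((4 * B\<^sup>2 + 8 * B\<^sup>2 * B\<^sup>2 * L) * ?M)"
      using L by (intro sq_int_continuous(2)[OF H2_edge_continuous[OF H]]) auto
    then show "edge_norm2 L f \<le> K * ?M" by (simp add: K_def mult.assoc)
  qed
qed

text \<open>Since \<open>q\<close> and \<open>q'\<close> vanish at \<open>L\<close>, Green's
  identity leaves only boundary terms at \<open>0\<close>; suitable \<open>q\<close> then isolate
  \<open>f 0\<close> or \<open>f' 0\<close>.\<close>

lemma H2_edge_pairing_bound: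
  fixes q q' q'' :: "real \<Rightarrow> complex"
  assumes L: "0 < L"
    and q: "\<And>t. (q has_vector_derivative q' t) (at t)"
    and q': "\<And>t. (q' has_vector_derivative q'' t) (at t)"
    and q'': "continuous_on UNIV q''"
    and z: "q L = 0" "q' L = 0"
  shows "\<exists>K\<ge>0. \<forall>g f f' f''. edge_eq lam L g f f' f'' \<longrightarrow> (cmod (f 0 * q' 0 - f' 0 * q 0))\<^sup>2 \<le> K * (edge_norm2 L f + edge_norm2 L g)"
proof -
  let ?l = "complex_of_real lam"
  have cq: "continuous_on {0..L} q" and cq'': "continuous_on {0..L} q''"
    using continuous_on_vector_derivative[OF has_vector_derivative_at_within[OF q]] continuous_on_subset[OF q''] by auto
  have cw: "continuous_on {0..L} (\<lambda>t. ?l * q t + q'' t)" by (intro continuous_intros cq cq'')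
  obtain B1 where B1: "0 \<le> B1" "\<And>t. t \<in> {0..L} \<Longrightarrow> cmod (q t) \<le> B1"
    using continuous_Icc_bounded[OF cq] by blast
  obtain B2 where B2: "0 \<le> B2" "\<And>t. t \<in> {0..L} \<Longrightarrow> cmod (?l * q t + q'' t) \<le> B2"
    using continuous_Icc_bounded[OF cw] by blast
  define K where "K = 2 * (B1\<^sup>2 * L) + 2 * (B2\<^sup>2 * L)"
  show ?thesis
  proof (intro exI[of _ K] conjI allI impI)
    show "0 \<le> K" using L by (simp add: K_def)
    fix g f f' f''
    assume E: "edge_eq lam L g f f' f''"
    note H = edge_eqD(1)[OF E] and g = edge_eqD(2)[OF E]
    have x: "L \<in> {0..L}" using L by auto
    have cf: "continuous_on {0..L} f" by (rule H2_edge_continuous[OF H])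
    have f: "sq_int L f" using sq_int_continuous(1)[OF cf] L by simp
    let ?X = "LINT t:{0..L}|lborel. f t * (?l * q t + q'' t)" and ?Y = "LINT t:{0..L}|lborel. g t * q t"
    have i1: "set_integrable lborel {0..L} (\<lambda>t. ?l * (f t * q t))"
      and i2: "set_integrable lborel {0..L} (\<lambda>t. f t * q'' t)"
      by (intro borel_integrable_atLeastAtMost' continuous_intros cf cq cq'')+
    have "?X = (LINT t:{0..L}|lborel. ?l * (f t * q t) + f t * q'' t)"
      by (simp add: algebra_simps)
    also have "\<dots> = ?l * (LINT t:{0..L}|lborel. f t * q t) + (LINT t:{0..L}|lborel. f t * q'' t)"
      using set_integral_add(2)[OF i1 i2] by simp
    finally have X: "?X = ?l * (LINT t:{0..L}|lborel. f t * q t) + (LINT t:{0..L}|lborel. f t * q'' t)" .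
    have "(LINT t:{0..L}|lborel. f'' t * q t) - (LINT t:{0..L}|lborel. f t * q'' t) = f 0 * q' 0 - f' 0 * q 0"
      using H2_edge_Green[OF H x q q' q''] z by simp
    moreover have "(LINT t:{0..L}|lborel. f'' t * q t) = - ?Y - ?l * (LINT t:{0..L}|lborel. f t * q t)"
      using integral_residual[OF E cq x] by (simp add: eq_diff_eq)
    ultimately have "f 0 * q' 0 - f' 0 * q 0 = - ?Y - ?X" unfolding X by (metis diff_diff_eq)
    then have "(cmod (f 0 * q' 0 - f' 0 * q 0))\<^sup>2 \<le> 2 * (cmod ?Y)\<^sup>2 + 2 * (cmod ?X)\<^sup>2"
      using cmod_add_square_le[of "- ?Y" "- ?X"] by simp
    also have "\<dots> \<le> 2 * (B1\<^sup>2 * L * edge_norm2 L g) + 2 * (B2\<^sup>2 * L * edge_norm2 L f)"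
      by (intro add_mono mult_left_mono integral_mult_bounded_square_le g f L cq cw B1 B2 x) auto
    also have "\<dots> \<le> K * (edge_norm2 L f + edge_norm2 L g)"
      using L by (simp add: K_def algebra_simps)
    finally show "(cmod (f 0 * q' 0 - f' 0 * q 0))\<^sup>2 \<le> K * (edge_norm2 L f + edge_norm2 L g)" .
  qed
qed

text \<open>The cubic Hermite polynomial with value \<open>0\<close> and slope \<open>1\<close> at
  \<open>0\<close> and a double zero at \<open>L\<close>.\<close>

definition ramp :: "real \<Rightarrow> real \<Rightarrow> complex" where "ramp L t = of_real (t * (1 - t / L)\<^sup>2)"
definition ramp' :: "real \<Rightarrow> real \<Rightarrow> complex" where "ramp' L t = of_real ((1 - t / L)\<^sup>2 - 2 * t / L * (1 - t / L))"
definition ramp'' :: "real \<Rightarrow> real \<Rightarrow> complex" where "ramp'' L t = of_real (- 4 / L * (1 - t / L) + 2 * t / L\<^sup>2)"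

lemma
  assumes L: "L \<noteq> 0"
  shows ramp_derivative: "(ramp L has_vector_derivative ramp' L t) (at t)"
  and ramp'_derivative: "(ramp' L has_vector_derivative ramp'' L t) (at t)"
  and ramp''_continuous: "continuous_on A (ramp'' L)"
  and ramp_ends: "ramp L 0 = 0" "ramp' L 0 = 1" "ramp L L = 0" "ramp' L L = 0"
proof -
  have "((\<lambda>t. t * (1 - t / L)\<^sup>2) has_real_derivative (1 - t / L)\<^sup>2 - 2 * t / L * (1 - t / L)) (at t)"
    by (use L in \<open>auto intro!: derivative_eq_intros simp: field_simps power2_eq_square\<close>)
  then show "(ramp L has_vector_derivative ramp' L t) (at t)"
    unfolding ramp_def ramp'_def
    by (intro bounded_linear.has_vector_derivative[OF bounded_linear_of_real])
       (simp add: has_real_derivative_iff_has_vector_derivative)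
  have "((\<lambda>t. (1 - t / L)\<^sup>2 - 2 * t / L * (1 - t / L)) has_real_derivative - 4 / L * (1 - t / L) + 2 * t / L\<^sup>2) (at t)"
    by (use L in \<open>auto intro!: derivative_eq_intros simp: field_simps power2_eq_square\<close>)
  then show "(ramp' L has_vector_derivative ramp'' L t) (at t)"
    unfolding ramp''_def ramp'_def
    by (intro bounded_linear.has_vector_derivative[OF bounded_linear_of_real])
       (simp add: has_real_derivative_iff_has_vector_derivative)
qed (use L in \<open>auto simp: ramp_def ramp'_def ramp''_def[abs_def] divide_inverse intro!: continuous_intros\<close>)

text \<open>The companion cubic, with value \<open>1\<close> and slope \<open>0\<close> at
  \<open>0\<close> and a double zero at \<open>L\<close>.\<close>

definition hat :: "real \<Rightarrow> real \<Rightarrow> complex" where "hat L t = of_real ((1 - t / L)\<^sup>2 * (1 + 2 * t / L))"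
definition hat' :: "real \<Rightarrow> real \<Rightarrow> complex" where "hat' L t = of_real (- 6 * t / L\<^sup>2 * (1 - t / L))"
definition hat'' :: "real \<Rightarrow> real \<Rightarrow> complex" where "hat'' L t = of_real (- 6 / L\<^sup>2 * (1 - t / L) + 6 * t / L ^ 3)"

lemma
  assumes L: "L \<noteq> 0"
  shows hat_derivative: "(hat L has_vector_derivative hat' L t) (at t)"
  and hat'_derivative: "(hat' L has_vector_derivative hat'' L t) (at t)"
  and hat''_continuous: "continuous_on A (hat'' L)"
  and hat_ends: "hat L 0 = 1" "hat' L 0 = 0" "hat L L = 0" "hat' L L = 0"
proof -
  have "((\<lambda>t. (1 - t / L)\<^sup>2 * (1 + 2 * t / L)) has_real_derivative - 6 * t / L\<^sup>2 * (1 - t / L)) (at t)"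
    by (use L in \<open>auto intro!: derivative_eq_intros simp: field_simps power2_eq_square\<close>)
  then show "(hat L has_vector_derivative hat' L t) (at t)"
    unfolding hat_def hat'_def
    by (intro bounded_linear.has_vector_derivative[OF bounded_linear_of_real])
       (simp add: has_real_derivative_iff_has_vector_derivative)
  have "((\<lambda>t. - 6 * t / L\<^sup>2 * (1 - t / L)) has_real_derivative - 6 / L\<^sup>2 * (1 - t / L) + 6 * t / L ^ 3) (at t)"
    by (use L in \<open>auto intro!: derivative_eq_intros simp: field_simps power2_eq_square power3_eq_cube\<close>)
  then show "(hat' L has_vector_derivative hat'' L t) (at t)"
    unfolding hat''_def hat'_def
    by (intro bounded_linear.has_vector_derivative[OF bounded_linear_of_real])
       (simp add: has_real_derivative_iff_has_vector_derivative)
qed (use L in \<open>auto simp: hat_def hat'_def hat''_def[abs_def] divide_inverse intro!: continuous_intros\<close>)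

text \<open>Converse of the norm bound: testing with \<open>ramp\<close> produces
  \<open>f 0\<close>, testing with \<open>hat\<close> produces \<open>- f' 0\<close>. This is what
  makes the vertex values of a domain element square summable.\<close>

lemma H2_edge_trace:
  fixes lam L :: real
  assumes L: "0 < L"
  shows "\<exists>K\<ge>0. \<forall>g f f' f''. edge_eq lam L g f f' f'' \<longrightarrow>
    (cmod (f 0))\<^sup>2 + (cmod (f' 0))\<^sup>2 \<le> K * (edge_norm2 L f + edge_norm2 L g)"
proof -
  have L0: "L \<noteq> 0" using L by simp
  note pair = H2_edge_pairing_bound[OF L, of _ _ _ lam]
  obtain K1 where K1: "0 \<le> K1" "\<And>g f f' f''. edge_eq lam L g f f' f'' \<Longrightarrow> (cmod (f 0))\<^sup>2 \<le> K1 * (edge_norm2 L f + edge_norm2 L g)"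
    using pair[OF ramp_derivative ramp'_derivative ramp''_continuous ramp_ends(3,4), OF L0 L0 L0 L0 L0]
    unfolding ramp_ends[OF L0] mult_zero_right mult_1_right diff_zero by blast
  obtain K2 where K2: "0 \<le> K2" "\<And>g f f' f''. edge_eq lam L g f f' f'' \<Longrightarrow> (cmod (f' 0))\<^sup>2 \<le> K2 * (edge_norm2 L f + edge_norm2 L g)"
    using pair[OF hat_derivative hat'_derivative hat''_continuous hat_ends(3,4), OF L0 L0 L0 L0 L0]
    unfolding hat_ends[OF L0] mult_zero_right mult_1_right diff_0 norm_minus_cancel by blast
  show ?thesis
    by (rule exI[of _ "K1 + K2"]) (use K1 K2 in \<open>auto simp: distrib_right intro: add_mono\<close>)
qed

lemma indefinite_integral_continuous_Icc:
  fixes h :: "real \<Rightarrow> complex"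
  assumes h: "set_integrable lborel {0..L} h"
  shows "continuous_on {0..L} (\<lambda>x. LINT t:{0..x}|lborel. h t)"
proof -
  have "continuous_on {0..L} (\<lambda>x. integral {0..x} h)"
    by (rule indefinite_integral_continuous_1[OF set_borel_integral_eq_integral(1)[OF h]])
  then show ?thesis
  proof (rule continuous_on_eq)
    fix x assume "x \<in> {0..L}"
    then have "set_integrable lborel {0..x} h" by (intro set_integrable_subset[OF h]) auto
    from set_borel_integral_eq_integral(2)[OF this]
    show "integral {0..x} h = (LINT t:{0..x}|lborel. h t)" by simp
  qed
qed

text \<open>The variation of parameters formula, now with arbitrary initial data. \<open>P\<close>
  and \<open>Q\<close> are only absolutely continuous, so the derivative formulas are checked in
  integrated form; differentiability of \<open>f\<close> then follows because \<open>f'\<close> is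
  continuous.\<close>

lemma H2_edge_solution:
  fixes A B :: complex and lam :: real
  assumes L: "0 < L" and g: "sq_int L g"
  defines "P \<equiv> \<lambda>x. LINT t:{0..x}|lborel. g t * ccs lam t" and "Q \<equiv> \<lambda>x. LINT t:{0..x}|lborel. g t * csn lam t"
  defines "f \<equiv> \<lambda>x. ccs lam x * (A + Q x) + csn lam x * (B - P x)"
    and "f' \<equiv> \<lambda>x. ccs lam x * (B - P x) - of_real lam * csn lam x * (A + Q x)"
  shows "H2_edge L f f' (\<lambda>x. - g x - of_real lam * f x)"
proof -
  let ?l = "complex_of_real lam"
  let ?C = "ccs lam" and ?S = "csn lam"
  have gi: "set_integrable lborel {0..L} g" by (rule sq_int_set_integrable[OF g])
  have cP: "continuous_on {0..L} P" and cQ: "continuous_on {0..L} Q"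
    unfolding P_def Q_def
    by (intro indefinite_integral_continuous_Icc set_integrable_mult_continuous[OF gi] continuous_csn continuous_ccs)+
  have cf: "continuous_on {0..L} f" and cf': "continuous_on {0..L} f'"
    unfolding f_def f'_def by (intro continuous_intros cP cQ)+
  have sf: "sq_int L f" using sq_int_continuous(1)[OF cf] L by simp
  have s'': "sq_int L (\<lambda>x. - g x - ?l * f x)"
    using sq_int_linear_combination(1)[OF g sf, of "-1" "-?l"] by simp
  have [simp]: "f 0 = A" "f' 0 = B" "P 0 = 0" "Q 0 = 0"
  proof -
    have z: "(LINT t:{0..0}|lborel. h t) = 0" for h :: "real \<Rightarrow> complex"
      unfolding set_lebesgue_integral_def
      by (rule integral_eq_zero_AE) (use AE_lborel_singleton[of "0::real"] in \<open>eventually_elim, auto simp: indicator_def\<close>)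
    show "P 0 = 0" "Q 0 = 0" unfolding P_def Q_def by (rule z)+
    then show "f 0 = A" "f' 0 = B" by (simp_all add: f_def f'_def)
  qed
  have main: "f x - A = (LINT t:{0..x}|lborel. f' t)"
      "f' x - B = (LINT t:{0..x}|lborel. - g t - ?l * f t)" if x: "x \<in> {0..L}" for x
  proof -
    have x0: "0 \<le> x" "x \<le> L" using x by auto
    have sub: "{0..x} \<subseteq> {0..L}" using x0 by auto
    have gx: "set_integrable lborel {0..x} g" by (rule set_integrable_subset[OF gi]) (use sub in auto)
    have cPx: "continuous_on {0..x} P" and cQx: "continuous_on {0..x} Q"
      using continuous_on_subset[OF _ sub] cP cQ by auto
    note int = set_integrable_mult_continuous[OF gx]
    have igC: "set_integrable lborel {0..x} (\<lambda>t. g t * ?C t)" and igS: "set_integrable lborel {0..x} (\<lambda>t. g t * ?S t)"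
      by (intro int continuous_csn continuous_ccs)+
    have dC: "(?C has_vector_derivative - ?l * ?S t) (at t within {0..x})"
      and dS: "(?S has_vector_derivative ?C t) (at t within {0..x})" for t
      by (rule has_vector_derivative_at_within[OF ccs_has_vector_derivative]
            has_vector_derivative_at_within[OF csn_has_vector_derivative])+
    \<comment> \<open>These four identities replace the product rule for \<open>P\<close> and
      \<open>Q\<close> times a fundamental solution.\<close>
    have bp: "(LINT t:{0..x}|lborel. P t * (- ?l * ?S t)) = P x * ?C x - (LINT t:{0..x}|lborel. g t * ?C t * ?C t)"
      "(LINT t:{0..x}|lborel. P t * ?C t) = P x * ?S x - (LINT t:{0..x}|lborel. g t * ?C t * ?S t)"
      "(LINT t:{0..x}|lborel. Q t * (- ?l * ?S t)) = Q x * ?C x - (LINT t:{0..x}|lborel. g t * ?S t * ?C t)"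
      "(LINT t:{0..x}|lborel. Q t * ?C t) = Q x * ?S x - (LINT t:{0..x}|lborel. g t * ?S t * ?S t)"
      unfolding P_def Q_def
      by (intro set_integral_by_parts_Icc x0 igC igS dC dS continuous_intros)+
    have iC: "(LINT t:{0..x}|lborel. ?C t) = ?S x" and iS: "(LINT t:{0..x}|lborel. - ?l * ?S t) = ?C x - 1"
      using integral_FTC_atLeastAtMost[OF x0(1) dS continuous_ccs] integral_FTC_atLeastAtMost[OF x0(1) dC continuous_on_mult_of_real(1)]
      by (simp_all add: set_lebesgue_integral_def)
    have i: "set_integrable lborel {0..x} (\<lambda>t. B * ?C t)" "set_integrable lborel {0..x} (\<lambda>t. P t * ?C t)"
      "set_integrable lborel {0..x} (\<lambda>t. A * (- ?l * ?S t))" "set_integrable lborel {0..x} (\<lambda>t. Q t * (- ?l * ?S t))"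
      "set_integrable lborel {0..x} (\<lambda>t. A * ?C t)" "set_integrable lborel {0..x} (\<lambda>t. Q t * ?C t)"
      "set_integrable lborel {0..x} (\<lambda>t. B * (- ?l * ?S t))" "set_integrable lborel {0..x} (\<lambda>t. P t * (- ?l * ?S t))"
      by (intro borel_integrable_atLeastAtMost' continuous_intros cPx cQx)+
    have "(LINT t:{0..x}|lborel. f' t) = (LINT t:{0..x}|lborel. (B * ?C t - P t * ?C t) + (A * (- ?l * ?S t) + Q t * (- ?l * ?S t)))"
      unfolding f'_def by (simp add: algebra_simps)
    also have "\<dots> = (B * (LINT t:{0..x}|lborel. ?C t) - (LINT t:{0..x}|lborel. P t * ?C t)) +
        (A * (LINT t:{0..x}|lborel. - ?l * ?S t) + (LINT t:{0..x}|lborel. Q t * (- ?l * ?S t)))"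
      using i by (simp only: set_integral_add set_integral_diff set_integral_mult_right)
    also have "\<dots> = f x - A"
      unfolding bp iC iS f_def by (simp add: algebra_simps)
    finally show "f x - A = (LINT t:{0..x}|lborel. f' t)" by simp
    have iCC: "set_integrable lborel {0..x} (\<lambda>t. g t * ?C t * ?C t)" and iSS: "set_integrable lborel {0..x} (\<lambda>t. ?l * (g t * ?S t * ?S t))"
      using set_integrable_mult_continuous[OF igC continuous_ccs] set_integrable_mult_continuous[OF igS continuous_csn] by auto
    \<comment> \<open>Splitting \<open>g\<close> by the Wronskian identity matches the quadratic
      terms left over from \<open>bp\<close>.\<close>
    have "g t = g t * (?C t * ?C t + ?l * ?S t * ?S t)" for t by (simp add: ccs_csn_square)
    then have "(LINT t:{0..x}|lborel. g t) = (LINT t:{0..x}|lborel. g t * ?C t * ?C t + ?l * (g t * ?S t * ?S t))"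
      by (simp add: algebra_simps)
    also have "\<dots> = (LINT t:{0..x}|lborel. g t * ?C t * ?C t) + ?l * (LINT t:{0..x}|lborel. g t * ?S t * ?S t)"
      using iCC iSS by (simp only: set_integral_add set_integral_mult_right)
    finally have ig: "(LINT t:{0..x}|lborel. g t) = (LINT t:{0..x}|lborel. g t * ?C t * ?C t) + ?l * (LINT t:{0..x}|lborel. g t * ?S t * ?S t)" .
    have i': "set_integrable lborel {0..x} (\<lambda>t. ?l * (A * ?C t + Q t * ?C t))"
      by (intro borel_integrable_atLeastAtMost' continuous_intros cPx cQx)
    have i'': "set_integrable lborel {0..x} (\<lambda>t. - g t)"
      using set_integrable_mult_right[of "-1::complex" lborel "{0..x}" g] gx by simp
    have "- g t - ?l * f t = (- g t - ?l * (A * ?C t + Q t * ?C t)) + (B * (- ?l * ?S t) - P t * (- ?l * ?S t))" for t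
      unfolding f_def by (simp add: algebra_simps)
    then have "(LINT t:{0..x}|lborel. - g t - ?l * f t) =
       (LINT t:{0..x}|lborel. (- g t - ?l * (A * ?C t + Q t * ?C t)) + (B * (- ?l * ?S t) - P t * (- ?l * ?S t)))"
      by (simp only:)
    also have "\<dots> = (- (LINT t:{0..x}|lborel. g t) - ?l * (A * (LINT t:{0..x}|lborel. ?C t) + (LINT t:{0..x}|lborel. Q t * ?C t))) +
        (B * (LINT t:{0..x}|lborel. - ?l * ?S t) - (LINT t:{0..x}|lborel. P t * (- ?l * ?S t)))"
      using i i' i'' gx by (simp only: set_integral_add set_integral_diff set_integral_mult_right set_integral_uminus)
    also have "\<dots> = f' x - B"
      unfolding bp iC iS ig f'_def by (simp add: algebra_simps)
    finally show "f' x - B = (LINT t:{0..x}|lborel. - g t - ?l * f t)" by simp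
  qed
  have der: "(f has_vector_derivative f' x) (at x within {0..L})" if x: "x \<in> {0..L}" for x
  proof -
    have "((\<lambda>u. A + integral {0..u} f') has_vector_derivative 0 + f' x) (at x within {0..L})"
      by (intro has_vector_derivative_add has_vector_derivative_const integral_has_vector_derivative cf' x)
    then have d: "((\<lambda>u. A + integral {0..u} f') has_vector_derivative f' x) (at x within {0..L})" by simp
    show ?thesis
    proof (rule has_vector_derivative_transform[OF x _ d])
      fix u assume u: "u \<in> {0..L}"
      have "set_integrable lborel {0..u} f'"
        by (rule borel_integrable_atLeastAtMost'[OF continuous_on_subset[OF cf']]) (use u in auto)
      from set_borel_integral_eq_integral(2)[OF this] main(1)[OF u]
      show "f u = A + integral {0..u} f'" by (simp add: algebra_simps)
    qed
  qed
  have "f' x = f' 0 + (LINT t:{0..x}|lborel. - g t - ?l * f t)" if "x \<in> {0..L}" for x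
    using main(2)[OF that] by (simp add: algebra_simps)
  with der show ?thesis
    unfolding H2_edge_def using s'' sq_int_set_integrable[OF s''] by blast
qed

subsection \<open>Square-summable families\<close>

definition l2 :: "('a \<Rightarrow> complex) \<Rightarrow> bool" where
  "l2 u \<longleftrightarrow> (\<lambda>p. (cmod (u p))\<^sup>2) summable_on UNIV"

definition l2n :: "('a \<Rightarrow> complex) \<Rightarrow> real" where
  "l2n u = (\<Sum>\<^sub>\<infinity>p. (cmod (u p))\<^sup>2)"

lemma l2n_nonneg [simp]: "0 \<le> l2n u"
  unfolding l2n_def by (rule infsum_nonneg) simp

lemma l2_dominated:
  assumes "h summable_on UNIV" "\<And>p. (cmod (u p))\<^sup>2 \<le> h p"
  shows "l2 u" "l2n u \<le> infsum h UNIV"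
proof -
  show "l2 u" unfolding l2_def by (rule summable_on_comparison_test[OF assms(1)]) (use assms in auto)
  then show "l2n u \<le> infsum h UNIV" unfolding l2n_def l2_def by (intro infsum_mono assms) auto
qed

lemma l2_pointwise: "l2 u \<Longrightarrow> (cmod (u p))\<^sup>2 \<le> l2n u"
  unfolding l2_def l2n_def using finite_sum_le_infsum[of "\<lambda>p. (cmod (u p))\<^sup>2" UNIV "{p}"] by simp

lemma l2_cmult: "l2 u \<Longrightarrow> l2 (\<lambda>p. c * u p)" "l2n (\<lambda>p. c * u p) = (cmod c)\<^sup>2 * l2n u"
  unfolding l2_def l2n_def norm_mult power_mult_distrib
  by (auto intro: summable_on_cmult_right simp: infsum_cmult_right')

lemma l2_add:
  assumes "l2 u" "l2 v"
  shows "l2 (\<lambda>p. u p + v p)" "l2n (\<lambda>p. u p + v p) \<le> 2 * l2n u + 2 * l2n v"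
proof -
  have s: "(\<lambda>p. 2 * (cmod (u p))\<^sup>2 + 2 * (cmod (v p))\<^sup>2) summable_on UNIV"
    using assms unfolding l2_def by (intro summable_on_add summable_on_cmult_right)
  note * = l2_dominated[OF s, of "\<lambda>p. u p + v p", OF cmod_add_square_le]
  show "l2 (\<lambda>p. u p + v p)" by (rule *)
  have "infsum (\<lambda>p. 2 * (cmod (u p))\<^sup>2 + 2 * (cmod (v p))\<^sup>2) UNIV = 2 * l2n u + 2 * l2n v"
    using assms unfolding l2_def l2n_def
    by (subst infsum_add) (auto intro: summable_on_cmult_right simp: infsum_cmult_right')
  with *(2) show "l2n (\<lambda>p. u p + v p) \<le> 2 * l2n u + 2 * l2n v" by simp
qed

lemma summable_on_bij_comp:
  assumes "bij \<pi>"
  shows "(\<lambda>p. h (\<pi> p)) summable_on UNIV \<longleftrightarrow> h summable_on UNIV"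
    and "infsum (\<lambda>p. h (\<pi> p)) UNIV = infsum h UNIV"
  using assms summable_on_reindex_bij_betw[of \<pi> UNIV UNIV h] infsum_reindex_bij_betw[of \<pi> UNIV UNIV h] by auto

lemma bij_shifts:
  "bij (\<lambda>(m::int, n::int). (m + i, n + j))"
  by (rule bij_betw_byWitness[where f' = "\<lambda>(m, n). (m - i, n - j)"]) auto

section \<open>The weighted nearest neighbour operator\<close>

definition nbr_sum :: "real \<Rightarrow> real \<Rightarrow> (int \<times> int \<Rightarrow> complex) \<Rightarrow> int \<times> int \<Rightarrow> complex" where
  "nbr_sum c d u = (\<lambda>(m, n). of_real c * (u (m + 1, n) + u (m - 1, n)) + of_real d * (u (m, n + 1) + u (m, n - 1)))"

text \<open>Cauchy-Schwarz with weights \<open>c, c, d, d\<close>; the difference of the two sides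
  is the sum over the six pairs of weighted squared differences (Lagrange's identity).\<close>

lemma weighted_square_le:
  fixes c d :: real
  assumes "0 \<le> c" "0 \<le> d"
  shows "(c * (x1 + x2) + d * (x3 + x4))\<^sup>2 \<le> (2 * c + 2 * d) * (c * (x1\<^sup>2 + x2\<^sup>2) + d * (x3\<^sup>2 + x4\<^sup>2))"
proof -
  have "0 \<le> c * c * (x1 - x2)\<^sup>2 + c * d * (x1 - x3)\<^sup>2 + c * d * (x1 - x4)\<^sup>2 + c * d * (x2 - x3)\<^sup>2
    + c * d * (x2 - x4)\<^sup>2 + d * d * (x3 - x4)\<^sup>2"
    using assms by (intro add_nonneg_nonneg mult_nonneg_nonneg) auto
  also have "\<dots> = (2 * c + 2 * d) * (c * (x1\<^sup>2 + x2\<^sup>2) + d * (x3\<^sup>2 + x4\<^sup>2)) - (c * (x1 + x2) + d * (x3 + x4))\<^sup>2"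
    by (simp add: power2_eq_square algebra_simps)
  finally show ?thesis by simp
qed

text \<open>Schur test: the coefficients of the adjacency operator have total weight \<open>2\<bar>c\<bar> + 2\<bar>d\<bar>\<close>.\<close>

lemma nbr_sum_l2:
  assumes u: "l2 u"
  shows "l2 (nbr_sum c d u)" "l2n (nbr_sum c d u) \<le> (2 * \<bar>c\<bar> + 2 * \<bar>d\<bar>)\<^sup>2 * l2n u"
proof -
  let ?M = "2 * \<bar>c\<bar> + 2 * \<bar>d\<bar>"
  let ?v = "\<lambda>p. (cmod (u p))\<^sup>2"
  define h where "h = (\<lambda>p. ?M * (\<bar>c\<bar> * (?v ((\<lambda>(m,n). (m + 1, n + 0)) p) + ?v ((\<lambda>(m,n). (m + - 1, n + 0)) p))
     + \<bar>d\<bar> * (?v ((\<lambda>(m,n). (m + 0, n + 1)) p) + ?v ((\<lambda>(m,n). (m + 0, n + - 1)) p))))"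
  have s: "(\<lambda>p. ?v ((\<lambda>(m,n). (m + i, n + j)) p)) summable_on UNIV" for i j
    using u unfolding l2_def by (subst summable_on_bij_comp(1)[OF bij_shifts])
  have i: "infsum (\<lambda>p. ?v ((\<lambda>(m,n). (m + i, n + j)) p)) UNIV = l2n u" for i j
    unfolding l2n_def by (rule summable_on_bij_comp(2)[OF bij_shifts])
  have hs: "h summable_on UNIV"
    unfolding h_def by (intro summable_on_cmult_right summable_on_add s)
  have le: "(cmod (nbr_sum c d u p))\<^sup>2 \<le> h p" for p
  proof (cases p)
    case (Pair m n)
    have "cmod (nbr_sum c d u p) \<le> \<bar>c\<bar> * (cmod (u (m + 1, n)) + cmod (u (m - 1, n))) + \<bar>d\<bar> * (cmod (u (m, n + 1)) + cmod (u (m, n - 1)))"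
      unfolding nbr_sum_def Pair
      by (auto simp: norm_mult intro!: order_trans[OF norm_triangle_ineq] add_mono mult_left_mono norm_triangle_ineq)
    then have "(cmod (nbr_sum c d u p))\<^sup>2 \<le> (\<bar>c\<bar> * (cmod (u (m + 1, n)) + cmod (u (m - 1, n))) + \<bar>d\<bar> * (cmod (u (m, n + 1)) + cmod (u (m, n - 1))))\<^sup>2"
      by (rule power_mono) simp
    also have "\<dots> \<le> h p" unfolding h_def Pair
      using weighted_square_le[of "\<bar>c\<bar>" "\<bar>d\<bar>"] by simp
    finally show ?thesis .
  qed
  show "l2 (nbr_sum c d u)" by (rule l2_dominated(1)[OF hs le])
  have "infsum h UNIV = ?M * (\<bar>c\<bar> * (l2n u + l2n u) + \<bar>d\<bar> * (l2n u + l2n u))"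
    unfolding h_def by (simp only: infsum_cmult_right' infsum_add summable_on_add summable_on_cmult_right s i)
  also have "\<dots> = ?M\<^sup>2 * l2n u" by (simp add: power2_eq_square algebra_simps)
  finally show "l2n (nbr_sum c d u) \<le> ?M\<^sup>2 * l2n u" using l2_dominated(2)[OF hs le] by simp
qed

lemma nbr_sum_diff: "nbr_sum c d (\<lambda>p. u p - v p) p = nbr_sum c d u p - nbr_sum c d v p"
  by (cases p) (simp add: nbr_sum_def algebra_simps)

section \<open>Inverting a diagonally dominant difference operator\<close>

text \<open>Young's inequality with a free parameter: the fixed factor \<open>2\<close> of
  \<open>cmod_add_square_le\<close> would lose the strict inequality between the Schur bound and the
  diagonal.\<close>

lemma cmod_add_square_le_weighted:
  assumes e: "0 < (e::real)"
  shows "(cmod (x + y))\<^sup>2 \<le> (1 + e) * (cmod x)\<^sup>2 + (1 + 1 / e) * (cmod y)\<^sup>2"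
proof -
  have "(cmod (x + y))\<^sup>2 \<le> (cmod x + cmod y)\<^sup>2" by (simp add: norm_triangle_ineq power_mono)
  also have "\<dots> = (cmod x)\<^sup>2 + (cmod y)\<^sup>2 + 2 * cmod x * cmod y" by (simp add: power2_sum)
  also have "2 * cmod x * cmod y = 2 * (sqrt e * cmod x) * (cmod y / sqrt e)" using e by simp
  also have "\<dots> \<le> (sqrt e * cmod x)\<^sup>2 + (cmod y / sqrt e)\<^sup>2" by (rule sum_squares_bound)
  also have "\<dots> = e * (cmod x)\<^sup>2 + 1 / e * (cmod y)\<^sup>2" using e by (simp add: power_mult_distrib power_divide)
  finally show ?thesis by (simp add: algebra_simps)
qed

text \<open>The lower bound \<open>r\<close> is uniform over the vertices while \<open>D\<close> may
  vary, as it does at the chain.\<close>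

locale diagonally_dominant =
  fixes c d :: real and D :: "int \<times> int \<Rightarrow> real" and r :: real
  assumes dom: "2 * \<bar>c\<bar> + 2 * \<bar>d\<bar> < r" and D: "\<And>p. r \<le> \<bar>D p\<bar>"
begin

definition "M = 2 * \<bar>c\<bar> + 2 * \<bar>d\<bar>"
text \<open>Chosen so that \<open>(1 + eps) * M\<^sup>2\<close> is at most the midpoint of
  \<open>M\<^sup>2\<close> and \<open>r\<^sup>2\<close>; the \<open>+ 1\<close> in the denominator
  keeps it positive when \<open>M = 0\<close>. \<open>K\<close> is then the factor for which
  \<open>K * l2n \<rho>\<close> is the fixed point of the inequality in \<open>step\<close>.\<close>

definition "eps = (r\<^sup>2 - M\<^sup>2) / (2 * M\<^sup>2 + 1)"
definition "K = (1 + 1 / eps) * 2 / (r\<^sup>2 - M\<^sup>2)"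

lemma M_r: "0 \<le> M" "0 < r" "M < r" "0 < r\<^sup>2 - M\<^sup>2" "0 < eps" "0 \<le> K" "(1 + eps) * M\<^sup>2 \<le> (r\<^sup>2 + M\<^sup>2) / 2"
proof -
  show M: "0 \<le> M" "M < r" using dom by (auto simp: M_def)
  then show r: "0 < r" by simp
  show *: "0 < r\<^sup>2 - M\<^sup>2" using M by (simp add: power_strict_mono)
  have p: "0 < 2 * M\<^sup>2 + 1" by (simp add: add_nonneg_pos)
  show e: "0 < eps" unfolding eps_def using * p by simp
  show "0 \<le> K" unfolding K_def using * e by simp
  have "eps * M\<^sup>2 \<le> (r\<^sup>2 - M\<^sup>2) / 2"
    unfolding eps_def using * p by (simp add: field_simps)
  then show "(1 + eps) * M\<^sup>2 \<le> (r\<^sup>2 + M\<^sup>2) / 2" by (simp add: field_simps)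
qed

text \<open>With \<open>v = u\<close> this yields the a priori bound, with \<open>v\<close> the
  previous iterate the induction step for the Neumann series.\<close>

lemma step:
  assumes v: "l2 v" and rho: "l2 \<rho>" and eq: "\<And>p. of_real (D p) * u p = nbr_sum c d v p + \<rho> p"
  shows "l2 u" "r\<^sup>2 * l2n u \<le> (r\<^sup>2 + M\<^sup>2) / 2 * l2n v + (1 + 1 / eps) * l2n \<rho>"
proof -
  let ?h = "\<lambda>p. (1 + eps) * (cmod (nbr_sum c d v p))\<^sup>2 + (1 + 1 / eps) * (cmod (\<rho> p))\<^sup>2"
  have sn: "(\<lambda>p. (cmod (nbr_sum c d v p))\<^sup>2) summable_on UNIV" and sr: "(\<lambda>p. (cmod (\<rho> p))\<^sup>2) summable_on UNIV"
    using nbr_sum_l2(1)[OF v] rho by (auto simp: l2_def)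
  have hs: "?h summable_on UNIV" by (intro summable_on_add summable_on_cmult_right sn sr)
  have le: "(cmod (of_real r * u p))\<^sup>2 \<le> ?h p" for p
  proof -
    have "cmod (of_real r * u p) \<le> cmod (of_real (D p) * u p)"
      using D[of p] M_r(2) by (simp add: norm_mult mult_right_mono)
    then have "(cmod (of_real r * u p))\<^sup>2 \<le> (cmod (of_real (D p) * u p))\<^sup>2" by (rule power_mono) simp
    then show ?thesis unfolding eq using cmod_add_square_le_weighted[OF M_r(5)] by (rule order_trans)
  qed
  have "l2 (\<lambda>p. of_real r * u p)" by (rule l2_dominated(1)[OF hs le])
  from l2_cmult(1)[OF this, of "of_real (1 / r)"] show "l2 u" using M_r(2) by simp
  have "r\<^sup>2 * l2n u = l2n (\<lambda>p. of_real r * u p)" by (simp add: l2_cmult)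
  also have "\<dots> \<le> infsum ?h UNIV" by (rule l2_dominated(2)[OF hs le])
  also have "\<dots> = (1 + eps) * l2n (nbr_sum c d v) + (1 + 1 / eps) * l2n \<rho>"
    unfolding l2n_def by (simp only: infsum_cmult_right' infsum_add summable_on_cmult_right sn sr)
  also have "(1 + eps) * l2n (nbr_sum c d v) \<le> (1 + eps) * (M\<^sup>2 * l2n v)"
    unfolding M_def using M_r(5) by (intro mult_left_mono nbr_sum_l2(2) v) auto
  also have "\<dots> \<le> (r\<^sup>2 + M\<^sup>2) / 2 * l2n v"
    using mult_right_mono[OF M_r(7) l2n_nonneg[of v]] by (simp add: mult.assoc)
  finally show "r\<^sup>2 * l2n u \<le> (r\<^sup>2 + M\<^sup>2) / 2 * l2n v + (1 + 1 / eps) * l2n \<rho>" by simp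
qed

lemma K_eq: "(1 + 1 / eps) * x = (r\<^sup>2 - M\<^sup>2) / 2 * (K * x)"
proof -
  have "y * x = s / 2 * (y * 2 / s * x)" if "s \<noteq> 0" for y s :: real using that by simp
  then show ?thesis unfolding K_def using M_r(4) by (metis less_irrefl)
qed

lemma a_priori:
  assumes u: "l2 u" and rho: "l2 \<rho>" and eq: "\<And>p. of_real (D p) * u p = nbr_sum c d u p + \<rho> p"
  shows "l2n u \<le> K * l2n \<rho>"
proof -
  have "r\<^sup>2 * l2n u \<le> (r\<^sup>2 + M\<^sup>2) / 2 * l2n u + (r\<^sup>2 - M\<^sup>2) / 2 * (K * l2n \<rho>)"
    using step(2)[OF u rho eq] by (simp only: K_eq)
  then have "(r\<^sup>2 - M\<^sup>2) / 2 * l2n u \<le> (r\<^sup>2 - M\<^sup>2) / 2 * (K * l2n \<rho>)" by (simp add: field_simps)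
  then show ?thesis using M_r(4) by simp
qed

text \<open>Partial sums of the Neumann series, produced by the Jacobi iteration from
  \<open>0\<close>.\<close>

primrec iter :: "(int \<times> int \<Rightarrow> complex) \<Rightarrow> nat \<Rightarrow> int \<times> int \<Rightarrow> complex" where
  "iter \<rho> 0 = (\<lambda>p. 0)"
| "iter \<rho> (Suc j) = (\<lambda>p. (nbr_sum c d (iter \<rho> j) p + \<rho> p) / of_real (D p))"

lemma D_nonzero: "D p \<noteq> 0" using D[of p] M_r(2) by auto

lemma iter_l2:
  assumes rho: "l2 \<rho>"
  shows "l2 (iter \<rho> j) \<and> l2n (iter \<rho> j) \<le> K * l2n \<rho>"
proof (induction j)
  case 0
  show ?case using M_r(6) by (simp add: l2_def l2n_def[of "\<lambda>p. 0"])
next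
  case (Suc j)
  have eq: "of_real (D p) * iter \<rho> (Suc j) p = nbr_sum c d (iter \<rho> j) p + \<rho> p" for p
    using D_nonzero by simp
  note st = step[OF conjunct1[OF Suc.IH] rho, of "iter \<rho> (Suc j)", OF eq]
  have "r\<^sup>2 * l2n (iter \<rho> (Suc j)) \<le> (r\<^sup>2 + M\<^sup>2) / 2 * l2n (iter \<rho> j) + (r\<^sup>2 - M\<^sup>2) / 2 * (K * l2n \<rho>)"
    using st(2) by (simp only: K_eq)
  also have "\<dots> \<le> (r\<^sup>2 + M\<^sup>2) / 2 * (K * l2n \<rho>) + (r\<^sup>2 - M\<^sup>2) / 2 * (K * l2n \<rho>)"
    using Suc.IH by (intro add_right_mono mult_left_mono) auto
  also have "\<dots> = r\<^sup>2 * (K * l2n \<rho>)" by (simp add: field_simps)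
  finally have "l2n (iter \<rho> (Suc j)) \<le> K * l2n \<rho>" using M_r(2) by simp
  with st(1) show ?case by blast
qed

text \<open>The source \<open>\<rho>\<close> cancels in differences, so they contract by the full
  factor \<open>M / r\<close> in norm, with no loss from Young's inequality.\<close>

lemma iter_difference:
  assumes rho: "l2 \<rho>"
  shows "l2 (\<lambda>p. iter \<rho> (Suc j) p - iter \<rho> j p) \<and>
    l2n (\<lambda>p. iter \<rho> (Suc j) p - iter \<rho> j p) \<le> ((M / r)\<^sup>2) ^ j * l2n (iter \<rho> 1)"
proof (induction j)
  case 0
  show ?case using iter_l2[OF rho, of 1] by simp
next
  case (Suc j)
  let ?V = "\<lambda>j p. iter \<rho> (Suc j) p - iter \<rho> j p"
  have E: "of_real (D p) * iter \<rho> (Suc i) p = nbr_sum c d (iter \<rho> i) p + \<rho> p" for i p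
    using D_nonzero by simp
  have eq: "of_real (D p) * ?V (Suc j) p = nbr_sum c d (?V j) p" for p
    by (simp only: right_diff_distrib E nbr_sum_diff add_diff_cancel_right)
  have le: "(cmod (?V (Suc j) p))\<^sup>2 \<le> (1 / r\<^sup>2) * (cmod (nbr_sum c d (?V j) p))\<^sup>2" for p
  proof -
    have "r * cmod (?V (Suc j) p) \<le> cmod (nbr_sum c d (?V j) p)"
      unfolding eq[symmetric] norm_mult using D[of p] by (intro mult_right_mono) auto
    then have "(r * cmod (?V (Suc j) p))\<^sup>2 \<le> (cmod (nbr_sum c d (?V j) p))\<^sup>2"
      using M_r(2) by (intro power_mono) auto
    then have "r\<^sup>2 * (cmod (?V (Suc j) p))\<^sup>2 \<le> (cmod (nbr_sum c d (?V j) p))\<^sup>2" by (simp only: power_mult_distrib)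
    then have "(cmod (?V (Suc j) p))\<^sup>2 \<le> (cmod (nbr_sum c d (?V j) p))\<^sup>2 / r\<^sup>2"
      using M_r(2) by (simp only: pos_le_divide_eq zero_less_power mult.commute)
    then show ?thesis by (simp only: divide_inverse mult_1_left mult.commute)
  qed
  have nl: "l2 (nbr_sum c d (?V j))" "l2n (nbr_sum c d (?V j)) \<le> M\<^sup>2 * l2n (?V j)"
    using nbr_sum_l2[of "?V j" c d] Suc.IH unfolding M_def by auto
  have hs: "(\<lambda>p. (1 / r\<^sup>2) * (cmod (nbr_sum c d (?V j) p))\<^sup>2) summable_on UNIV"
    using nl(1) unfolding l2_def by (rule summable_on_cmult_right)
  have "l2n (?V (Suc j)) \<le> 1 / r\<^sup>2 * l2n (nbr_sum c d (?V j))"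
    using l2_dominated(2)[OF hs le] unfolding infsum_cmult_right' l2n_def .
  also have "\<dots> \<le> 1 / r\<^sup>2 * (M\<^sup>2 * l2n (?V j))"
    by (rule mult_left_mono[OF nl(2)]) simp
  also have "\<dots> \<le> 1 / r\<^sup>2 * (M\<^sup>2 * (((M / r)\<^sup>2) ^ j * l2n (iter \<rho> 1)))"
    by (rule mult_left_mono[OF mult_left_mono[OF conjunct2[OF Suc.IH]]]) simp_all
  also have "\<dots> = ((M / r)\<^sup>2) ^ Suc j * l2n (iter \<rho> 1)" by (simp add: power_divide)
  finally show ?case using l2_dominated(1)[OF hs le] by blast
qed

text \<open>The iterates converge at each vertex since their increments decay geometrically. Square
  summability passes to the limit as in Fatou's lemma, every finite sum inheriting the uniform
  bound; the equation does so because it involves only five vertices at a time.\<close>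

lemma solvable:
  assumes rho: "l2 \<rho>"
  obtains u where "l2 u" "\<And>p. of_real (D p) * u p = nbr_sum c d u p + \<rho> p"
proof -
  have conv: "convergent (\<lambda>j. iter \<rho> j p)" for p
  proof -
    let ?V = "\<lambda>j. iter \<rho> (Suc j) p - iter \<rho> j p"
    have V: "cmod (?V j) \<le> (M / r) ^ j * sqrt (l2n (iter \<rho> 1))" for j
    proof (rule power2_le_imp_le)
      have "(cmod (?V j))\<^sup>2 \<le> l2n (\<lambda>p. iter \<rho> (Suc j) p - iter \<rho> j p)"
        by (rule l2_pointwise[OF conjunct1[OF iter_difference[OF rho]]])
      also have "\<dots> \<le> ((M / r)\<^sup>2) ^ j * l2n (iter \<rho> 1)" using iter_difference[OF rho] by blast
      also have "\<dots> = ((M / r) ^ j * sqrt (l2n (iter \<rho> 1)))\<^sup>2"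
      proof -
        have "((M / r)\<^sup>2) ^ j = ((M / r) ^ j)\<^sup>2" by (metis mult.commute power_mult)
        then show ?thesis by (simp only: power_mult_distrib real_sqrt_pow2 l2n_nonneg)
      qed
      finally show "(cmod (?V j))\<^sup>2 \<le> ((M / r) ^ j * sqrt (l2n (iter \<rho> 1)))\<^sup>2" .
      show "0 \<le> (M / r) ^ j * sqrt (l2n (iter \<rho> 1))" using M_r by auto
    qed
    have g: "summable (\<lambda>j. (M / r) ^ j * sqrt (l2n (iter \<rho> 1)))"
      using M_r by (intro summable_mult2 summable_geometric) auto
    have "summable ?V" by (rule summable_comparison_test'[OF g, of 0]) (rule V)
    moreover have "(\<lambda>n. \<Sum>j<n. ?V j) = (\<lambda>n. iter \<rho> n p - iter \<rho> 0 p)"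
      by (rule ext, rule sum_lessThan_telescope)
    ultimately show ?thesis by (simp only: summable_iff_convergent iter.simps(1) diff_0_right)
  qed
  define u where "u = (\<lambda>p. lim (\<lambda>j. iter \<rho> j p))"
  have lim: "(\<lambda>j. iter \<rho> j p) \<longlonglongrightarrow> u p" for p
    using conv unfolding u_def convergent_LIMSEQ_iff .
  have "l2 u"
    unfolding l2_def
  proof (rule nonneg_bdd_above_summable_on)
    show "bdd_above (sum (\<lambda>p. (cmod (u p))\<^sup>2) ` {F. F \<subseteq> UNIV \<and> finite F})"
    proof (rule bdd_aboveI2)
      fix F :: "(int \<times> int) set" assume "F \<in> {F. F \<subseteq> UNIV \<and> finite F}"
      then have F: "finite F" by simp
      show "(\<Sum>p\<in>F. (cmod (u p))\<^sup>2) \<le> K * l2n \<rho>"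
      proof (rule tendsto_upperbound)
        show "(\<lambda>j. \<Sum>p\<in>F. (cmod (iter \<rho> j p))\<^sup>2) \<longlonglongrightarrow> (\<Sum>p\<in>F. (cmod (u p))\<^sup>2)"
          by (intro tendsto_intros lim)
        have "(\<Sum>p\<in>F. (cmod (iter \<rho> j p))\<^sup>2) \<le> l2n (iter \<rho> j)" for j
          unfolding l2n_def using iter_l2[OF rho, of j] F by (intro finite_sum_le_infsum) (auto simp: l2_def)
        then show "\<forall>\<^sub>F j in sequentially. (\<Sum>p\<in>F. (cmod (iter \<rho> j p))\<^sup>2) \<le> K * l2n \<rho>"
          using iter_l2[OF rho] by (auto intro!: always_eventually intro: order_trans)
      qed simp
    qed
  qed simp
  moreover have "of_real (D p) * u p = nbr_sum c d u p + \<rho> p" for p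
  proof (rule LIMSEQ_unique)
    show "(\<lambda>j. of_real (D p) * iter \<rho> (Suc j) p) \<longlonglongrightarrow> of_real (D p) * u p"
      by (intro tendsto_intros LIMSEQ_Suc lim)
    have "(\<lambda>j. nbr_sum c d (iter \<rho> j) p + \<rho> p) \<longlonglongrightarrow> nbr_sum c d u p + \<rho> p"
      by (cases p) (simp only: nbr_sum_def prod.case, intro tendsto_intros lim)
    then show "(\<lambda>j. of_real (D p) * iter \<rho> (Suc j) p) \<longlonglongrightarrow> nbr_sum c d u p + \<rho> p"
      using D_nonzero by simp
  qed
  ultimately show ?thesis by (rule that)
qed

end

section \<open>Sums over edges and over vertices\<close>

lemma edge_UNIV: "(UNIV :: edge set) = range Hor \<union> range Ver"
  by (auto intro: edge.exhaust)

lemma edge_summable: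
  fixes g :: "edge \<Rightarrow> real"
  assumes "(\<lambda>p. g (Hor p)) summable_on UNIV" "(\<lambda>p. g (Ver p)) summable_on UNIV"
  shows "g summable_on UNIV" "infsum g UNIV = (\<Sum>\<^sub>\<infinity>p. g (Hor p)) + (\<Sum>\<^sub>\<infinity>p. g (Ver p))"
proof -
  have i: "inj Hor" "inj Ver" by (auto simp: inj_def)
  have "(g has_sum (\<Sum>\<^sub>\<infinity>p. g (Hor p))) (range Hor)" "(g has_sum (\<Sum>\<^sub>\<infinity>p. g (Ver p))) (range Ver)"
    using assms i by (subst has_sum_reindex; simp add: o_def)+
  then have "(g has_sum (\<Sum>\<^sub>\<infinity>p. g (Hor p)) + (\<Sum>\<^sub>\<infinity>p. g (Ver p))) UNIV"
    unfolding edge_UNIV by (rule has_sum_Un_disjoint) auto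
  then show "g summable_on UNIV" "infsum g UNIV = (\<Sum>\<^sub>\<infinity>p. g (Hor p)) + (\<Sum>\<^sub>\<infinity>p. g (Ver p))"
    by (auto simp: has_sum_iff)
qed

lemma edge_summableD:
  fixes g :: "edge \<Rightarrow> real"
  assumes "g summable_on UNIV"
  shows "(\<lambda>p. g (Hor p)) summable_on UNIV" "(\<lambda>p. g (Ver p)) summable_on UNIV"
proof -
  have i: "inj Hor" "inj Ver" by (auto simp: inj_def)
  have "g summable_on range Hor" "g summable_on range Ver"
    using assms by (auto intro: summable_on_subset_banach)
  then show "(\<lambda>p. g (Hor p)) summable_on UNIV" "(\<lambda>p. g (Ver p)) summable_on UNIV"
    using summable_on_reindex[OF i(1), of g] summable_on_reindex[OF i(2), of g] by (auto simp: o_def)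
qed

fun src :: "edge \<Rightarrow> int \<times> int" where
  "src (Hor p) = p" | "src (Ver p) = p"

fun tgt :: "edge \<Rightarrow> int \<times> int" where
  "tgt (Hor (m, n)) = (m + 1, n)" | "tgt (Ver (m, n)) = (m, n + 1)"

lemma tgt_shift: "tgt (Hor p) = (\<lambda>(m, n). (m + 1, n + 0)) p" "tgt (Ver p) = (\<lambda>(m, n). (m + 0, n + 1)) p"
  by (cases p; simp)+

text \<open>The factor \<open>2\<close>: every vertex is the starting point of two edges and the end
  point of two.\<close>

lemma edge_ends_summable:
  assumes u: "l2 u"
  shows "(\<lambda>e. (cmod (u (src e)))\<^sup>2) summable_on UNIV" "(\<Sum>\<^sub>\<infinity>e. (cmod (u (src e)))\<^sup>2) = 2 * l2n u"
    "(\<lambda>e. (cmod (u (tgt e)))\<^sup>2) summable_on UNIV" "(\<Sum>\<^sub>\<infinity>e. (cmod (u (tgt e)))\<^sup>2) = 2 * l2n u"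
proof -
  let ?v = "\<lambda>p. (cmod (u p))\<^sup>2"
  have s: "(\<lambda>p. ?v ((\<lambda>(m,n). (m + i, n + j)) p)) summable_on UNIV" for i j
    using u unfolding l2_def by (subst summable_on_bij_comp(1)[OF bij_shifts])
  have i: "infsum (\<lambda>p. ?v ((\<lambda>(m,n). (m + i, n + j)) p)) UNIV = l2n u" for i j
    unfolding l2n_def by (rule summable_on_bij_comp(2)[OF bij_shifts])
  have 0: "?v summable_on UNIV" using u by (simp add: l2_def)
  show "(\<lambda>e. ?v (src e)) summable_on UNIV" by (rule edge_summable(1)) (simp_all add: 0)
  show "(\<Sum>\<^sub>\<infinity>e. ?v (src e)) = 2 * l2n u" by (subst edge_summable(2)) (simp_all add: 0 l2n_def)
  show "(\<lambda>e. ?v (tgt e)) summable_on UNIV" by (rule edge_summable(1)) (simp_all only: tgt_shift s)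
  show "(\<Sum>\<^sub>\<infinity>e. ?v (tgt e)) = 2 * l2n u" by (subst edge_summable(2)) (simp_all only: tgt_shift s i)
qed

subsection \<open>The resolvent set\<close>

lemma elen_simps [simp]: "elen a b (Hor p) = a" "elen a b (Ver p) = b"
  by (auto simp: elen_def)

lemma in_L2_linear_combination:
  assumes "in_L2 a b \<phi>" "in_L2 a b \<psi>"
  shows "in_L2 a b (\<lambda>e t. c * \<phi> e t + d * \<psi> e t)"
proof -
  have s: "sq_int (elen a b e) (\<phi> e)" "sq_int (elen a b e) (\<psi> e)" for e
    using assms by (auto simp: in_L2_def)
  have "(\<lambda>e. 2 * (cmod c)\<^sup>2 * edge_norm2 (elen a b e) (\<phi> e) + 2 * (cmod d)\<^sup>2 * edge_norm2 (elen a b e) (\<psi> e)) summable_on UNIV"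
    using assms by (auto simp: in_L2_def intro!: summable_on_add summable_on_cmult_right)
  then have "(\<lambda>e. edge_norm2 (elen a b e) (\<lambda>t. c * \<phi> e t + d * \<psi> e t)) summable_on UNIV"
    by (rule summable_on_comparison_test) (use sq_int_linear_combination(2)[OF s] in auto)
  then show ?thesis using sq_int_linear_combination(1)[OF s] by (auto simp: in_L2_def)
qed

lemma cmod_add4_square_le:
  "(cmod (x + y + z + w))\<^sup>2 \<le> 4 * ((cmod x)\<^sup>2 + (cmod y)\<^sup>2 + (cmod z)\<^sup>2 + (cmod w)\<^sup>2)"
  using cmod_add_square_le[of "x + y" "z + w"] cmod_add_square_le[of x y] cmod_add_square_le[of z w]
  by (simp add: add.assoc)

lemma cmod_diff_add_square_le:
  "(cmod (x + - y + z))\<^sup>2 \<le> 2 * (2 * (cmod x)\<^sup>2 + 2 * (cmod y)\<^sup>2) + 2 * (cmod z)\<^sup>2"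
  using cmod_add_square_le[of "x + - y" z] cmod_add_square_le[of x "- y"] by simp

section \<open>Slopes at the ends of an edge in terms of its end values\<close>

definition sn_moment :: "real \<Rightarrow> real \<Rightarrow> (real \<Rightarrow> complex) \<Rightarrow> complex" where
  "sn_moment lam L g = (LINT t:{0..L}|lborel. g t * csn lam t)"

definition cs_moment :: "real \<Rightarrow> real \<Rightarrow> (real \<Rightarrow> complex) \<Rightarrow> complex" where
  "cs_moment lam L g = (LINT t:{0..L}|lborel. g t * ccs lam t)"

text \<open>The contribution of the source \<open>g\<close> to the slope at the initial end; the
  contribution at the far end is \<open>- sn_moment lam L g / csn lam L\<close>.\<close>

definition slope_term :: "real \<Rightarrow> real \<Rightarrow> (real \<Rightarrow> complex) \<Rightarrow> complex" where
  "slope_term lam L g = cs_moment lam L g - ccs lam L * sn_moment lam L g / csn lam L"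

lemma H2_edge_end_values:
  assumes L: "0 < L" and E: "edge_eq lam L g f f' f''"
  shows "f L = ccs lam L * (f 0 + sn_moment lam L g) + csn lam L * (f' 0 - cs_moment lam L g)"
    and "f' L = ccs lam L * (f' 0 - cs_moment lam L g) - of_real lam * csn lam L * (f 0 + sn_moment lam L g)"
  using H2_edge_variation_of_parameters[OF E, of L] L by (auto simp: sn_moment_def cs_moment_def)

text \<open>The Dirichlet-to-Neumann map of an edge, with source: \<open>sn lam L \<noteq> 0\<close>
  lets the end values determine the initial slope, and the Wronskian identity simplifies the slope
  at the far end.\<close>

lemma H2_edge_end_derivatives:
  assumes L: "0 < L" and S: "sn lam L \<noteq> 0" and E: "edge_eq lam L g f f' f''"
  shows "f' 0 = (f L - ccs lam L * f 0) / csn lam L + slope_term lam L g"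
    and "f' L = (ccs lam L * f L - f 0) / csn lam L - sn_moment lam L g / csn lam L"
proof -
  let ?C = "ccs lam L" and ?S = "csn lam L" and ?l = "complex_of_real lam"
  let ?p = "sn_moment lam L g" and ?q = "cs_moment lam L g"
  have S0: "?S \<noteq> 0" using S by simp
  note e = H2_edge_end_values[OF L E]
  have 1: "f' 0 - ?q = (f L - ?C * (f 0 + ?p)) / ?S"
    unfolding e(1) using S0 by simp
  then have "f' 0 = ?q + (f L - ?C * (f 0 + ?p)) / ?S" by (simp add: diff_eq_eq add.commute)
  then show "f' 0 = (f L - ?C * f 0) / ?S + slope_term lam L g"
    by (simp add: slope_term_def algebra_simps diff_divide_distrib add_divide_distrib)
  have w: "?C * ?C + ?l * ?S * ?S = 1" by (rule ccs_csn_square)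
  have "f' L * ?S = ?C * ((f' 0 - ?q) * ?S) - ?l * ?S * ?S * (f 0 + ?p)"
    unfolding e(2) by (simp add: algebra_simps)
  also have "(f' 0 - ?q) * ?S = f L - ?C * (f 0 + ?p)" unfolding 1 using S0 by simp
  also have "?C * (f L - ?C * (f 0 + ?p)) - ?l * ?S * ?S * (f 0 + ?p) = ?C * f L - (?C * ?C + ?l * ?S * ?S) * (f 0 + ?p)"
    by (simp add: algebra_simps)
  also have "\<dots> = ?C * f L - f 0 - ?p" unfolding w by simp
  finally have "f' L = (?C * f L - f 0 - ?p) / ?S" using S0 by (simp add: eq_divide_eq)
  then show "f' L = (?C * f L - f 0) / ?S - ?p / ?S" by (simp add: diff_divide_distrib)
qed

lemma H2_edge_exists:
  fixes A B :: complex
  assumes "0 < L" "sq_int L g"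
  shows "\<exists>f f'. edge_eq lam L g f f' (\<lambda>x. - g x - of_real lam * f x) \<and> f 0 = A \<and> f' 0 = B"
proof -
  have z: "(LINT t:{0..0}|lborel. h t) = 0" for h :: "real \<Rightarrow> complex"
    unfolding set_lebesgue_integral_def
    by (rule integral_eq_zero_AE) (use AE_lborel_singleton[of "0::real"] in \<open>eventually_elim, auto simp: indicator_def\<close>)
  have "\<exists>f f'. H2_edge L f f' (\<lambda>x. - g x - of_real lam * f x) \<and> f 0 = A \<and> f' 0 = B"
    by (intro exI conjI, rule H2_edge_solution[OF assms, of lam A B]) (simp_all only: z, simp_all)
  then show ?thesis using assms(2) by (simp add: edge_eq_def)
qed

section \<open>Estimates uniform over the lattice and the vertex equation\<close>

locale lattice =
  fixes a b lam :: real
  assumes a: "0 < a" and b: "0 < b"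
begin

abbreviation "len \<equiv> elen a b"
abbreviation "N2 g \<equiv> \<lambda>e. edge_norm2 (elen a b e) (g e)"

lemma len_pos: "0 < len e" using a b by (cases e) auto

text \<open>Only two edge lengths occur, so the larger of two constants serves all edges.\<close>

lemma uniform_edge_bound:
  assumes "\<And>L. 0 < L \<Longrightarrow> \<exists>K\<ge>0. Q L K" and mono: "\<And>L K K'. Q L K \<Longrightarrow> K \<le> K' \<Longrightarrow> Q L K'"
  shows "\<exists>K\<ge>0::real. \<forall>e. Q (len e) K"
proof -
  obtain K1 K2 where K: "0 \<le> K1" "Q a K1" "0 \<le> K2" "Q b K2" using assms(1)[OF a] assms(1)[OF b] by blast
  have "Q (len e) (max K1 K2)" for e
    by (cases e) (use mono[OF K(2), of "max K1 K2"] mono[OF K(4), of "max K1 K2"] in auto)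
  then show ?thesis using K by (intro exI[of _ "max K1 K2"]) auto
qed

lemma norm_bound:
  "\<exists>K\<ge>0. \<forall>e g f f' f''. edge_eq lam (len e) g f f' f'' \<longrightarrow>
     edge_norm2 (len e) f \<le> K * ((cmod (f 0))\<^sup>2 + (cmod (f' 0))\<^sup>2 + edge_norm2 (len e) g)"
proof (rule uniform_edge_bound[OF H2_edge_norm_bound])
  fix L K K' :: real
  assume "\<forall>g f f' f''. edge_eq lam L g f f' f'' \<longrightarrow> edge_norm2 L f \<le> K * ((cmod (f 0))\<^sup>2 + (cmod (f' 0))\<^sup>2 + edge_norm2 L g)"
    and "K \<le> K'"
  then show "\<forall>g f f' f''. edge_eq lam L g f f' f'' \<longrightarrow> edge_norm2 L f \<le> K' * ((cmod (f 0))\<^sup>2 + (cmod (f' 0))\<^sup>2 + edge_norm2 L g)"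
    by (meson order_trans mult_right_mono add_nonneg_nonneg zero_le_power2 edge_norm2_nonneg)
qed

lemma trace_bound:
  "\<exists>K\<ge>0. \<forall>e g f f' f''. edge_eq lam (len e) g f f' f'' \<longrightarrow>
     (cmod (f 0))\<^sup>2 + (cmod (f' 0))\<^sup>2 \<le> K * (edge_norm2 (len e) f + edge_norm2 (len e) g)"
proof (rule uniform_edge_bound[OF H2_edge_trace])
  fix L K K' :: real
  assume "\<forall>g f f' f''. edge_eq lam L g f f' f'' \<longrightarrow> (cmod (f 0))\<^sup>2 + (cmod (f' 0))\<^sup>2 \<le> K * (edge_norm2 L f + edge_norm2 L g)"
    and "K \<le> K'"
  then show "\<forall>g f f' f''. edge_eq lam L g f f' f'' \<longrightarrow> (cmod (f 0))\<^sup>2 + (cmod (f' 0))\<^sup>2 \<le> K' * (edge_norm2 L f + edge_norm2 L g)"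
    by (meson order_trans mult_right_mono add_nonneg_nonneg edge_norm2_nonneg)
qed

lemma functional_bound:
  "\<exists>K\<ge>0. \<forall>e g. sq_int (len e) g \<longrightarrow> (cmod (slope_term lam (len e) g))\<^sup>2 \<le> K * edge_norm2 (len e) g
     \<and> (cmod (sn_moment lam (len e) g / csn lam (len e)))\<^sup>2 \<le> K * edge_norm2 (len e) g"
proof (rule uniform_edge_bound)
  fix L :: real
  assume L: "0 < L"
  show "\<exists>K\<ge>0. \<forall>g. sq_int L g \<longrightarrow> (cmod (slope_term lam L g))\<^sup>2 \<le> K * edge_norm2 L g
     \<and> (cmod (sn_moment lam L g / csn lam L))\<^sup>2 \<le> K * edge_norm2 L g"
  proof -
    obtain B1 where B1: "0 \<le> B1" "\<And>t. t \<in> {0..L} \<Longrightarrow> cmod (csn lam t) \<le> B1"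
      using continuous_Icc_bounded[OF continuous_csn] by blast
    obtain B2 where B2: "0 \<le> B2" "\<And>t. t \<in> {0..L} \<Longrightarrow> cmod (ccs lam t) \<le> B2"
      using continuous_Icc_bounded[OF continuous_ccs] by blast
    define s c where "s = (cmod (1 / csn lam L))\<^sup>2" and "c = (cmod (ccs lam L / csn lam L))\<^sup>2"
    define K where "K = 2 * (B2\<^sup>2 * L) + 2 * (c * (B1\<^sup>2 * L)) + s * (B1\<^sup>2 * L)"
    have nn: "0 \<le> s" "0 \<le> c" "0 \<le> B1\<^sup>2 * L" "0 \<le> B2\<^sup>2 * L" using L by (auto simp: s_def c_def)
    have "(cmod (slope_term lam L g))\<^sup>2 \<le> K * edge_norm2 L g \<and> (cmod (sn_moment lam L g / csn lam L))\<^sup>2 \<le> K * edge_norm2 L g"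
      if g: "sq_int L g" for g
    proof -
      have p: "(cmod (sn_moment lam L g))\<^sup>2 \<le> B1\<^sup>2 * L * edge_norm2 L g" unfolding sn_moment_def
        by (rule integral_mult_bounded_square_le[OF g L continuous_csn B1(2)]) (use L in auto)
      have q: "(cmod (cs_moment lam L g))\<^sup>2 \<le> B2\<^sup>2 * L * edge_norm2 L g" unfolding cs_moment_def
        by (rule integral_mult_bounded_square_le[OF g L continuous_ccs B2(2)]) (use L in auto)
      have e1: "(cmod (sn_moment lam L g / csn lam L))\<^sup>2 = s * (cmod (sn_moment lam L g))\<^sup>2"
        by (simp add: s_def norm_divide power_divide)
      have e2: "(cmod (ccs lam L * sn_moment lam L g / csn lam L))\<^sup>2 = c * (cmod (sn_moment lam L g))\<^sup>2"
        by (simp add: c_def norm_divide norm_mult power_divide power_mult_distrib)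
      have b1: "s * (cmod (sn_moment lam L g))\<^sup>2 \<le> s * (B1\<^sup>2 * L) * edge_norm2 L g"
        using mult_left_mono[OF p nn(1)] by (simp add: mult.assoc)
      have b2: "c * (cmod (sn_moment lam L g))\<^sup>2 \<le> c * (B1\<^sup>2 * L) * edge_norm2 L g"
        using mult_left_mono[OF p nn(2)] by (simp add: mult.assoc)
      have K: "K * edge_norm2 L g = 2 * (B2\<^sup>2 * L * edge_norm2 L g) + 2 * (c * (B1\<^sup>2 * L) * edge_norm2 L g) + s * (B1\<^sup>2 * L) * edge_norm2 L g"
        unfolding K_def by (simp add: algebra_simps)
      have nn2: "0 \<le> s * (B1\<^sup>2 * L) * edge_norm2 L g" "0 \<le> c * (B1\<^sup>2 * L) * edge_norm2 L g" "0 \<le> B2\<^sup>2 * L * edge_norm2 L g"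
        by (intro mult_nonneg_nonneg nn edge_norm2_nonneg)+
      have "(cmod (slope_term lam L g))\<^sup>2 \<le> 2 * (cmod (cs_moment lam L g))\<^sup>2 + 2 * (cmod (ccs lam L * sn_moment lam L g / csn lam L))\<^sup>2"
        unfolding slope_term_def using cmod_add_square_le[of "cs_moment lam L g" "- (ccs lam L * sn_moment lam L g / csn lam L)"] by simp
      then show ?thesis unfolding K e1 using e2 b1 b2 q nn2 by linarith
    qed
    moreover have "0 \<le> K" unfolding K_def using nn L by (intro add_nonneg_nonneg mult_nonneg_nonneg) auto
    ultimately show ?thesis by blast
  qed
next
  fix L K K' :: real
  assume "\<forall>g. sq_int L g \<longrightarrow> (cmod (slope_term lam L g))\<^sup>2 \<le> K * edge_norm2 L g \<and> (cmod (sn_moment lam L g / csn lam L))\<^sup>2 \<le> K * edge_norm2 L g"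
    and "K \<le> K'"
  then show "\<forall>g. sq_int L g \<longrightarrow> (cmod (slope_term lam L g))\<^sup>2 \<le> K' * edge_norm2 L g \<and> (cmod (sn_moment lam L g / csn lam L))\<^sup>2 \<le> K' * edge_norm2 L g"
    by (meson order_trans mult_right_mono edge_norm2_nonneg)
qed

text \<open>The source on the edges as seen by a vertex: outgoing edges contribute
  \<open>slope_term\<close>, incoming ones the far-end moment.\<close>

definition rho :: "(edge \<Rightarrow> real \<Rightarrow> complex) \<Rightarrow> int \<times> int \<Rightarrow> complex" where
  "rho g = (\<lambda>(m, n). slope_term lam a (g (Hor (m, n))) + sn_moment lam a (g (Hor (m - 1, n))) / csn lam a +
     slope_term lam b (g (Ver (m, n))) + sn_moment lam b (g (Ver (m, n - 1))) / csn lam b)"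

lemma rho_bound:
  "\<exists>K\<ge>0. \<forall>g. in_L2 a b g \<longrightarrow> l2 (rho g) \<and> l2n (rho g) \<le> K * infsum (N2 g) UNIV"
proof -
  obtain K where K: "0 \<le> K"
    "\<And>e g. sq_int (len e) g \<Longrightarrow> (cmod (slope_term lam (len e) g))\<^sup>2 \<le> K * edge_norm2 (len e) g"
    "\<And>e g. sq_int (len e) g \<Longrightarrow> (cmod (sn_moment lam (len e) g / csn lam (len e)))\<^sup>2 \<le> K * edge_norm2 (len e) g"
    using functional_bound by blast
  show ?thesis
  \<comment> \<open>A factor \<open>4\<close> from squaring a sum of four terms, times
    \<open>2\<close> because each edge feeds both of its end vertices.\<close>
  proof (intro exI[of _ "8 * K"] conjI[of "0 \<le> _"] allI impI)
    show "0 \<le> 8 * K" using K by simp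
    fix g assume g: "in_L2 a b g"
    have sq: "sq_int (len e) (g e)" for e using g by (simp add: in_L2_def)
    have s0: "N2 g summable_on UNIV" using g by (simp add: in_L2_def)
    note s = edge_summableD[OF s0]
    let ?H = "\<lambda>p. N2 g (Hor p)" and ?V = "\<lambda>p. N2 g (Ver p)"
    define h where "h = (\<lambda>p. 4 * K * (?H p + ?H ((\<lambda>(m,n). (m + - 1, n + 0)) p) + ?V p + ?V ((\<lambda>(m,n). (m + 0, n + - 1)) p)))"
    have s1: "(\<lambda>p. ?H ((\<lambda>(m,n). (m + i, n + j)) p)) summable_on UNIV" for i j
      using s(1) by (subst summable_on_bij_comp(1)[OF bij_shifts, of ?H])
    have i1: "infsum (\<lambda>p. ?H ((\<lambda>(m,n). (m + i, n + j)) p)) UNIV = infsum ?H UNIV" for i j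
      by (rule summable_on_bij_comp(2)[OF bij_shifts, of ?H])
    have s2: "(\<lambda>p. ?V ((\<lambda>(m,n). (m + i, n + j)) p)) summable_on UNIV" for i j
      using s(2) by (subst summable_on_bij_comp(1)[OF bij_shifts, of ?V])
    have i2: "infsum (\<lambda>p. ?V ((\<lambda>(m,n). (m + i, n + j)) p)) UNIV = infsum ?V UNIV" for i j
      by (rule summable_on_bij_comp(2)[OF bij_shifts, of ?V])
    have hs: "h summable_on UNIV" unfolding h_def by (intro summable_on_cmult_right summable_on_add s s1 s2)
    have le: "(cmod (rho g p))\<^sup>2 \<le> h p" for p
    proof (cases p)
      case (Pair m n)
      have "(cmod (rho g p))\<^sup>2 \<le> 4 * ((cmod (slope_term lam a (g (Hor (m, n)))))\<^sup>2 + (cmod (sn_moment lam a (g (Hor (m - 1, n))) / csn lam a))\<^sup>2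
        + (cmod (slope_term lam b (g (Ver (m, n)))))\<^sup>2 + (cmod (sn_moment lam b (g (Ver (m, n - 1))) / csn lam b))\<^sup>2)"
        unfolding rho_def Pair prod.case by (rule cmod_add4_square_le)
      also have "\<dots> \<le> 4 * (K * ?H (m, n) + K * ?H (m - 1, n) + K * ?V (m, n) + K * ?V (m, n - 1))"
        using K(2)[of "Hor (m, n)" "g (Hor (m, n))"] K(3)[of "Hor (m - 1, n)" "g (Hor (m - 1, n))"]
          K(2)[of "Ver (m, n)" "g (Ver (m, n))"] K(3)[of "Ver (m, n - 1)" "g (Ver (m, n - 1))"] sq
        by (metis (no_types, lifting) add_mono elen_simps mult_left_mono zero_le_numeral)
      also have "\<dots> = h p" unfolding h_def Pair by (simp add: algebra_simps)
      finally show ?thesis .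
    qed
    have "infsum h UNIV = 4 * K * (infsum ?H UNIV + infsum ?H UNIV + infsum ?V UNIV + infsum ?V UNIV)"
      unfolding h_def by (simp only: infsum_cmult_right' infsum_add summable_on_add s s1 s2 i1 i2)
    also have "\<dots> = 8 * K * infsum (N2 g) UNIV"
      unfolding edge_summable(2)[of "N2 g", OF s] by simp
    finally show "l2 (rho g) \<and> l2n (rho g) \<le> 8 * K * infsum (N2 g) UNIV"
      using l2_dominated[OF hs le] by simp
  qed
qed

text \<open>Pure algebra on end slopes, stated for any \<open>\<psi>'\<close> obeying the four
  formulas. It serves a given element of the domain, a constructed solution and, with
  \<open>g = 0\<close>, the extension of vertex data into the edges.\<close>

lemma vertex_equation:
  assumes H0: "\<And>p. \<psi>' (Hor p) 0 = (u (tgt (Hor p)) - ccs lam a * u p) / csn lam a + slope_term lam a (g (Hor p))"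
    and Ha: "\<And>p. \<psi>' (Hor p) a = (ccs lam a * u (tgt (Hor p)) - u p) / csn lam a - sn_moment lam a (g (Hor p)) / csn lam a"
    and V0: "\<And>p. \<psi>' (Ver p) 0 = (u (tgt (Ver p)) - ccs lam b * u p) / csn lam b + slope_term lam b (g (Ver p))"
    and Vb: "\<And>p. \<psi>' (Ver p) b = (ccs lam b * u (tgt (Ver p)) - u p) / csn lam b - sn_moment lam b (g (Ver p)) / csn lam b"
  shows "\<psi>' (Hor (m, n)) 0 - \<psi>' (Hor (m - 1, n)) a + \<psi>' (Ver (m, n)) 0 - \<psi>' (Ver (m, n - 1)) b - of_real c * u (m, n) =
    nbr_sum (1 / sn lam a) (1 / sn lam b) u (m, n) + rho g (m, n)
     - of_real (c + 2 * cs lam a / sn lam a + 2 * cs lam b / sn lam b) * u (m, n)"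
  unfolding H0 Ha V0 Vb
  by (simp add: nbr_sum_def rho_def algebra_simps diff_divide_distrib add_divide_distrib)

text \<open>The vertex values of a domain element satisfy a diagonally dominant equation, which
  bounds them by the source; conversely, solving that equation and filling in the edges produces a
  preimage of any \<open>f\<close>.\<close>

lemma not_in_spectrum:
  fixes \<alpha> :: "int \<Rightarrow> int \<Rightarrow> real"
  assumes Sa: "sn lam a \<noteq> 0" and Sb: "sn lam b \<noteq> 0"
    and dom: "2 / \<bar>sn lam a\<bar> + 2 / \<bar>sn lam b\<bar> < r"
    and D: "\<And>m n. r \<le> \<bar>\<alpha> m n + 2 * cs lam a / sn lam a + 2 * cs lam b / sn lam b\<bar>"
  shows "lam \<notin> spectrum_lattice a b \<alpha>"
proof -
  define ca cb where "ca = 1 / sn lam a" and "cb = 1 / sn lam b"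
  define D' where "D' = (\<lambda>(m, n). \<alpha> m n + 2 * cs lam a / sn lam a + 2 * cs lam b / sn lam b)"
  interpret diagonally_dominant ca cb D' r
    by unfold_locales (use dom D in \<open>auto simp: ca_def cb_def D'_def\<close>)
  let ?l = "complex_of_real lam"
  have S: "sn lam (len e) \<noteq> 0" for e using Sa Sb by (cases e) auto
  obtain Kr where Kr: "0 \<le> Kr" "\<And>g. in_L2 a b g \<Longrightarrow> l2 (rho g) \<and> l2n (rho g) \<le> Kr * infsum (N2 g) UNIV"
    using rho_bound by blast
  obtain Kt where Kt: "0 \<le> Kt"
    "\<And>e g f f' f''. edge_eq lam (len e) g f f' f'' \<Longrightarrow> (cmod (f 0))\<^sup>2 + (cmod (f' 0))\<^sup>2 \<le> Kt * (edge_norm2 (len e) f + edge_norm2 (len e) g)"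
    using trace_bound by blast
  obtain Kn where Kn: "0 \<le> Kn"
    "\<And>e g f f' f''. edge_eq lam (len e) g f f' f'' \<Longrightarrow> edge_norm2 (len e) f \<le> Kn * ((cmod (f 0))\<^sup>2 + (cmod (f' 0))\<^sup>2 + edge_norm2 (len e) g)"
    using norm_bound by blast
  obtain Kb where Kb: "0 \<le> Kb"
    "\<And>e g. sq_int (len e) g \<Longrightarrow> (cmod (slope_term lam (len e) g))\<^sup>2 \<le> Kb * edge_norm2 (len e) g"
    using functional_bound by blast
  define s where "s = (cmod (1 / csn lam a))\<^sup>2 + (cmod (1 / csn lam b))\<^sup>2
    + (cmod (ccs lam a / csn lam a))\<^sup>2 + (cmod (ccs lam b / csn lam b))\<^sup>2"
  \<comment> \<open>A summable majorant for the squared norm on each edge, in terms of vertex values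
    and source. It gives the resolvent bound in one half and membership of the solution in
    \<open>L^2\<close> in the other.\<close>
  define h where "h = (\<lambda>u g e. Kn * (1 + 4 * s + 2 * Kb) * ((cmod (u (src e)))\<^sup>2 + (cmod (u (tgt e)))\<^sup>2 + N2 g e))"
  have nb': "edge_norm2 (len e) f \<le> h u g e"
    if E: "edge_eq lam (len e) (g e) f f' f''" and f0: "f 0 = u (src e)" and fL: "f (len e) = u (tgt e)" for e f f' f'' g and u :: "int \<times> int \<Rightarrow> complex"
  proof -
    note g = edge_eqD(2)[OF E]
    let ?x = "(cmod (u (src e)))\<^sup>2" and ?y = "(cmod (u (tgt e)))\<^sup>2"
    have se: "(cmod (1 / csn lam (len e)))\<^sup>2 \<le> s" "(cmod (ccs lam (len e) / csn lam (len e)))\<^sup>2 \<le> s"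
      unfolding s_def by (cases e; simp)+
    have s0: "0 \<le> s" by (simp add: s_def)
    have d1: "f' 0 = (1 / csn lam (len e) * u (tgt e) + (- (ccs lam (len e) / csn lam (len e) * u (src e)))) + slope_term lam (len e) (g e)"
      using H2_edge_end_derivatives(1)[OF len_pos S E] by (simp add: f0 fL diff_divide_distrib)
    have "(cmod (f' 0))\<^sup>2 \<le> 2 * (2 * (cmod (1 / csn lam (len e) * u (tgt e)))\<^sup>2 + 2 * (cmod (ccs lam (len e) / csn lam (len e) * u (src e)))\<^sup>2)
        + 2 * (cmod (slope_term lam (len e) (g e)))\<^sup>2"
      unfolding d1 by (rule cmod_diff_add_square_le)
    also have "\<dots> \<le> 2 * (2 * (s * ?y) + 2 * (s * ?x)) + 2 * (Kb * N2 g e)"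
      unfolding norm_mult[of "1 / csn lam (len e)"] norm_mult[of "ccs lam (len e) / csn lam (len e)"] power_mult_distrib
      using mult_right_mono[OF se(1), of ?y] mult_right_mono[OF se(2), of ?x] Kb(2)[OF g] by simp
    finally have d: "(cmod (f' 0))\<^sup>2 \<le> 4 * s * (?x + ?y) + 2 * Kb * N2 g e" by (simp add: algebra_simps)
    have "edge_norm2 (len e) f \<le> Kn * (?x + (cmod (f' 0))\<^sup>2 + N2 g e)"
      using Kn(2)[OF E] by (simp add: f0)
    also have "\<dots> \<le> Kn * ((1 + 4 * s + 2 * Kb) * (?x + ?y + N2 g e))"
    proof (rule mult_left_mono[OF _ Kn(1)])
      have "(1 + 4 * s + 2 * Kb) * (?x + ?y + N2 g e) = ?x + ?y + N2 g e + 4 * s * (?x + ?y) + 4 * s * N2 g e + 2 * Kb * (?x + ?y) + 2 * Kb * N2 g e"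
        by (simp add: algebra_simps)
      moreover have "0 \<le> 4 * s * N2 g e" "0 \<le> 2 * Kb * (?x + ?y)" "0 \<le> ?y" using s0 Kb(1) by auto
      ultimately show "?x + (cmod (f' 0))\<^sup>2 + N2 g e \<le> (1 + 4 * s + 2 * Kb) * (?x + ?y + N2 g e)"
        using d by linarith
    qed
    finally show ?thesis by (simp add: h_def mult.assoc)
  qed
  have hs: "h u g summable_on UNIV" "infsum (h u g) UNIV = Kn * (1 + 4 * s + 2 * Kb) * (4 * l2n u + infsum (N2 g) UNIV)"
    if u: "l2 u" and g: "in_L2 a b g" for u g
  proof -
    have s0: "N2 g summable_on UNIV" using g by (simp add: in_L2_def)
    note es = edge_ends_summable[OF u]
    show "h u g summable_on UNIV" unfolding h_def by (intro summable_on_cmult_right summable_on_add es s0)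
    show "infsum (h u g) UNIV = Kn * (1 + 4 * s + 2 * Kb) * (4 * l2n u + infsum (N2 g) UNIV)"
      unfolding h_def infsum_cmult_right'
      by (simp only: infsum_add summable_on_add es s0) simp
  qed
  \<comment> \<open>The \<open>4\<close> is two from \<open>src\<close> plus two from
    \<open>tgt\<close>; \<open>K * Kr\<close> bounds the vertex values by the source.\<close>
  define C where "C = sqrt (Kn * (1 + 4 * s + 2 * Kb) * (4 * (K * Kr) + 1))"
  have bounded: "L2_norm a b \<psi> \<le> C * L2_norm a b (\<lambda>e t. \<phi> e t - ?l * \<psi> e t)" if op: "lattice_op a b \<alpha> \<psi> \<phi>" for \<psi> \<phi>
  proof -
    obtain \<psi>' \<psi>'' where L2: "in_L2 a b \<psi>" "in_L2 a b \<phi>"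
      and H: "\<And>e. H2_edge (len e) (\<psi> e) (\<psi>' e) (\<psi>'' e)"
      and vc: "vertex_conditions a b \<alpha> \<psi> \<psi>'"
      and ae0: "\<And>e. AE t in lborel. t \<in> {0..len e} \<longrightarrow> \<phi> e t = - \<psi>'' e t"
      using op unfolding lattice_op_def by blast
    define g where "g = (\<lambda>e t. \<phi> e t - ?l * \<psi> e t)"
    have g2: "in_L2 a b g" using in_L2_linear_combination[OF L2(2,1), of 1 "- ?l"] by (simp add: g_def)
    have gs: "sq_int (len e) (g e)" for e using g2 by (simp add: in_L2_def)
    have E: "edge_eq lam (len e) (g e) (\<psi> e) (\<psi>' e) (\<psi>'' e)" for e
    proof -
      have "AE t in lborel. t \<in> {0..len e} \<longrightarrow> g e t = - \<psi>'' e t - ?l * \<psi> e t"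
        using ae0[of e] by eventually_elim (auto simp: g_def)
      then show ?thesis unfolding edge_eq_def using H gs by blast
    qed
    define u where "u = (\<lambda>p. \<psi> (Hor p) 0)"
    have f0: "\<psi> e 0 = u (src e)" for e
      using vc by (cases e) (auto simp: u_def vertex_conditions_def)
    have fL: "\<psi> e (len e) = u (tgt e)" for e
    proof (cases e)
      case (Hor p)
      obtain m n where p: "p = (m, n)" by (cases p)
      show ?thesis using vc[unfolded vertex_conditions_def, rule_format, of "m + 1" n] by (simp add: Hor p u_def)
    next
      case (Ver p)
      obtain m n where p: "p = (m, n)" by (cases p)
      show ?thesis using vc[unfolded vertex_conditions_def, rule_format, of m "n + 1"] by (simp add: Ver p u_def)
    qed
    \<comment> \<open>The trace estimate at the initial points of the horizontal edges, one for each
      vertex.\<close>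
    have u2: "l2 u"
    proof (rule l2_dominated(1))
      have "(\<lambda>p. N2 \<psi> (Hor p)) summable_on UNIV" "(\<lambda>p. N2 g (Hor p)) summable_on UNIV"
        using L2(1) g2 by (auto simp: in_L2_def dest: edge_summableD)
      then show "(\<lambda>p. Kt * (N2 \<psi> (Hor p) + N2 g (Hor p))) summable_on UNIV"
        by (intro summable_on_cmult_right summable_on_add)
      show "(cmod (u p))\<^sup>2 \<le> Kt * (N2 \<psi> (Hor p) + N2 g (Hor p))" for p
        using Kt(2)[OF E, of "Hor p"] zero_le_power2[of "cmod (\<psi>' (Hor p) 0)"] unfolding u_def by linarith
    qed
    have eq: "of_real (D' p) * u p = nbr_sum ca cb u p + rho g p" for p
    proof (cases p)
      case (Pair m n)
      note ed = H2_edge_end_derivatives[OF len_pos S E]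
      have "\<psi>' (Hor (m, n)) 0 - \<psi>' (Hor (m - 1, n)) a + \<psi>' (Ver (m, n)) 0 - \<psi>' (Ver (m, n - 1)) b - of_real (\<alpha> m n) * u (m, n) =
        nbr_sum ca cb u (m, n) + rho g (m, n) - of_real (D' (m, n)) * u (m, n)"
        unfolding ca_def cb_def D'_def prod.case
      proof (rule vertex_equation)
        fix p
        show "\<psi>' (Hor p) 0 = (u (tgt (Hor p)) - ccs lam a * u p) / csn lam a + slope_term lam a (g (Hor p))"
          "\<psi>' (Hor p) a = (ccs lam a * u (tgt (Hor p)) - u p) / csn lam a - sn_moment lam a (g (Hor p)) / csn lam a"
          using ed[of "Hor p"] unfolding f0 fL by simp_all
        show "\<psi>' (Ver p) 0 = (u (tgt (Ver p)) - ccs lam b * u p) / csn lam b + slope_term lam b (g (Ver p))"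
          "\<psi>' (Ver p) b = (ccs lam b * u (tgt (Ver p)) - u p) / csn lam b - sn_moment lam b (g (Ver p)) / csn lam b"
          using ed[of "Ver p"] unfolding f0 fL by simp_all
      qed
      moreover have "\<psi>' (Hor (m, n)) 0 - \<psi>' (Hor (m - 1, n)) a + \<psi>' (Ver (m, n)) 0 - \<psi>' (Ver (m, n - 1)) b = of_real (\<alpha> m n) * u (m, n)"
        using vc by (simp add: vertex_conditions_def u_def)
      ultimately show ?thesis unfolding Pair by simp
    qed
    let ?G = "infsum (N2 g) UNIV"
    have G0: "0 \<le> ?G" by (rule infsum_nonneg) simp
    have "l2n u \<le> K * l2n (rho g)" using a_priori[OF u2 _ eq] Kr(2)[OF g2] by blast
    also have "\<dots> \<le> K * (Kr * ?G)" using Kr(2)[OF g2] M_r(6) by (intro mult_left_mono) auto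
    finally have un: "l2n u \<le> K * Kr * ?G" by (simp add: mult.assoc)
    have s0: "0 \<le> s" by (simp add: s_def)
    have nbe: "N2 \<psi> e \<le> h u g e" for e
      by (rule nb'[where f = "\<psi> e" and g = g and u = u and e = e, OF E f0 fL])
    have "infsum (N2 \<psi>) UNIV \<le> infsum (h u g) UNIV"
      using L2(1) hs(1)[OF u2 g2] nbe by (intro infsum_mono) (auto simp: in_L2_def)
    also have "\<dots> \<le> Kn * (1 + 4 * s + 2 * Kb) * (4 * (K * Kr * ?G) + ?G)"
      unfolding hs(2)[OF u2 g2] using un Kn(1) Kb(1) s0 by (intro mult_left_mono add_right_mono) auto
    also have "\<dots> = (Kn * (1 + 4 * s + 2 * Kb) * (4 * (K * Kr) + 1)) * ?G" by (simp add: algebra_simps)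
    finally have "sqrt (infsum (N2 \<psi>) UNIV) \<le> C * sqrt ?G"
      unfolding C_def real_sqrt_mult[symmetric] by (rule real_sqrt_le_mono)
    then show ?thesis by (simp add: L2_norm_def g_def)
  qed
  have surj: "\<exists>\<psi> \<phi>. lattice_op a b \<alpha> \<psi> \<phi> \<and> L2_norm a b (\<lambda>e t. \<phi> e t - ?l * \<psi> e t - f e t) = 0"
    if f: "in_L2 a b f" for f
  proof -
    have fs: "sq_int (len e) (f e)" for e using f by (simp add: in_L2_def)
    obtain u where u2: "l2 u" and ueq: "\<And>p. of_real (D' p) * u p = nbr_sum ca cb u p + rho f p"
      using solvable[of "rho f"] Kr(2)[OF f] by blast
    \<comment> \<open>The initial slope is dictated by the Dirichlet-to-Neumann formula, so that the
      solution arrives at the value \<open>u (tgt e)\<close>.\<close>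
    define B where "B = (\<lambda>e. (u (tgt e) - ccs lam (len e) * u (src e)) / csn lam (len e) + slope_term lam (len e) (f e))"
    have "\<forall>e. \<exists>y. edge_eq lam (len e) (f e) (fst y) (snd y) (\<lambda>x. - f e x - ?l * fst y x) \<and> fst y 0 = u (src e) \<and> snd y 0 = B e"
    proof
      fix e
      obtain y0 y1 where "edge_eq lam (len e) (f e) y0 y1 (\<lambda>x. - f e x - ?l * y0 x) \<and> y0 0 = u (src e) \<and> y1 0 = B e"
        using H2_edge_exists[OF len_pos fs, of lam e "u (src e)" "B e"] by blast
      then show "\<exists>y. edge_eq lam (len e) (f e) (fst y) (snd y) (\<lambda>x. - f e x - ?l * fst y x) \<and> fst y 0 = u (src e) \<and> snd y 0 = B e"
        by (intro exI[of _ "(y0, y1)"]) simp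
    qed
    from choice[OF this] obtain y where y: "\<forall>e. edge_eq lam (len e) (f e) (fst (y e)) (snd (y e)) (\<lambda>x. - f e x - ?l * fst (y e) x)
        \<and> fst (y e) 0 = u (src e) \<and> snd (y e) 0 = B e" ..
    define \<psi> where "\<psi> = (\<lambda>e. fst (y e))"
    define \<psi>' where "\<psi>' = (\<lambda>e. snd (y e))"
    define \<psi>'' where "\<psi>'' = (\<lambda>e x. - f e x - ?l * \<psi> e x)"
    have E: "edge_eq lam (len e) (f e) (\<psi> e) (\<psi>' e) (\<psi>'' e)" and f0: "\<psi> e 0 = u (src e)" and d0: "\<psi>' e 0 = B e" for e
      using y[rule_format, of e] by (simp_all add: \<psi>_def \<psi>'_def \<psi>''_def)
    note H = edge_eqD(1)[OF E]
    have S0: "csn lam (len e) \<noteq> 0" for e using S by simp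
    have fL: "\<psi> e (len e) = u (tgt e)" for e
      unfolding H2_edge_end_values(1)[OF len_pos E] f0 d0 B_def slope_term_def
      using S0[of e] by (simp add: field_simps)
    note ed = H2_edge_end_derivatives[OF len_pos S E]
    define \<phi> where "\<phi> = (\<lambda>e x. - \<psi>'' e x)"
    have nbe: "N2 \<psi> e \<le> h u f e" for e
      by (rule nb'[where f = "\<psi> e" and g = f and u = u and e = e, OF E f0 fL])
    have psi2: "in_L2 a b \<psi>"
      unfolding in_L2_def
    proof (intro conjI allI)
      show "sq_int (len e) (\<psi> e)" for e
        using sq_int_continuous(1)[OF H2_edge_continuous[OF H]] len_pos[of e] by simp
      show "N2 \<psi> summable_on UNIV"
        by (rule summable_on_comparison_test[OF hs(1)[OF u2 f]]) (use nbe in auto)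
    qed
    have phi: "\<phi> = (\<lambda>e t. 1 * f e t + ?l * \<psi> e t)" by (simp add: \<phi>_def \<psi>''_def add.commute)
    have phi2: "in_L2 a b \<phi>" unfolding phi by (rule in_L2_linear_combination[OF f psi2])
    have "vertex_conditions a b \<alpha> \<psi> \<psi>'"
      unfolding vertex_conditions_def
    proof (intro allI conjI)
      fix m n
      show "\<psi> (Hor (m - 1, n)) a = \<psi> (Hor (m, n)) 0" using fL[of "Hor (m - 1, n)"] f0[of "Hor (m, n)"] by simp
      show "\<psi> (Ver (m, n)) 0 = \<psi> (Hor (m, n)) 0" using f0[of "Ver (m, n)"] f0[of "Hor (m, n)"] by simp
      show "\<psi> (Ver (m, n - 1)) b = \<psi> (Hor (m, n)) 0" using fL[of "Ver (m, n - 1)"] f0[of "Hor (m, n)"] by simp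
      have "\<psi>' (Hor (m, n)) 0 - \<psi>' (Hor (m - 1, n)) a + \<psi>' (Ver (m, n)) 0 - \<psi>' (Ver (m, n - 1)) b - of_real (\<alpha> m n) * u (m, n) =
        nbr_sum ca cb u (m, n) + rho f (m, n) - of_real (D' (m, n)) * u (m, n)"
        unfolding ca_def cb_def D'_def prod.case
      proof (rule vertex_equation)
        fix p
        show "\<psi>' (Hor p) 0 = (u (tgt (Hor p)) - ccs lam a * u p) / csn lam a + slope_term lam a (f (Hor p))"
          "\<psi>' (Hor p) a = (ccs lam a * u (tgt (Hor p)) - u p) / csn lam a - sn_moment lam a (f (Hor p)) / csn lam a"
          using ed[of "Hor p"] unfolding f0 fL by simp_all
        show "\<psi>' (Ver p) 0 = (u (tgt (Ver p)) - ccs lam b * u p) / csn lam b + slope_term lam b (f (Ver p))"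
          "\<psi>' (Ver p) b = (ccs lam b * u (tgt (Ver p)) - u p) / csn lam b - sn_moment lam b (f (Ver p)) / csn lam b"
          using ed[of "Ver p"] unfolding f0 fL by simp_all
      qed
      then show "\<psi>' (Hor (m, n)) 0 - \<psi>' (Hor (m - 1, n)) a + \<psi>' (Ver (m, n)) 0 - \<psi>' (Ver (m, n - 1)) b = of_real (\<alpha> m n) * \<psi> (Hor (m, n)) 0"
        unfolding ueq using f0[of "Hor (m, n)"] by simp
    qed
    then have "(\<forall>e. H2_edge (len e) (\<psi> e) (\<psi>' e) (\<psi>'' e)) \<and> vertex_conditions a b \<alpha> \<psi> \<psi>' \<and>
        (\<forall>e. AE t in lborel. t \<in> {0..len e} \<longrightarrow> \<phi> e t = - \<psi>'' e t)"
      using H by (simp add: \<phi>_def)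
    then have "lattice_op a b \<alpha> \<psi> \<phi>"
      unfolding lattice_op_def using psi2 phi2 by blast
    moreover have "L2_norm a b (\<lambda>e t. \<phi> e t - ?l * \<psi> e t - f e t) = 0"
      by (simp add: phi L2_norm_def edge_norm2_def)
    ultimately show ?thesis by blast
  qed
  show ?thesis using bounded surj unfolding spectrum_lattice_def by blast
qed

end

subsection \<open>Approximate eigenfunctions\<close>

lemma H2_edge_smooth:
  assumes L: "0 < L"
    and f: "\<And>t. (f has_vector_derivative f' t) (at t)" and f': "\<And>t. (f' has_vector_derivative f'' t) (at t)"
    and c: "continuous_on UNIV f''"
  shows "H2_edge L f f' f''"
proof -
  have c': "continuous_on A f''" for A using c by (rule continuous_on_subset) simp
  have "f' x = f' 0 + (LINT t:{0..x}|lborel. f'' t)" if "x \<in> {0..L}" for x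
  proof -
    have "(LINT t:{0..x}|lborel. f'' t) = f' x - f' 0"
      unfolding set_lebesgue_integral_def
      by (rule integral_FTC_atLeastAtMost[OF _ has_vector_derivative_at_within[OF f'] c']) (use that in auto)
    then show ?thesis by simp
  qed
  moreover have "sq_int L f''" using L by (intro sq_int_continuous(1)[OF c']) simp
  ultimately show ?thesis unfolding H2_edge_def
    using borel_integrable_atLeastAtMost'[OF c'[of "{0..L}"]] has_vector_derivative_at_within[OF f] by blast
qed

lemma l2_finite:
  assumes "finite F" "\<And>p. p \<notin> F \<Longrightarrow> u p = 0"
  shows "l2 u" "l2n u = (\<Sum>p\<in>F. (cmod (u p))\<^sup>2)"
proof -
  have "((\<lambda>p. (cmod (u p))\<^sup>2) has_sum (\<Sum>p\<in>F. (cmod (u p))\<^sup>2)) UNIV"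
    by (rule has_sum_finite_neutralI) (use assms in auto)
  then show "l2 u" "l2n u = (\<Sum>p\<in>F. (cmod (u p))\<^sup>2)"
    by (auto simp: l2_def l2n_def has_sum_iff)
qed

lemma l2_inj:
  assumes f: "inj f" and z: "\<And>e. e \<notin> range f \<Longrightarrow> u e = 0"
  shows "l2 u \<longleftrightarrow> l2 (\<lambda>j. u (f j))" "l2n u = l2n (\<lambda>j. u (f j))"
proof -
  have "l2 u \<longleftrightarrow> (\<lambda>e. (cmod (u e))\<^sup>2) summable_on range f"
    unfolding l2_def by (rule summable_on_cong_neutral) (use z in auto)
  then show "l2 u \<longleftrightarrow> l2 (\<lambda>j. u (f j))"
    using summable_on_reindex[OF f, of "\<lambda>e. (cmod (u e))\<^sup>2"] by (simp add: l2_def o_def)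
  have "l2n u = infsum (\<lambda>e. (cmod (u e))\<^sup>2) (range f)"
    unfolding l2n_def by (rule infsum_cong_neutral) (use z in auto)
  then show "l2n u = l2n (\<lambda>j. u (f j))"
    using infsum_reindex[OF f, of "\<lambda>e. (cmod (u e))\<^sup>2"] by (simp add: l2n_def o_def)
qed

definition wave :: "complex \<Rightarrow> nat \<Rightarrow> int \<Rightarrow> complex" where
  "wave c N j = (if 1 \<le> j \<and> j \<le> int N then c ^ nat j else 0)"

text \<open>The recursion \<open>w j = c * w (j - 1)\<close> fails only at \<open>j = 1\<close> and
  \<open>j = N + 1\<close>, each time by at most \<open>1\<close> in modulus, whereas the squared
  norm is \<open>N\<close>.\<close>

lemma wave_l2:
  assumes c: "cmod c = 1"
  shows "l2 (wave c N)" "l2n (wave c N) = real N"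
    "l2 (\<lambda>j. wave c N (j - 1) * c - wave c N j)" "l2n (\<lambda>j. wave c N (j - 1) * c - wave c N j) \<le> 2"
proof -
  let ?F = "{1..int N}" and ?r = "\<lambda>j. wave c N (j - 1) * c - wave c N j"
  note w = l2_finite[of ?F "wave c N"]
  show "l2 (wave c N)" by (rule w) (auto simp: wave_def)
  have "l2n (wave c N) = (\<Sum>j\<in>?F. (cmod (wave c N j))\<^sup>2)" by (rule w) (auto simp: wave_def)
  also have "\<dots> = (\<Sum>j\<in>?F. 1)" by (rule sum.cong) (auto simp: wave_def norm_power c)
  finally show "l2n (wave c N) = real N" by simp
  let ?G = "{1, int N + 1}"
  have rf: "?r j = 0" if np: "j \<notin> ?G" for j
  proof -
    consider "j \<le> 0 \<or> j > int N + 1" | "2 \<le> j" "j \<le> int N" using np by fastforce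
    then show ?thesis
    proof cases
      case 1
      then show ?thesis by (auto simp: wave_def)
    next
      case 2
      then have "nat j = Suc (nat (j - 1))" by simp
      with 2 show ?thesis by (simp add: wave_def)
    qed
  qed
  have r2: "l2 ?r" "l2n ?r = (\<Sum>j\<in>?G. (cmod (?r j))\<^sup>2)" by (rule l2_finite[of ?G]; use rf in simp)+
  show "l2 ?r" by (rule r2)
  have "cmod (?r j) \<le> 1" if "j \<in> ?G" for j
    using that by (auto simp: wave_def norm_power norm_mult c)
  then have "(cmod (?r j))\<^sup>2 \<le> 1" if "j \<in> ?G" for j using that by (simp add: power_le_one)
  then have "l2n ?r \<le> real (card ?G) * 1" unfolding r2(2) by (intro sum_bounded_above) auto
  also have "\<dots> \<le> 2" by (simp add: card_insert_if)
  finally show "l2n ?r \<le> 2" .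
qed

context lattice
begin

text \<open>The functions \<open>A\<^sub>e cs + B\<^sub>e sn\<close> on the edges are continuous at the vertices, and \<open>r\<close> is the
  defect in the coupling condition for the derivatives.\<close>

definition quasi_mode :: "(int \<Rightarrow> int \<Rightarrow> real) \<Rightarrow> (edge \<Rightarrow> complex) \<Rightarrow> (edge \<Rightarrow> complex) \<Rightarrow> (int \<times> int \<Rightarrow> complex) \<Rightarrow> bool" where
  "quasi_mode \<alpha> A B r \<longleftrightarrow> l2 A \<and> l2 B \<and> l2 r \<and> (\<forall>p. A (Ver p) = A (Hor p)) \<and>
     (\<forall>e. A e * ccs lam (len e) + B e * csn lam (len e) = A (Hor (tgt e))) \<and>
     (\<forall>m n. B (Hor (m, n)) + r (m, n) - (B (Hor (m - 1, n)) * ccs lam a - of_real lam * csn lam a * A (Hor (m - 1, n)))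
       + B (Ver (m, n)) - (B (Ver (m, n - 1)) * ccs lam b - of_real lam * csn lam b * A (Ver (m, n - 1)))
       = of_real (\<alpha> m n) * A (Hor (m, n)))"

text \<open>The defect is removed by adding multiples of a cubic with prescribed derivative at the
  initial points of the horizontal edges; the result lies in the domain of the operator.\<close>

lemma quasi_mode_bound:
  fixes \<alpha> :: "int \<Rightarrow> int \<Rightarrow> real"
  assumes ns: "lam \<notin> spectrum_lattice a b \<alpha>"
  shows "\<exists>K\<ge>0. \<forall>A B r. quasi_mode \<alpha> A B r \<longrightarrow> l2n A + l2n B \<le> K * l2n r"
proof -
  let ?l = "complex_of_real lam"
  obtain C where C: "\<And>\<psi> \<phi>. lattice_op a b \<alpha> \<psi> \<phi> \<Longrightarrow>
      L2_norm a b \<psi> \<le> C * L2_norm a b (\<lambda>e t. \<phi> e t - ?l * \<psi> e t)"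
    using ns unfolding spectrum_lattice_def by blast
  obtain Kt where Kt: "0 \<le> Kt"
    "\<And>e g f f' f''. edge_eq lam (len e) g f f' f'' \<Longrightarrow> (cmod (f 0))\<^sup>2 + (cmod (f' 0))\<^sup>2 \<le> Kt * (edge_norm2 (len e) f + edge_norm2 (len e) g)"
    using trace_bound by blast
  obtain Kn where Kn: "0 \<le> Kn"
    "\<And>e g f f' f''. edge_eq lam (len e) g f f' f'' \<Longrightarrow> edge_norm2 (len e) f \<le> Kn * ((cmod (f 0))\<^sup>2 + (cmod (f' 0))\<^sup>2 + edge_norm2 (len e) g)"
    using norm_bound by blast
  \<comment> \<open>The residual \<open>(H - lam) ramp\<close>: correcting the slope at a vertex
    costs a multiple of this source on one horizontal edge.\<close>
  define w where "w = (\<lambda>t. - (ramp'' a t + ?l * ramp a t))"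
  have a0: "a \<noteq> 0" using a by simp
  have cw: "continuous_on A w" for A
    unfolding w_def
    by (intro continuous_intros continuous_on_subset[OF ramp''_continuous[OF a0]]
        continuous_on_vector_derivative[OF has_vector_derivative_at_within[OF ramp_derivative[OF a0]]]) auto
  define Kw where "Kw = edge_norm2 a w"
  have sw: "sq_int a w" using sq_int_continuous(1)[OF cw] a by simp
  have Kw: "0 \<le> Kw" by (simp add: Kw_def)
  show ?thesis
  \<comment> \<open>The trace estimate, the resolvent bound \<open>C\<close> and the source bound
    \<open>2 * Kw * l2n r\<close> are chained; the final \<open>+ 2\<close> pays for passing from
    \<open>B + R\<close> back to \<open>B\<close>.\<close>
  proof (intro exI[of _ "2 * (Kt * (C\<^sup>2 + 1) * (2 * Kw)) + 2"] conjI allI impI)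
    show "0 \<le> 2 * (Kt * (C\<^sup>2 + 1) * (2 * Kw)) + 2" using Kt(1) Kw by simp
    fix A B :: "edge \<Rightarrow> complex" and r :: "int \<times> int \<Rightarrow> complex"
    assume "quasi_mode \<alpha> A B r"
    then have A: "l2 A" and B: "l2 B" and r: "l2 r" and AV: "\<And>p. A (Ver p) = A (Hor p)"
      and At: "\<And>e. A e * ccs lam (len e) + B e * csn lam (len e) = A (Hor (tgt e))"
      and vx: "\<And>m n. B (Hor (m, n)) + r (m, n) - (B (Hor (m - 1, n)) * ccs lam a - ?l * csn lam a * A (Hor (m - 1, n)))
       + B (Ver (m, n)) - (B (Ver (m, n - 1)) * ccs lam b - ?l * csn lam b * A (Ver (m, n - 1)))
       = of_real (\<alpha> m n) * A (Hor (m, n))"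
      unfolding quasi_mode_def by blast+
    define R where "R = (\<lambda>e. case e of Hor p \<Rightarrow> r p | Ver p \<Rightarrow> 0)"
    have Rs: "R (Hor p) = r p" "R (Ver p) = 0" for p by (auto simp: R_def)
    have R2: "l2 R" "l2n R = l2n r"
      using edge_summable[of "\<lambda>e. (cmod (R e))\<^sup>2"] r by (auto simp: l2_def l2n_def Rs)
    define \<psi> where "\<psi> = (\<lambda>e t. A e * ccs lam t + B e * csn lam t + R e * ramp a t)"
    define \<psi>' where "\<psi>' = (\<lambda>e t. A e * (- ?l * csn lam t) + B e * ccs lam t + R e * ramp' a t)"
    define \<psi>'' where "\<psi>'' = (\<lambda>e t. A e * (- ?l * ccs lam t) + B e * (- ?l * csn lam t) + R e * ramp'' a t)"
    define g where "g = (\<lambda>e t. R e * w t)"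
    define \<phi> where "\<phi> = (\<lambda>e t. - \<psi>'' e t)"
    have gphi: "g e t = - \<psi>'' e t - ?l * \<psi> e t" for e t
      by (simp add: g_def w_def \<psi>''_def \<psi>_def algebra_simps)
    have H: "H2_edge (len e) (\<psi> e) (\<psi>' e) (\<psi>'' e)" for e
    proof (rule H2_edge_smooth[OF len_pos])
      show "(\<psi> e has_vector_derivative \<psi>' e t) (at t)" for t
        unfolding \<psi>_def \<psi>'_def
        by (intro has_vector_derivative_add has_vector_derivative_mult_right ccs_has_vector_derivative
            csn_has_vector_derivative ramp_derivative[OF a0])
      show "(\<psi>' e has_vector_derivative \<psi>'' e t) (at t)" for t
        unfolding \<psi>'_def \<psi>''_def
        by (intro has_vector_derivative_add has_vector_derivative_mult_right ccs_has_vector_derivative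
            csn_has_vector_derivative ramp'_derivative[OF a0])
      show "continuous_on UNIV (\<psi>'' e)"
        unfolding \<psi>''_def by (intro continuous_intros ramp''_continuous[OF a0])
    qed
    have gs: "sq_int (len e) (g e)" for e
    proof -
      have "continuous_on {0..len e} (\<lambda>t. R e * w t)" by (intro continuous_intros cw)
      then show ?thesis unfolding g_def using len_pos[of e] by (intro sq_int_continuous(1)) auto
    qed
    have gN: "N2 g e \<le> 2 * Kw * (cmod (R e))\<^sup>2" for e
    proof (cases e)
      case (Hor p)
      show ?thesis using sq_int_linear_combination(2)[OF sw sw, of "R e" 0] by (simp add: g_def Hor Kw_def mult.commute mult.left_commute)
    next
      case (Ver p)
      then show ?thesis by (simp add: g_def Rs edge_norm2_def)
    qed
    have E: "edge_eq lam (len e) (g e) (\<psi> e) (\<psi>' e) (\<psi>'' e)" for e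
      unfolding edge_eq_def using H gs by (simp add: gphi)
    have v0: "\<psi> e 0 = A e" "\<psi>' e 0 = B e + R e" for e
      by (simp_all add: \<psi>_def \<psi>'_def ramp_ends[OF a0])
    \<comment> \<open>On horizontal edges the cubic has a double zero at the far end, on vertical
      edges its coefficient is zero; so the far-end data are untouched by the correction.\<close>
    have RN: "R e * ramp a (len e) = 0" "R e * ramp' a (len e) = 0" for e
      by (cases e; simp add: Rs ramp_ends[OF a0])+
    have vL: "\<psi> e (len e) = A (Hor (tgt e))" "\<psi>' e (len e) = B e * ccs lam (len e) - ?l * csn lam (len e) * A e" for e
      using At[of e] by (simp_all add: \<psi>_def \<psi>'_def RN mult.commute mult.left_commute)
    have sR: "(\<lambda>e. (cmod (R e))\<^sup>2) summable_on UNIV" and sA: "(\<lambda>e. (cmod (A e))\<^sup>2) summable_on UNIV"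
      and sB: "(\<lambda>e. (cmod (B e))\<^sup>2) summable_on UNIV"
      using R2 A B by (auto simp: l2_def)
    have gsum: "N2 g summable_on UNIV"
      by (rule summable_on_comparison_test[of "\<lambda>e. 2 * Kw * (cmod (R e))\<^sup>2"])
         (use gN sR in \<open>auto intro!: summable_on_cmult_right\<close>)
    have g2: "in_L2 a b g" using gs gsum by (simp add: in_L2_def)
    have G: "infsum (N2 g) UNIV \<le> 2 * Kw * l2n r"
    proof -
      have "infsum (N2 g) UNIV \<le> infsum (\<lambda>e. 2 * Kw * (cmod (R e))\<^sup>2) UNIV"
        by (rule infsum_mono[OF gsum]) (use gN sR in \<open>auto intro!: summable_on_cmult_right\<close>)
      also have "\<dots> = 2 * Kw * l2n R" unfolding l2n_def by (rule infsum_cmult_right')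
      finally show ?thesis unfolding R2(2) .
    qed
    have psi2: "in_L2 a b \<psi>"
      unfolding in_L2_def
    proof (intro conjI allI)
      show "sq_int (len e) (\<psi> e)" for e
        using sq_int_continuous(1)[OF H2_edge_continuous[OF H]] len_pos[of e] by simp
      show "N2 \<psi> summable_on UNIV"
      proof (rule summable_on_comparison_test)
        have "l2 (\<lambda>e. B e + R e)" by (rule l2_add(1)[OF B R2(1)])
        then show "(\<lambda>e. Kn * ((cmod (A e))\<^sup>2 + (cmod (B e + R e))\<^sup>2 + N2 g e)) summable_on UNIV"
          unfolding l2_def by (intro summable_on_cmult_right summable_on_add sA gsum)
        show "N2 \<psi> e \<le> Kn * ((cmod (A e))\<^sup>2 + (cmod (B e + R e))\<^sup>2 + N2 g e)" for e
          using Kn(2)[OF E] unfolding v0 .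
      qed simp
    qed
    have phi: "\<phi> = (\<lambda>e t. 1 * g e t + ?l * \<psi> e t)" by (simp add: \<phi>_def gphi)
    have phi2: "in_L2 a b \<phi>" unfolding phi by (rule in_L2_linear_combination[OF g2 psi2])
    have "vertex_conditions a b \<alpha> \<psi> \<psi>'"
      unfolding vertex_conditions_def
    proof (intro allI conjI)
      fix m n
      show "\<psi> (Hor (m - 1, n)) a = \<psi> (Hor (m, n)) 0" using vL(1)[of "Hor (m - 1, n)"] by (simp add: v0)
      show "\<psi> (Ver (m, n)) 0 = \<psi> (Hor (m, n)) 0" by (simp add: v0 AV)
      show "\<psi> (Ver (m, n - 1)) b = \<psi> (Hor (m, n)) 0" using vL(1)[of "Ver (m, n - 1)"] by (simp add: v0)
      show "\<psi>' (Hor (m, n)) 0 - \<psi>' (Hor (m - 1, n)) a + \<psi>' (Ver (m, n)) 0 - \<psi>' (Ver (m, n - 1)) b = of_real (\<alpha> m n) * \<psi> (Hor (m, n)) 0"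
        using vx[of m n] vL(2)[of "Hor (m - 1, n)"] vL(2)[of "Ver (m, n - 1)"] by (simp add: v0 Rs)
    qed
    then have "(\<forall>e. H2_edge (len e) (\<psi> e) (\<psi>' e) (\<psi>'' e)) \<and> vertex_conditions a b \<alpha> \<psi> \<psi>' \<and>
        (\<forall>e. AE t in lborel. t \<in> {0..len e} \<longrightarrow> \<phi> e t = - \<psi>'' e t)"
      using H by (simp add: \<phi>_def)
    then have op: "lattice_op a b \<alpha> \<psi> \<phi>"
      unfolding lattice_op_def using psi2 phi2 by blast
    let ?P = "infsum (N2 \<psi>) UNIV" and ?G = "infsum (N2 g) UNIV"
    have P0: "0 \<le> ?P" and G0: "0 \<le> ?G" by (auto intro: infsum_nonneg)
    have "(\<lambda>e t. \<phi> e t - ?l * \<psi> e t) = g" by (simp add: phi)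
    then have "sqrt ?P \<le> C * sqrt ?G" using C[OF op] by (simp add: L2_norm_def)
    then have "(sqrt ?P)\<^sup>2 \<le> (C * sqrt ?G)\<^sup>2" using P0 by (intro power_mono) auto
    then have PG: "?P \<le> C\<^sup>2 * ?G" using P0 G0 by (simp add: power_mult_distrib)
    have le: "(cmod (A e))\<^sup>2 + (cmod (B e))\<^sup>2 \<le> 2 * (Kt * (N2 \<psi> e + N2 g e)) + 2 * (cmod (R e))\<^sup>2" for e
    proof -
      have "(cmod (B e))\<^sup>2 \<le> 2 * (cmod (B e + R e))\<^sup>2 + 2 * (cmod (R e))\<^sup>2"
        using cmod_add_square_le[of "B e + R e" "- R e"] by simp
      moreover have "(cmod (A e))\<^sup>2 + (cmod (B e + R e))\<^sup>2 \<le> Kt * (N2 \<psi> e + N2 g e)"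
        using Kt(2)[OF E] unfolding v0 .
      ultimately show ?thesis using zero_le_power2[of "cmod (A e)"] by linarith
    qed
    have psum: "N2 \<psi> summable_on UNIV" using psi2 by (simp add: in_L2_def)
    have "l2n A + l2n B = infsum (\<lambda>e. (cmod (A e))\<^sup>2 + (cmod (B e))\<^sup>2) UNIV"
      unfolding l2n_def by (rule infsum_add[OF sA sB, symmetric])
    also have "\<dots> \<le> infsum (\<lambda>e. 2 * (Kt * (N2 \<psi> e + N2 g e)) + 2 * (cmod (R e))\<^sup>2) UNIV"
      by (intro infsum_mono summable_on_add summable_on_cmult_right sA sB sR psum gsum le)
    also have "\<dots> = 2 * (Kt * (?P + ?G)) + 2 * l2n R"
      unfolding l2n_def
      by (simp only: infsum_cmult_right' infsum_add summable_on_add summable_on_cmult_right sR psum gsum)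
    also have "\<dots> \<le> 2 * (Kt * (C\<^sup>2 * ?G + ?G)) + 2 * l2n r"
      unfolding R2(2) using PG Kt(1) by (intro add_right_mono mult_left_mono) auto
    also have "\<dots> = 2 * (Kt * (C\<^sup>2 + 1) * ?G) + 2 * l2n r" by (simp add: algebra_simps)
    also have "\<dots> \<le> 2 * (Kt * (C\<^sup>2 + 1) * (2 * Kw * l2n r)) + 2 * l2n r"
      using G Kt(1) by (intro add_right_mono mult_left_mono) auto
    also have "\<dots> = (2 * (Kt * (C\<^sup>2 + 1) * (2 * Kw)) + 2) * l2n r" by (simp add: algebra_simps)
    finally show "l2n A + l2n B \<le> (2 * (Kt * (C\<^sup>2 + 1) * (2 * Kw)) + 2) * l2n r" .
  qed
qed

text \<open>Extending \<open>u\<close> into the edges by homogeneous solutions gives a quasi-mode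
  whose coupling defect is the residual \<open>r\<close> of the difference equation; the constant is
  inherited because \<open>l2n A = 2 * l2n u\<close>.\<close>

lemma discrete_lower_bound:
  fixes \<alpha> :: "int \<Rightarrow> int \<Rightarrow> real"
  assumes ns: "lam \<notin> spectrum_lattice a b \<alpha>" and Sa: "sn lam a \<noteq> 0" and Sb: "sn lam b \<noteq> 0"
  defines "D \<equiv> \<lambda>(m, n). \<alpha> m n + 2 * cs lam a / sn lam a + 2 * cs lam b / sn lam b"
  shows "\<exists>K\<ge>0. \<forall>u r. l2 u \<longrightarrow> l2 r \<longrightarrow>
    (\<forall>p. r p = of_real (D p) * u p - nbr_sum (1 / sn lam a) (1 / sn lam b) u p) \<longrightarrow> l2n u \<le> K * l2n r"
proof -
  obtain K where K: "0 \<le> K" "\<And>A B r. quasi_mode \<alpha> A B r \<Longrightarrow> l2n A + l2n B \<le> K * l2n r"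
    using quasi_mode_bound[OF ns] by blast
  have S: "csn lam (len e) \<noteq> 0" for e using Sa Sb by (cases e) auto
  define s where "s = (cmod (1 / csn lam a))\<^sup>2 + (cmod (1 / csn lam b))\<^sup>2
    + (cmod (ccs lam a / csn lam a))\<^sup>2 + (cmod (ccs lam b / csn lam b))\<^sup>2"
  have se: "(cmod (1 / csn lam (len e)))\<^sup>2 \<le> s" "(cmod (ccs lam (len e) / csn lam (len e)))\<^sup>2 \<le> s" for e
    unfolding s_def by (cases e; simp)+
  show ?thesis
  proof (intro exI[of _ K] conjI K(1) allI impI)
    fix u r
    assume u: "l2 u" and r: "l2 r" and req: "\<forall>p. r p = of_real (D p) * u p - nbr_sum (1 / sn lam a) (1 / sn lam b) u p"
    define A where "A = (\<lambda>e. u (src e))"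
    define B where "B = (\<lambda>e. (u (tgt e) - ccs lam (len e) * u (src e)) / csn lam (len e))"
    note es = edge_ends_summable[OF u]
    have A2: "l2 A" "l2n A = 2 * l2n u" using es(1,2) by (auto simp: l2_def l2n_def A_def)
    have B2: "l2 B"
    proof (rule l2_dominated(1))
      show "(\<lambda>e. 2 * (s * (cmod (u (tgt e)))\<^sup>2) + 2 * (s * (cmod (u (src e)))\<^sup>2)) summable_on UNIV"
        by (intro summable_on_add summable_on_cmult_right es)
      show "(cmod (B e))\<^sup>2 \<le> 2 * (s * (cmod (u (tgt e)))\<^sup>2) + 2 * (s * (cmod (u (src e)))\<^sup>2)" for e
      proof -
        have Be: "B e = 1 / csn lam (len e) * u (tgt e) + - (ccs lam (len e) / csn lam (len e) * u (src e))"
          by (simp add: B_def diff_divide_distrib)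
        have "(cmod (B e))\<^sup>2 \<le> 2 * (cmod (1 / csn lam (len e) * u (tgt e)))\<^sup>2 + 2 * (cmod (ccs lam (len e) / csn lam (len e) * u (src e)))\<^sup>2"
          unfolding Be using cmod_add_square_le[of "1 / csn lam (len e) * u (tgt e)" "- (ccs lam (len e) / csn lam (len e) * u (src e))"]
          unfolding norm_minus_cancel .
        also have "\<dots> \<le> 2 * (s * (cmod (u (tgt e)))\<^sup>2) + 2 * (s * (cmod (u (src e)))\<^sup>2)"
          unfolding norm_mult[of "1 / csn lam (len e)"] norm_mult[of "ccs lam (len e) / csn lam (len e)"] power_mult_distrib
          by (intro add_mono mult_left_mono mult_right_mono se) auto
        finally show ?thesis .
      qed
    qed
    have "quasi_mode \<alpha> A B r"
      unfolding quasi_mode_def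
    proof (intro conjI allI A2(1) B2 r)
      show "A (Ver p) = A (Hor p)" for p by (simp add: A_def)
      show "A e * ccs lam (len e) + B e * csn lam (len e) = A (Hor (tgt e))" for e
        using S[of e] by (simp add: A_def B_def)
      fix m n
      \<comment> \<open>Both end slopes are encoded in one function, told apart by the test
        \<open>t = 0\<close> since edge lengths are positive, so that \<open>vertex_equation\<close>
        applies with zero source.\<close>
      define \<psi>' where "\<psi>' = (\<lambda>e (t::real). if t = 0 then B e else (ccs lam (len e) * u (tgt e) - u (src e)) / csn lam (len e))"
      have rho0: "rho (\<lambda>e t. 0) p = 0" "slope_term lam L (\<lambda>t. 0) = 0" "sn_moment lam L (\<lambda>t. 0) = 0" for p L
        by (auto simp: rho_def slope_term_def sn_moment_def cs_moment_def split: prod.split)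
      have E: "\<psi>' (Hor (m, n)) 0 - \<psi>' (Hor (m - 1, n)) a + \<psi>' (Ver (m, n)) 0 - \<psi>' (Ver (m, n - 1)) b - of_real (\<alpha> m n) * u (m, n) =
        nbr_sum (1 / sn lam a) (1 / sn lam b) u (m, n) + rho (\<lambda>e t. 0) (m, n)
        - of_real (\<alpha> m n + 2 * cs lam a / sn lam a + 2 * cs lam b / sn lam b) * u (m, n)"
        by (rule vertex_equation) (use a b in \<open>auto simp: \<psi>'_def B_def rho0\<close>)
      have dL: "B e * ccs lam (len e) - of_real lam * csn lam (len e) * A e = \<psi>' e (len e)" for e
      proof -
        let ?C = "ccs lam (len e)" and ?S = "csn lam (len e)"
        have BS: "B e * ?S = u (tgt e) - ?C * u (src e)" using S[of e] by (simp add: B_def)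
        have "(B e * ?C - of_real lam * ?S * A e) * ?S = ?C * (B e * ?S) - of_real lam * ?S * ?S * A e"
          by (simp add: algebra_simps)
        also have "\<dots> = ?C * u (tgt e) - (?C * ?C + of_real lam * ?S * ?S) * u (src e)"
          unfolding BS A_def by (simp add: algebra_simps)
        also have "\<dots> = ?C * u (tgt e) - u (src e)" by (simp add: ccs_csn_square)
        finally show ?thesis using S[of e] len_pos[of e] by (simp add: \<psi>'_def eq_divide_eq)
      qed
      have p0: "\<psi>' e 0 = B e" for e by (simp add: \<psi>'_def)
      have dH: "B (Hor (m - 1, n)) * ccs lam a - of_real lam * csn lam a * A (Hor (m - 1, n)) = \<psi>' (Hor (m - 1, n)) a"
        and dV: "B (Ver (m, n - 1)) * ccs lam b - of_real lam * csn lam b * A (Ver (m, n - 1)) = \<psi>' (Ver (m, n - 1)) b"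
        using dL[of "Hor (m - 1, n)"] dL[of "Ver (m, n - 1)"] by simp_all
      have lin: "x1 + y - p1 + x2 - p2 = c" if "x1 - p1 + x2 - p2 - c = z + 0 - d" "y = d - z" for x1 x2 y p1 p2 c z d :: complex
      proof -
        have "x1 + y - p1 + x2 - p2 = (x1 - p1 + x2 - p2 - c) + y + c" by simp
        then show ?thesis unfolding that by simp
      qed
      show "B (Hor (m, n)) + r (m, n) - (B (Hor (m - 1, n)) * ccs lam a - of_real lam * csn lam a * A (Hor (m - 1, n)))
       + B (Ver (m, n)) - (B (Ver (m, n - 1)) * ccs lam b - of_real lam * csn lam b * A (Ver (m, n - 1)))
       = of_real (\<alpha> m n) * A (Hor (m, n))"
        unfolding dH dV
        using lin[OF E[unfolded p0 rho0(1)] req[rule_format, of "(m, n)", unfolded D_def prod.case]] by (simp add: A_def)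
    qed
    then show "l2n u \<le> K * l2n r" using K(2)[of A B r] A2(2) l2n_nonneg[of u] l2n_nonneg[of B] by linarith
  qed
qed

text \<open>The squared norms \<open>N\<close> grow while the defects stay bounded by
  \<open>2\<close>, against the estimate for a resolvent point as soon as
  \<open>N > 2 * K\<close>.\<close>

lemma standing_wave_in_spectrum:
  assumes qm: "\<And>N. \<exists>B r. quasi_mode \<alpha> (\<lambda>_. 0) B r \<and> l2n B = real N \<and> l2n r \<le> 2"
  shows "lam \<in> spectrum_lattice a b \<alpha>"
proof (rule ccontr)
  assume ns: "lam \<notin> spectrum_lattice a b \<alpha>"
  obtain K where K: "0 \<le> K" "\<And>A B r. quasi_mode \<alpha> A B r \<Longrightarrow> l2n A + l2n B \<le> K * l2n r"
    using quasi_mode_bound[OF ns] by blast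
  obtain N :: nat where N: "2 * K < real N" using reals_Archimedean2 by blast
  obtain B r where B: "quasi_mode \<alpha> (\<lambda>_. 0) B r" "l2n B = real N" "l2n r \<le> 2" using qm by blast
  have "K * l2n r \<le> K * 2" using B(3) K(1) by (rule mult_left_mono)
  then show False using K(2)[OF B(1)] B(2) N l2n_nonneg[of "\<lambda>_::edge. 0"] by linarith
qed

text \<open>If \<open>sn lam a = 0\<close>, a sine wave along one row of horizontal edges vanishes
  at every vertex, whatever the coupling there, and its slope is multiplied by
  \<open>cs lam a\<close>, of modulus \<open>1\<close>, from edge to edge. Truncation costs a defect
  at two vertices. A column is used when \<open>sn lam b = 0\<close>.\<close>

lemma special_in_spectrum:
  fixes \<alpha> :: "int \<Rightarrow> int \<Rightarrow> real"
  assumes S: "sn lam a = 0 \<or> sn lam b = 0"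
  shows "lam \<in> spectrum_lattice a b \<alpha>"
proof -
  have c1: "cmod (ccs lam L) = 1" if "sn lam L = 0" for L
    using cs_sn_square[of lam L] that by (simp add: abs_square_eq_1)
  show ?thesis using S
  proof
    assume S: "sn lam a = 0"
    let ?w = "wave (ccs lam a)"
    show ?thesis
    proof (rule standing_wave_in_spectrum)
      fix N
      define B where "B = (\<lambda>e. case e of Hor (j, k) \<Rightarrow> if k = 0 then ?w N j else 0 | Ver _ \<Rightarrow> 0)"
      define r where "r = (\<lambda>(m::int, n::int). if n = 0 then ?w N (m - 1) * ccs lam a - ?w N m else 0)"
      note w = wave_l2[OF c1[OF S], of N]
      have B2: "l2 B \<longleftrightarrow> l2 (\<lambda>j. B (Hor (j, 0)))" "l2n B = l2n (\<lambda>j. B (Hor (j, 0)))"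
        by (rule l2_inj; force simp: inj_def B_def split: edge.splits)+
      have r2: "l2 r \<longleftrightarrow> l2 (\<lambda>j. r (j, 0))" "l2n r = l2n (\<lambda>j. r (j, 0))"
        by (rule l2_inj; force simp: inj_def r_def)+
      have "quasi_mode \<alpha> (\<lambda>_. 0) B r"
        unfolding quasi_mode_def B2 r2 using w S by (auto simp: B_def r_def l2_def split: edge.splits)
      then show "\<exists>B r. quasi_mode \<alpha> (\<lambda>_. 0) B r \<and> l2n B = real N \<and> l2n r \<le> 2"
        using w by (intro exI[of _ B] exI[of _ r]) (simp add: B2 r2, simp add: B_def r_def)
    qed
  next
    assume S: "sn lam b = 0"
    let ?w = "wave (ccs lam b)"
    show ?thesis
    proof (rule standing_wave_in_spectrum)
      fix N
      define B where "B = (\<lambda>e. case e of Ver (k, j) \<Rightarrow> if k = 0 then ?w N j else 0 | Hor _ \<Rightarrow> 0)"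
      define r where "r = (\<lambda>(m::int, n::int). if m = 0 then ?w N (n - 1) * ccs lam b - ?w N n else 0)"
      note w = wave_l2[OF c1[OF S], of N]
      have B2: "l2 B \<longleftrightarrow> l2 (\<lambda>j. B (Ver (0, j)))" "l2n B = l2n (\<lambda>j. B (Ver (0, j)))"
        by (rule l2_inj; force simp: inj_def B_def split: edge.splits)+
      have r2: "l2 r \<longleftrightarrow> l2 (\<lambda>j. r (0, j))" "l2n r = l2n (\<lambda>j. r (0, j))"
        by (rule l2_inj; force simp: inj_def r_def)+
      have "quasi_mode \<alpha> (\<lambda>_. 0) B r"
        unfolding quasi_mode_def B2 r2 using w S by (auto simp: B_def r_def l2_def split: edge.splits)
      then show "\<exists>B r. quasi_mode \<alpha> (\<lambda>_. 0) B r \<and> l2n B = real N \<and> l2n r \<le> 2"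
        using w by (intro exI[of _ B] exI[of _ r]) (simp add: B2 r2, simp add: B_def r_def)
    qed
  qed
qed

end

section \<open>Separation of variables on the vertex lattice\<close>

lemma l2_product:
  assumes v: "l2 v" and w: "l2 w"
  shows "l2 (\<lambda>(m, n). v m * w n)" "l2n (\<lambda>(m, n). v m * w n) = l2n v * l2n w"
proof -
  let ?f = "\<lambda>(m, n). (cmod (v m))\<^sup>2 * (cmod (w n))\<^sup>2"
  have sv: "(\<lambda>m. (cmod (v m))\<^sup>2) summable_on UNIV" and sw: "(\<lambda>n. (cmod (w n))\<^sup>2) summable_on UNIV"
    using v w by (auto simp: l2_def)
  have 1: "((\<lambda>n. ?f (m, n)) has_sum ((cmod (v m))\<^sup>2 * l2n w)) UNIV" for m
    using has_sum_cmult_right[OF has_sum_infsum[OF sw], of "(cmod (v m))\<^sup>2"] by (simp add: l2n_def)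
  have 2: "((\<lambda>m. (cmod (v m))\<^sup>2 * l2n w) has_sum (l2n v * l2n w)) UNIV"
    using has_sum_cmult_left[OF has_sum_infsum[OF sv], of "l2n w"] by (simp add: l2n_def)
  have "?f summable_on Sigma UNIV (\<lambda>_. UNIV)"
    by (rule summable_on_SigmaI[OF 1]) (use 2 has_sum_imp_summable in auto)
  then have "(?f has_sum (l2n v * l2n w)) (Sigma UNIV (\<lambda>_. UNIV))"
    by (rule has_sum_SigmaI[OF 1 2])
  moreover have "(\<lambda>p. (cmod (case p of (m, n) \<Rightarrow> v m * w n))\<^sup>2) = ?f"
    by (auto simp: norm_mult power_mult_distrib)
  ultimately show "l2 (\<lambda>(m, n). v m * w n)" "l2n (\<lambda>(m, n). v m * w n) = l2n v * l2n w"
    by (auto simp: l2_def l2n_def has_sum_iff)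
qed

text \<open>One coordinate direction of the vertex operator, with opposite sign: adjacency minus
  coupling.\<close>

definition jacobi :: "real \<Rightarrow> (int \<Rightarrow> real) \<Rightarrow> (int \<Rightarrow> complex) \<Rightarrow> int \<Rightarrow> complex" where
  "jacobi c \<alpha> v m = of_real c * (v (m + 1) + v (m - 1)) - of_real (\<alpha> m) * v m"

text \<open>Existence of a Weyl sequence for \<open>z\<close>, written with squared norms.\<close>

definition approx_ev :: "((int \<Rightarrow> complex) \<Rightarrow> int \<Rightarrow> complex) \<Rightarrow> real \<Rightarrow> bool" where
  "approx_ev X z \<longleftrightarrow> (\<forall>\<epsilon>>0. \<exists>v. l2 v \<and> 0 < l2n v \<and> l2 (\<lambda>m. X v m - of_real z * v m) \<and>
     l2n (\<lambda>m. X v m - of_real z * v m) \<le> \<epsilon> * l2n v)"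

text \<open>Couplings that depend on \<open>m\<close> only make the vertex operator, up to an
  additive constant and a sign, a sum of operators in \<open>m\<close> and in \<open>n\<close>. If
  \<open>z1 + z2\<close> equals that constant, the product of approximate eigenvectors is an
  approximate null vector.\<close>

lemma (in lattice) in_spectrum_tensor:
  assumes Sa: "sn lam a \<noteq> 0" and Sb: "sn lam b \<noteq> 0"
    and z1: "approx_ev (jacobi (1 / sn lam a) \<alpha>) z1" and z2: "approx_ev (jacobi (1 / sn lam b) (\<lambda>_. 0)) z2"
    and z: "z1 + z2 = 2 * cs lam a / sn lam a + 2 * cs lam b / sn lam b"
  shows "lam \<in> spectrum_lattice a b (\<lambda>m n. \<alpha> m)"
proof (rule ccontr)
  assume ns: "lam \<notin> spectrum_lattice a b (\<lambda>m n. \<alpha> m)"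
  let ?D = "\<lambda>(m, n). \<alpha> m + 2 * cs lam a / sn lam a + 2 * cs lam b / sn lam b"
  let ?nb = "nbr_sum (1 / sn lam a) (1 / sn lam b)"
  obtain K where K: "0 \<le> K" "\<And>u r. l2 u \<Longrightarrow> l2 r \<Longrightarrow>
    (\<And>p. r p = of_real (?D p) * u p - ?nb u p) \<Longrightarrow> l2n u \<le> K * l2n r"
    using discrete_lower_bound[OF ns Sa Sb] by blast
  \<comment> \<open>Makes \<open>K * (4 * \<epsilon>) < 1\<close>; the \<open>4\<close> comes from
    adding two residuals with a factor \<open>2\<close> each.\<close>
  define \<epsilon> where "\<epsilon> = 1 / (8 * (K + 1))"
  have e: "0 < \<epsilon>" "K * (4 * \<epsilon>) < 1" using K(1) by (auto simp: \<epsilon>_def field_simps)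
  define X where "X = jacobi (1 / sn lam a) \<alpha>"
  define Y where "Y = jacobi (1 / sn lam b) (\<lambda>_. 0)"
  obtain v where v: "l2 v" "0 < l2n v" "l2 (\<lambda>m. X v m - of_real z1 * v m)"
      "l2n (\<lambda>m. X v m - of_real z1 * v m) \<le> \<epsilon> * l2n v"
    using z1 e(1) unfolding approx_ev_def X_def by blast
  obtain w where w: "l2 w" "0 < l2n w" "l2 (\<lambda>m. Y w m - of_real z2 * w m)"
      "l2n (\<lambda>m. Y w m - of_real z2 * w m) \<le> \<epsilon> * l2n w"
    using z2 e(1) unfolding approx_ev_def Y_def by blast
  define x where "x = (\<lambda>m. X v m - of_real z1 * v m)"
  define y where "y = (\<lambda>m. Y w m - of_real z2 * w m)"
  define u where "u = (\<lambda>(m, n). v m * w n)"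
  define r where "r = (\<lambda>p. - 1 * ((case p of (m, n) \<Rightarrow> x m * w n) + (case p of (m, n) \<Rightarrow> v m * y n)))"
  note pu = l2_product[OF v(1) w(1), folded u_def]
  have x2: "l2 x" and y2: "l2 y" using v(3) w(3) by (simp_all add: x_def y_def)
  note p1 = l2_product[OF x2 w(1)]
  note p2 = l2_product[OF v(1) y2]
  note pa = l2_add[OF p1(1) p2(1)]
  have r2: "l2 r" unfolding r_def by (rule l2_cmult(1)[OF pa(1)])
  have rn: "l2n r = l2n (\<lambda>p. (case p of (m, n) \<Rightarrow> x m * w n) + (case p of (m, n) \<Rightarrow> v m * y n))"
    unfolding r_def l2_cmult(2) by simp
  have "l2n r \<le> 2 * (l2n x * l2n w) + 2 * (l2n v * l2n y)"
    unfolding rn using pa(2) by (simp only: p1(2) p2(2))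
  also have "\<dots> \<le> 2 * ((\<epsilon> * l2n v) * l2n w) + 2 * (l2n v * (\<epsilon> * l2n w))"
    using v(4)[folded x_def] w(4)[folded y_def]
    by (intro add_mono mult_left_mono mult_right_mono) auto
  also have "\<dots> = 4 * \<epsilon> * l2n u" unfolding pu(2) by simp
  finally have rle: "l2n r \<le> 4 * \<epsilon> * l2n u" .
  have "l2n u \<le> K * l2n r"
  proof (rule K(2)[OF pu(1) r2])
    fix p :: "int \<times> int"
    obtain m n where p: "p = (m, n)" by (cases p)
    have "?D (m, n) = \<alpha> m + (z1 + z2)" using z by simp
    then show "r p = of_real (?D p) * u p - ?nb u p"
      unfolding p by (simp only:) (simp add: r_def u_def x_def y_def X_def Y_def jacobi_def nbr_sum_def algebra_simps)
  qed
  also have "\<dots> \<le> K * (4 * \<epsilon> * l2n u)" using rle K(1) by (rule mult_left_mono)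
  also have "\<dots> = (K * (4 * \<epsilon>)) * l2n u" by simp
  also have "\<dots> < 1 * l2n u" using e(2) v(2) w(2) by (intro mult_strict_right_mono) (auto simp: pu(2))
  finally show False by simp
qed

text \<open>Truncating a plane wave to \<open>{1..N}\<close> leaves a residual at the four boundary sites only,
  which is negligible against the norm \<open>N\<close>; the support avoids the defect at \<open>0\<close>.\<close>

lemma approx_ev_plane_wave:
  assumes \<alpha>: "\<And>m. 1 \<le> m \<Longrightarrow> \<alpha> m = \<gamma>"
  shows "approx_ev (jacobi c \<alpha>) (2 * c * cos \<theta> - \<gamma>)"
  unfolding approx_ev_def
proof (intro allI impI)
  fix \<epsilon> :: real assume \<epsilon>: "0 < \<epsilon>"
  define z where "z = 2 * c * cos \<theta> - \<gamma>"
  \<comment> \<open>Bounds the squared residual at each of the at most four exceptional sites;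
    \<open>N\<close> is chosen against their total \<open>4 * Q\<close>.\<close>
  define Q where "Q = (2 * \<bar>c\<bar> + \<bar>\<gamma>\<bar> + \<bar>z\<bar>)\<^sup>2"
  obtain N0 :: nat where "4 * Q / \<epsilon> < real N0" using reals_Archimedean2 by blast
  then obtain N :: nat where N: "4 * Q / \<epsilon> < real N" "1 \<le> N" by (intro that[of "Suc N0"]) auto
  define v where "v = (\<lambda>m. if 1 \<le> m \<and> m \<le> int N then cis (\<theta> * of_int m) else 0)"
  define r where "r = (\<lambda>m. jacobi c \<alpha> v m - of_real z * v m)"
  have v2: "l2 v" "l2n v = (\<Sum>m\<in>{1..int N}. (cmod (v m))\<^sup>2)"
    by (rule l2_finite[of "{1..int N}"]; simp add: v_def)+
  have "(\<Sum>m\<in>{1..int N}. (cmod (v m))\<^sup>2) = (\<Sum>m\<in>{1..int N}. 1)" by (rule sum.cong) (auto simp: v_def)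
  then have vN: "l2n v = real N" unfolding v2(2) by simp
  let ?G = "{0, 1, int N, int N + 1}"
  have rf: "r m = 0" if np: "m \<notin> ?G" for m
  proof -
    consider "m < 0 \<or> m > int N + 1" | "2 \<le> m" "m \<le> int N - 1" using np by fastforce
    then show ?thesis
    proof cases
      case 1
      then show ?thesis by (auto simp: r_def jacobi_def v_def)
    next
      case 2
      have vm: "v m = cis (\<theta> * of_int m)" "v (m + 1) = cis (\<theta> * of_int m) * cis \<theta>" "v (m - 1) = cis (\<theta> * of_int m) * cis (- \<theta>)"
        using 2 by (auto simp: v_def cis_mult algebra_simps)
      have "cis \<theta> + cis (- \<theta>) = of_real (2 * cos \<theta>)" by (simp add: complex_eq_iff)
      then have "of_real c * (v (m + 1) + v (m - 1)) = of_real c * of_real (2 * cos \<theta>) * v m"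
        unfolding vm distrib_left[symmetric] by simp
      moreover have "\<alpha> m = \<gamma>" using 2 by (intro \<alpha>) simp
      ultimately show ?thesis by (simp add: r_def jacobi_def z_def algebra_simps)
    qed
  qed
  have v1: "cmod (v m) \<le> 1" for m by (simp add: v_def)
  have rb: "(cmod (r m))\<^sup>2 \<le> Q" for m
  proof -
    \<comment> \<open>Where \<open>\<alpha>\<close> may differ from \<open>\<gamma>\<close>, at
      \<open>m \<le> 0\<close>, the wave vanishes.\<close>
    have av: "of_real (\<alpha> m) * v m = of_real \<gamma> * v m" using \<alpha>[of m] by (auto simp: v_def)
    have "r m = of_real c * v (m + 1) + of_real c * v (m - 1) - of_real \<gamma> * v m - of_real z * v m"
      unfolding r_def jacobi_def av distrib_left ..
    then have "cmod (r m) \<le> \<bar>c\<bar> * cmod (v (m + 1)) + \<bar>c\<bar> * cmod (v (m - 1)) + \<bar>\<gamma>\<bar> * cmod (v m) + \<bar>z\<bar> * cmod (v m)"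
      by (auto intro!: order_trans[OF norm_triangle_ineq4] order_trans[OF norm_triangle_ineq] add_mono simp: norm_mult)
    also have "\<dots> \<le> \<bar>c\<bar> * 1 + \<bar>c\<bar> * 1 + \<bar>\<gamma>\<bar> * 1 + \<bar>z\<bar> * 1"
      by (intro add_mono mult_left_mono v1) auto
    finally show ?thesis unfolding Q_def by (intro power_mono) auto
  qed
  have r2: "l2 r" "l2n r = (\<Sum>m\<in>?G. (cmod (r m))\<^sup>2)" by (rule l2_finite[of ?G]; use rf in simp)+
  have "l2n r \<le> real (card ?G) * Q" unfolding r2(2) by (rule sum_bounded_above[OF rb])
  also have "\<dots> \<le> 4 * Q" by (intro mult_right_mono) (auto simp: Q_def card_insert_if)
  also have "\<dots> \<le> \<epsilon> * l2n v" using N(1) \<epsilon> unfolding vN by (simp add: field_simps)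
  finally have "l2n r \<le> \<epsilon> * l2n v" .
  then show "\<exists>v. l2 v \<and> 0 < l2n v \<and> l2 (\<lambda>m. jacobi c \<alpha> v m - of_real (2 * c * cos \<theta> - \<gamma>) * v m) \<and>
     l2n (\<lambda>m. jacobi c \<alpha> v m - of_real (2 * c * cos \<theta> - \<gamma>) * v m) \<le> \<epsilon> * l2n v"
    using v2(1) vN N(2) r2(1) unfolding r_def z_def by (intro exI[of _ v]) auto
qed

lemma summable_on_int_geometric:
  fixes q :: real
  assumes "0 \<le> q" "q < 1"
  shows "(\<lambda>m::int. q ^ nat \<bar>m\<bar>) summable_on UNIV"
proof -
  have U: "(UNIV :: int set) = range int \<union> range (\<lambda>n. - int n)"
    by (auto intro: int_cases2)
  have g: "(\<lambda>n::nat. q ^ n) summable_on UNIV"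
    using assms by (intro summable_nonneg_imp_summable_on summable_geometric) auto
  have "(\<lambda>m::int. q ^ nat \<bar>m\<bar>) summable_on range int"
    by (subst summable_on_reindex) (use g in \<open>auto simp: o_def\<close>)
  moreover have "(\<lambda>m::int. q ^ nat \<bar>m\<bar>) summable_on range (\<lambda>n. - int n)"
    by (subst summable_on_reindex) (use g in \<open>auto simp: o_def inj_def\<close>)
  ultimately show ?thesis unfolding U by (rule summable_on_union)
qed

text \<open>The sequence of powers of \<open>\<rho>\<close> is an exact eigenvector: hypothesis
  \<open>1\<close> is the recurrence away from the chain, hypothesis \<open>0\<close> the one at
  \<open>m = 0\<close>, where both neighbours carry the value \<open>\<rho>\<close>.\<close>

lemma approx_ev_bound_state:
  assumes \<rho>: "\<rho> \<noteq> 0" "\<bar>\<rho>\<bar> < 1"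
    and 1: "c * (\<rho> + 1 / \<rho>) - \<gamma> = z" and 0: "2 * c * \<rho> - \<gamma>t = z"
  shows "approx_ev (jacobi c (\<lambda>m. if m = 0 then \<gamma>t else \<gamma>)) z"
proof -
  define v where "v = (\<lambda>m::int. complex_of_real (\<rho> ^ nat \<bar>m\<bar>))"
  let ?\<alpha> = "\<lambda>m::int. if m = 0 then \<gamma>t else \<gamma>"
  have "(\<lambda>m::int. (\<rho>\<^sup>2) ^ nat \<bar>m\<bar>) summable_on UNIV"
    using \<rho> by (intro summable_on_int_geometric) (auto simp: abs_square_less_1)
  moreover have "(cmod (v m))\<^sup>2 = (\<rho>\<^sup>2) ^ nat \<bar>m\<bar>" for m
  proof -
    have "(cmod (v m))\<^sup>2 = (\<rho> ^ nat \<bar>m\<bar>)\<^sup>2" unfolding v_def norm_of_real by simp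
    also have "\<dots> = (\<rho>\<^sup>2) ^ nat \<bar>m\<bar>" by (metis mult.commute power_mult)
    finally show ?thesis .
  qed
  ultimately have v2: "l2 v" by (simp add: l2_def)
  have vp: "0 < l2n v" using l2_pointwise[OF v2, of 0] by (simp add: v_def)
  have "jacobi c ?\<alpha> v m - of_real z * v m = 0" for m
  proof -
    have "c * (\<rho> ^ nat \<bar>m + 1\<bar> + \<rho> ^ nat \<bar>m - 1\<bar>) - ?\<alpha> m * \<rho> ^ nat \<bar>m\<bar> - z * \<rho> ^ nat \<bar>m\<bar> = 0"
    proof (cases "m = 0")
      case True
      then show ?thesis using 0 by simp
    next
      case False
      define k where "k = nat \<bar>m\<bar> - 1"
      have k: "nat \<bar>m\<bar> = Suc k" using False by (simp add: k_def)
      have "nat \<bar>m + 1\<bar> = k \<and> nat \<bar>m - 1\<bar> = Suc (Suc k) \<or> nat \<bar>m - 1\<bar> = k \<and> nat \<bar>m + 1\<bar> = Suc (Suc k)"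
      proof (cases "0 < m")
        case True
        then have "m = int k + 1" using k by simp
        then show ?thesis by auto
      next
        case neg: False
        then have "m = - int k - 1" using k False by simp
        then show ?thesis by auto
      qed
      then have s: "\<rho> ^ nat \<bar>m + 1\<bar> + \<rho> ^ nat \<bar>m - 1\<bar> = \<rho> ^ k + \<rho> ^ Suc (Suc k)" by (metis add.commute)
      have "c * (\<rho> ^ k + \<rho> ^ Suc (Suc k)) = c * (\<rho> + 1 / \<rho>) * \<rho> ^ Suc k" using \<rho>(1) by (simp add: field_simps)
      also have "c * (\<rho> + 1 / \<rho>) = z + \<gamma>" using 1 by simp
      finally show ?thesis unfolding s k using False by (simp add: algebra_simps)
    qed
    then have "complex_of_real (c * (\<rho> ^ nat \<bar>m + 1\<bar> + \<rho> ^ nat \<bar>m - 1\<bar>) - ?\<alpha> m * \<rho> ^ nat \<bar>m\<bar> - z * \<rho> ^ nat \<bar>m\<bar>) = 0"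
      by (simp only: of_real_0)
    then show ?thesis by (simp only: jacobi_def v_def of_real_diff of_real_mult of_real_add)
  qed
  then have "(\<lambda>m. jacobi c ?\<alpha> v m - of_real z * v m) = (\<lambda>m. 0)" by (rule ext)
  then have "l2 (\<lambda>m. jacobi c ?\<alpha> v m - of_real z * v m)" "l2n (\<lambda>m. jacobi c ?\<alpha> v m - of_real z * v m) = 0"
    by (simp_all add: l2_def l2n_def)
  then show ?thesis unfolding approx_ev_def using v2 vp
    by (intro allI impI exI[of _ v]) simp
qed

context lattice
begin

abbreviation "H0 \<equiv> 2 * cs lam a / sn lam a + 2 * cs lam b / sn lam b"

text \<open>The same fraction \<open>t\<close> of the extreme symbol is taken in both directions,
  and \<open>sgn\<close> compensates the sign of each weight. The adjacency symbol is then
  \<open>t\<close> times the Schur bound and sweeps the whole band.\<close>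

lemma band_in_spectrum:
  assumes Sa: "sn lam a \<noteq> 0" and Sb: "sn lam b \<noteq> 0"
    and \<alpha>: "\<And>m. 1 \<le> m \<Longrightarrow> \<alpha> m = \<gamma>"
    and le: "\<bar>\<gamma> + H0\<bar> \<le> 2 / \<bar>sn lam a\<bar> + 2 / \<bar>sn lam b\<bar>"
  shows "lam \<in> spectrum_lattice a b (\<lambda>m n. \<alpha> m)"
proof -
  let ?M = "2 / \<bar>sn lam a\<bar> + 2 / \<bar>sn lam b\<bar>"
  have M: "0 < ?M" using Sa Sb by (intro add_pos_pos) auto
  define t where "t = (\<gamma> + H0) / ?M"
  have t: "\<bar>t\<bar> \<le> 1" using le M by (simp add: t_def abs_divide)
  have tM: "t * ?M = \<gamma> + H0" using M by (simp add: t_def)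
  have c: "2 * (1 / s) * cos (arccos (t * sgn s)) = t * (2 / \<bar>s\<bar>)" if "s \<noteq> 0" for s :: real
  proof -
    have "\<bar>t * sgn s\<bar> \<le> 1" using t that by (simp add: abs_mult)
    then have "cos (arccos (t * sgn s)) = t * sgn s" by (intro cos_arccos) auto
    then show ?thesis using that by (simp add: sgn_real_def)
  qed
  show ?thesis
  proof (rule in_spectrum_tensor[OF Sa Sb])
    show "approx_ev (jacobi (1 / sn lam a) \<alpha>) (2 * (1 / sn lam a) * cos (arccos (t * sgn (sn lam a))) - \<gamma>)"
      by (rule approx_ev_plane_wave[OF \<alpha>])
    show "approx_ev (jacobi (1 / sn lam b) (\<lambda>_. 0)) (2 * (1 / sn lam b) * cos (arccos (t * sgn (sn lam b))) - 0)"
      by (rule approx_ev_plane_wave) simp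
    show "2 * (1 / sn lam a) * cos (arccos (t * sgn (sn lam a))) - \<gamma> + (2 * (1 / sn lam b) * cos (arccos (t * sgn (sn lam b))) - 0) = H0"
      unfolding c[OF Sa] c[OF Sb] using tM by (simp add: distrib_left)
  qed
qed

text \<open>Subtracting the two bound-state equations across the chain gives
  \<open>1 / \<rho> - \<rho> = 2 * s\<close>, and then \<open>W\<close> is the value of
  \<open>(\<rho> + 1 / \<rho>) / sn lam a\<close>. The remainder \<open>z2\<close> must be supplied
  by a plane wave along the chain, whose values are bounded by
  \<open>2 / \<bar>sn lam b\<bar>\<close>.\<close>

lemma defect_in_spectrum:
  assumes Sa: "sn lam a \<noteq> 0" and Sb: "sn lam b \<noteq> 0"
    and d: "\<gamma> \<noteq> \<gamma>t"
    and le: "\<bar>\<gamma> + H0 - sgn (\<gamma> - \<gamma>t) * sqrt ((\<gamma> - \<gamma>t)\<^sup>2 + 4 / (sn lam a)\<^sup>2)\<bar> \<le> 2 / \<bar>sn lam b\<bar>"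
  shows "lam \<in> spectrum_lattice a b (\<lambda>m n. if m = 0 then \<gamma>t else \<gamma>)"
proof -
  define \<delta> where "\<delta> = \<gamma> - \<gamma>t"
  define W where "W = sgn \<delta> * sqrt (\<delta>\<^sup>2 + 4 / (sn lam a)\<^sup>2)"
  define s where "s = \<delta> * sn lam a / 2"
  define q where "q = sqrt (s\<^sup>2 + 1)"
  \<comment> \<open>The root of \<open>\<rho>\<^sup>2 + 2 * s * \<rho> - 1 = 0\<close> of modulus
    less than \<open>1\<close>; it has the sign of \<open>s\<close>.\<close>
  define \<rho> where "\<rho> = sgn s * (q - \<bar>s\<bar>)"
  have s0: "s \<noteq> 0" using Sa d by (simp add: s_def \<delta>_def)
  have q: "\<bar>s\<bar> < q" "q < \<bar>s\<bar> + 1" "q\<^sup>2 = s\<^sup>2 + 1"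
  proof -
    show q2: "q\<^sup>2 = s\<^sup>2 + 1" by (simp add: q_def)
    show "\<bar>s\<bar> < q" unfolding q_def by (rule real_less_rsqrt) simp
    show "q < \<bar>s\<bar> + 1" unfolding q_def using s0 by (intro real_less_lsqrt) (auto simp: power2_eq_square algebra_simps)
  qed
  have sg: "sgn s * sgn s = 1" using s0 by (simp add: sgn_real_def)
  have "(q - \<bar>s\<bar>) * (q + \<bar>s\<bar>) = 1" using q(3) by (simp add: algebra_simps power2_eq_square)
  then have inv: "\<rho> * (sgn s * (q + \<bar>s\<bar>)) = 1" unfolding \<rho>_def using sg by (simp add: algebra_simps mult.assoc[symmetric])
  then have \<rho>0: "\<rho> \<noteq> 0" by auto
  have ri: "1 / \<rho> = sgn s * (q + \<bar>s\<bar>)" using inv \<rho>0 by (simp add: field_simps)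
  have ab: "\<bar>\<rho>\<bar> < 1" using q s0 by (simp add: \<rho>_def abs_mult)
  have "sgn s * \<bar>s\<bar> = s" by (simp add: sgn_real_def)
  then have sum: "\<rho> + 1 / \<rho> = 2 * sgn s * q" and diff: "1 / \<rho> - \<rho> = 2 * s"
    unfolding ri by (simp_all add: \<rho>_def algebra_simps)
  have sW: "1 / sn lam a * (\<rho> + 1 / \<rho>) = W"
  proof -
    have "\<delta>\<^sup>2 + 4 / (sn lam a)\<^sup>2 = (2 / sn lam a)\<^sup>2 * (s\<^sup>2 + 1)"
      using Sa by (simp add: s_def power_divide power_mult_distrib field_simps)
    then have "sqrt (\<delta>\<^sup>2 + 4 / (sn lam a)\<^sup>2) = 2 / \<bar>sn lam a\<bar> * q"
      by (simp add: real_sqrt_mult q_def abs_divide real_sqrt_divide)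
    moreover have "sgn s = sgn \<delta> * sgn (sn lam a)" by (simp add: s_def sgn_mult sgn_divide)
    moreover have "sgn (sn lam a) / sn lam a = 1 / \<bar>sn lam a\<bar>" using Sa by (simp add: sgn_real_def)
    ultimately show ?thesis unfolding sum W_def by (simp add: field_simps)
  qed
  have "1 / sn lam a * (2 * s) = \<delta>" using Sa by (simp add: s_def)
  then have "1 / sn lam a * ((\<rho> + 1 / \<rho>) - (1 / \<rho> - \<rho>)) = W - \<delta>"
    unfolding right_diff_distrib[of "1 / sn lam a"] sW diff by simp
  then have e2: "2 * (1 / sn lam a) * \<rho> = W - \<delta>" by simp
  define z2 where "z2 = \<gamma> + H0 - W"
  have "\<bar>z2\<bar> \<le> 2 / \<bar>sn lam b\<bar>" using le unfolding z2_def W_def \<delta>_def .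
  then have "\<bar>z2 * sn lam b / 2\<bar> \<le> 1" using Sb by (simp add: abs_mult pos_le_divide_eq)
  then have cz: "cos (arccos (z2 * sn lam b / 2)) = z2 * sn lam b / 2" by (intro cos_arccos) auto
  show ?thesis
  proof (rule in_spectrum_tensor[OF Sa Sb, where ?z1.0 = "W - \<gamma>" and ?z2.0 = "2 * (1 / sn lam b) * cos (arccos (z2 * sn lam b / 2)) - 0"])
    show "approx_ev (jacobi (1 / sn lam a) (\<lambda>m. if m = 0 then \<gamma>t else \<gamma>)) (W - \<gamma>)"
      by (rule approx_ev_bound_state[OF \<rho>0 ab]) (use sW e2 in \<open>auto simp: \<delta>_def\<close>)
    show "approx_ev (jacobi (1 / sn lam b) (\<lambda>_. 0)) (2 * (1 / sn lam b) * cos (arccos (z2 * sn lam b / 2)) - 0)"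
      by (rule approx_ev_plane_wave) simp
    show "W - \<gamma> + (2 * (1 / sn lam b) * cos (arccos (z2 * sn lam b / 2)) - 0) = H0"
    proof -
      have e: "2 * (1 / sn lam b) * (z2 * sn lam b / 2) = z2" using Sb by simp
      show ?thesis unfolding cz e unfolding z2_def by linarith
    qed
  qed
qed

end

subsection \<open>Monotonicity between Dirichlet eigenvalues\<close>

text \<open>Half-angle functions. For \<open>lam > 0\<close>, with \<open>k\<close> its root and
  \<open>y\<close> half of the phase \<open>k * L\<close> reduced modulo \<open>pi\<close>, they are
  \<open>k * tan y\<close> and \<open>k * cot y\<close>; for \<open>lam < 0\<close> they become
  \<open>- k * tanh y\<close> and \<open>k * coth y\<close> with \<open>k = sqrt (- lam)\<close> and
  \<open>y = k * L / 2\<close>.\<close>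

definition Tm :: "real \<Rightarrow> real \<Rightarrow> real" where "Tm lam L = 1 / \<bar>sn lam L\<bar> - cs lam L / sn lam L"
definition Tp :: "real \<Rightarrow> real \<Rightarrow> real" where "Tp lam L = 1 / \<bar>sn lam L\<bar> + cs lam L / sn lam L"

text \<open>The intervals between consecutive Dirichlet eigenvalues \<open>(n\<pi>/L)\<^sup>2\<close> of an edge, the first one
  extended to \<open>-\<infinity>\<close>.\<close>

definition seg :: "real \<Rightarrow> nat \<Rightarrow> real set" where
  "seg L n = {lam. lam < (real (Suc n) * pi / L)\<^sup>2 \<and> (n = 0 \<or> (real n * pi / L)\<^sup>2 < lam)}"

lemma seg_convex: "x \<in> seg L n \<Longrightarrow> z \<in> seg L n \<Longrightarrow> x \<le> y \<Longrightarrow> y \<le> z \<Longrightarrow> y \<in> seg L n"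
  by (auto simp: seg_def)

lemma seg_nonpos: "0 < L \<Longrightarrow> lam \<le> 0 \<Longrightarrow> lam \<in> seg L 0"
  by (auto simp: seg_def intro!: order_le_less_trans[of lam 0])

lemma seg_nonpos_iff: "0 < L \<Longrightarrow> lam \<le> 0 \<Longrightarrow> lam \<in> seg L n \<Longrightarrow> n = 0"
  unfolding seg_def using zero_le_power2[of "real n * pi / L"] by auto

text \<open>On each interval the sign \<open>(-1) ^ n\<close> cancels both in
  \<open>\<bar>sn lam L\<bar>\<close> and in \<open>cs lam L / sn lam L\<close>, leaving half-angle
  formulas in \<open>y\<close>.\<close>

lemma seg_pos:
  assumes L: "0 < L" and lam: "0 < lam" "lam \<in> seg L n"
  defines "y \<equiv> (sqrt lam * L - real n * pi) / 2"
  shows "0 < y" "y < pi / 2" "sn lam L \<noteq> 0" "\<bar>sn lam L\<bar> = 2 * sin y * cos y / sqrt lam"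
    "Tm lam L = sqrt lam * tan y" "Tp lam L = sqrt lam / tan y"
proof -
  define k where "k = sqrt lam"
  have k: "0 < k" using lam by (simp add: k_def)
  have "sqrt lam < sqrt ((real (Suc n) * pi / L)\<^sup>2)"
    by (rule real_sqrt_less_mono) (use lam in \<open>auto simp: seg_def\<close>)
  then have u: "k < real (Suc n) * pi / L" using L by (simp add: k_def)
  have l: "real n * pi / L < k"
  proof (cases "n = 0")
    case False
    then have "sqrt ((real n * pi / L)\<^sup>2) < sqrt lam"
      by (intro real_sqrt_less_mono) (use lam in \<open>auto simp: seg_def\<close>)
    then show ?thesis using L by (simp add: k_def)
  qed (use k in simp)
  show y: "0 < y" "y < pi / 2"
    using u l L by (auto simp: y_def k_def[symmetric] field_simps)
  have kL: "k * L = 2 * y + real n * pi" by (simp add: y_def k_def field_simps)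
  define s where "s = ((-1) ^ n :: real)"
  have ss: "\<bar>s\<bar> = 1" "s * s = 1" by (auto simp: s_def power_mult_distrib[symmetric] power_abs)
  have sin: "sin (k * L) = s * sin (2 * y)" and cos: "cos (k * L) = s * cos (2 * y)"
    unfolding kL by (simp_all add: sin_add cos_add sin_npi cos_npi s_def mult.commute)
  have sp: "0 < sin y" "0 < cos y" using y by (auto intro!: sin_gt_zero cos_gt_zero)
  have sn: "sn lam L = s * (2 * sin y * cos y) / k" using lam sin by (simp add: sn_def k_def sin_double)
  have csn: "cs lam L = s * cos (2 * y)" using lam cos by (simp add: cs_def k_def)
  show s0: "sn lam L \<noteq> 0" using sp k ss by (auto simp: sn)
  show ab: "\<bar>sn lam L\<bar> = 2 * sin y * cos y / sqrt lam"
    using sp k ss by (simp add: sn abs_mult k_def)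
  have q: "cs lam L / sn lam L = k * cos (2 * y) / (2 * sin y * cos y)"
    using ss sp k unfolding sn csn by (auto simp: field_simps)
  have p: "1 / \<bar>sn lam L\<bar> = k / (2 * sin y * cos y)" unfolding ab k_def[symmetric] by simp
  have "Tm lam L = k * (1 - cos (2 * y)) / (2 * sin y * cos y)"
    unfolding Tm_def p q by (simp add: diff_divide_distrib right_diff_distrib)
  also have "1 - cos (2 * y) = 2 * (sin y)\<^sup>2" by (simp add: cos_double_sin)
  finally show "Tm lam L = sqrt lam * tan y" using sp by (simp add: k_def tan_def power2_eq_square)
  have "Tp lam L = k * (1 + cos (2 * y)) / (2 * sin y * cos y)"
    unfolding Tp_def p q by (simp add: add_divide_distrib distrib_left)
  also have "1 + cos (2 * y) = 2 * (cos y)\<^sup>2" by (simp add: cos_double_cos)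
  finally show "Tp lam L = sqrt lam / tan y" using sp by (simp add: k_def tan_def power2_eq_square)
qed

lemma seg_neg:
  assumes L: "0 < L" and lam: "lam < 0"
  defines "y \<equiv> sqrt (- lam) * L / 2"
  shows "0 < y" "sn lam L > 0" "Tm lam L = - (sqrt (- lam) * tanh y)" "Tp lam L = sqrt (- lam) / tanh y"
proof -
  define k where "k = sqrt (- lam)"
  have k: "0 < k" using lam by (simp add: k_def)
  show y: "0 < y" using k L by (simp add: y_def k_def[symmetric])
  have kL: "k * L = 2 * y" by (simp add: y_def k_def)
  have sp: "0 < sinh y" "0 < cosh y" using y by (auto simp: cosh_real_pos)
  have sn: "sn lam L = 2 * sinh y * cosh y / k" using lam kL by (simp add: sn_def k_def sinh_double)
  have csn: "cs lam L = cosh (2 * y)" using lam kL by (simp add: cs_def k_def)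
  show s0: "sn lam L > 0" using sp k by (simp add: sn)
  have q: "cs lam L / sn lam L = k * cosh (2 * y) / (2 * sinh y * cosh y)"
    using sp k unfolding sn csn by (auto simp: field_simps)
  have p: "1 / \<bar>sn lam L\<bar> = k / (2 * sinh y * cosh y)"
    unfolding abs_of_pos[OF s0] unfolding sn by simp
  have c2: "(cosh y)\<^sup>2 = (sinh y)\<^sup>2 + 1" by (rule cosh_square_eq)
  have "Tm lam L = k * (1 - cosh (2 * y)) / (2 * sinh y * cosh y)"
    unfolding Tm_def p q by (simp add: diff_divide_distrib right_diff_distrib)
  also have "1 - cosh (2 * y) = - (2 * (sinh y)\<^sup>2)" using c2 by (simp add: cosh_double)
  finally show "Tm lam L = - (sqrt (- lam) * tanh y)" using sp by (simp add: k_def tanh_def power2_eq_square)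
  have "Tp lam L = k * (1 + cosh (2 * y)) / (2 * sinh y * cosh y)"
    unfolding Tp_def p q by (simp add: add_divide_distrib distrib_left)
  also have "1 + cosh (2 * y) = 2 * (cosh y)\<^sup>2" using c2 by (simp add: cosh_double)
  finally show "Tp lam L = sqrt (- lam) / tanh y" using sp by (simp add: k_def tanh_def power2_eq_square)
qed

lemma seg_zero: "0 < L \<Longrightarrow> sn 0 L = L" "0 < L \<Longrightarrow> Tm 0 L = 0" "0 < L \<Longrightarrow> Tp 0 L = 2 / L"
  by (auto simp: sn_def Tm_def Tp_def cs_def)

lemma seg_sn_nonzero: "0 < L \<Longrightarrow> lam \<in> seg L n \<Longrightarrow> sn lam L \<noteq> 0"
  using seg_pos(3)[of L lam n] seg_neg(2)[of L lam] seg_zero(1)[of L] by (cases lam "0::real" rule: linorder_cases) auto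

lemma in_seg:
  assumes L: "0 < L" and s: "sn lam L \<noteq> 0"
  obtains n where "lam \<in> seg L n"
proof (cases "lam \<le> 0")
  case True
  then show ?thesis using that seg_nonpos[OF L] by blast
next
  case False
  then have lam: "0 < lam" by simp
  define k where "k = sqrt lam"
  have k: "0 < k" "k\<^sup>2 = lam" using lam by (auto simp: k_def)
  define n where "n = nat \<lfloor>k * L / pi\<rfloor>"
  have p0: "0 \<le> k * L / pi" using k L by simp
  then have rn: "real n = of_int \<lfloor>k * L / pi\<rfloor>" by (simp add: n_def)
  have n: "real n \<le> k * L / pi" "k * L / pi < real n + 1" unfolding rn by linarith+
  have u: "k < real (Suc n) * pi / L" using n(2) L by (simp add: field_simps)
  have l: "real n * pi / L \<le> k" using n(1) L by (simp add: field_simps)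
  have "real n * pi / L \<noteq> k"
  proof
    assume "real n * pi / L = k"
    then have "k * L = real n * pi" using L by auto
    then have "sin (k * L) = 0" by (simp add: sin_npi)
    then show False using s lam by (simp add: sn_def k_def)
  qed
  with l have l': "real n * pi / L < k" by simp
  have "lam < (real (Suc n) * pi / L)\<^sup>2" unfolding k(2)[symmetric] using u k(1) by (intro power_strict_mono) auto
  moreover have "(real n * pi / L)\<^sup>2 < lam" unfolding k(2)[symmetric] using l' L by (intro power_strict_mono) auto
  ultimately show ?thesis using that[of n] by (simp add: seg_def)
qed

section \<open>Elementary inequalities for trigonometric and hyperbolic functions\<close>

lemma less_if_derivative_pos:
  fixes f :: "real \<Rightarrow> real"
  assumes "x < y" "\<And>t. x \<le> t \<Longrightarrow> t \<le> y \<Longrightarrow> (f has_real_derivative f' t) (at t)"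
    "\<And>t. x < t \<Longrightarrow> t < y \<Longrightarrow> 0 < f' t"
  shows "f x < f y"
proof -
  obtain z where "x < z" "z < y" "f y - f x = (y - x) * f' z"
    using MVT2[of x y f f'] assms by blast
  then show ?thesis using assms(1,3) by (smt (verit) mult_pos_pos)
qed

lemma x_cos_less_sin: "0 < y \<Longrightarrow> y < pi \<Longrightarrow> y * cos y < sin (y::real)"
proof -
  assume y: "0 < y" "y < pi"
  have "sin 0 - 0 * cos 0 < sin y - y * cos y"
    by (rule less_if_derivative_pos[OF y(1), where f' = "\<lambda>t. t * sin t"])
       (use y in \<open>auto intro!: derivative_eq_intros mult_pos_pos sin_gt_zero\<close>)
  then show ?thesis by simp
qed

lemma sinh_gt_self: "0 < y \<Longrightarrow> y < sinh (y::real)"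
proof -
  assume y: "0 < y"
  have "0 < cosh t - 1" if "0 < t" for t :: real
    using that cosh_real_strict_mono[of 0 t] by simp
  then have "sinh 0 - 0 < sinh y - y"
    by (intro less_if_derivative_pos[OF y, where f' = "\<lambda>t. cosh t - 1"]) (auto intro!: derivative_eq_intros)
  then show ?thesis by simp
qed

lemma sinh_less_x_cosh: "0 < y \<Longrightarrow> sinh (y::real) < y * cosh y"
proof -
  assume y: "0 < y"
  have "0 * cosh 0 - sinh 0 < y * cosh y - sinh y"
    by (rule less_if_derivative_pos[OF y, where f' = "\<lambda>t. t * sinh t"])
       (use y in \<open>auto intro!: derivative_eq_intros mult_pos_pos\<close>)
  then show ?thesis by simp
qed

text \<open>The cotangent falls while its argument grows; the derivative of the product has the sign
  of \<open>sin t * cos t - t\<close>, which is negative.\<close>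

lemma x_over_tan_decreasing:
  assumes "0 < x" "x < y" "y < pi / 2"
  shows "y / tan y < x / tan (x::real)"
proof -
  have "- (x * cos x / sin x) < - (y * cos y / sin y)"
  proof (rule less_if_derivative_pos[OF assms(2), where f' = "\<lambda>t. (t - sin t * cos t) / (sin t)\<^sup>2"])
    fix t assume t: "x \<le> t" "t \<le> y"
    then have s: "0 < sin t" using assms by (intro sin_gt_zero) auto
    have sq: "cos t * cos t = 1 - sin t * sin t" using sin_cos_squared_add3[of t] by linarith
    have "t * (cos t * cos t) + t * (sin t * sin t) = t" unfolding sq by (simp add: algebra_simps)
    then show "((\<lambda>t. - (t * cos t / sin t)) has_real_derivative (t - sin t * cos t) / (sin t)\<^sup>2) (at t)"
      using s by (auto intro!: derivative_eq_intros simp: field_simps power2_eq_square)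
  next
    fix t assume t: "x < t" "t < y"
    then have s: "0 < sin t" using assms by (intro sin_gt_zero) auto
    have "cos t < cos 0" using t assms by (intro cos_monotone_0_pi) auto
    then have "sin t * cos t < sin t * 1" using s by (intro mult_strict_left_mono) auto
    also have "\<dots> \<le> t" using t assms by (simp add: sin_x_le_x)
    finally show "0 < (t - sin t * cos t) / (sin t)\<^sup>2" using s by simp
  qed
  then show ?thesis by (simp add: tan_def)
qed

lemma x_over_tanh_increasing:
  assumes "0 < x" "x < y"
  shows "x / tanh x < y / tanh (y::real)"
proof -
  have "x * cosh x / sinh x < y * cosh y / sinh y"
  proof (rule less_if_derivative_pos[OF assms(2), where f' = "\<lambda>t. (sinh t * cosh t - t) / (sinh t)\<^sup>2"])
    fix t assume t: "x \<le> t" "t \<le> y"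
    then have s: "0 < sinh t" using assms by auto
    have sq: "cosh t * cosh t = sinh t * sinh t + 1" using cosh_square_eq[of t] by (simp add: power2_eq_square)
    have "t * (cosh t * cosh t) = t * (sinh t * sinh t) + t" unfolding sq by (simp add: algebra_simps)
    then show "((\<lambda>t. t * cosh t / sinh t) has_real_derivative (sinh t * cosh t - t) / (sinh t)\<^sup>2) (at t)"
      using s by (auto intro!: derivative_eq_intros simp: field_simps power2_eq_square)
  next
    fix t assume t: "x < t" "t < y"
    then have t0: "0 < t" using assms by simp
    have "t < sinh t * 1" using sinh_gt_self[OF t0] by simp
    also have "\<dots> \<le> sinh t * cosh t" using t0 by (intro mult_left_mono cosh_real_ge_1) auto
    finally show "0 < (sinh t * cosh t - t) / (sinh t)\<^sup>2" using t0 by simp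
  qed
  then show ?thesis by (simp add: tanh_def)
qed

section \<open>Signs, monotonicity and blow-up of the half-angle functions\<close>

lemma Tm_signs:
  assumes L: "0 < L"
  shows "lam \<le> 0 \<Longrightarrow> Tm lam L \<le> 0" "lam < 0 \<Longrightarrow> Tm lam L < 0"
    "0 < lam \<Longrightarrow> lam \<in> seg L n \<Longrightarrow> 0 < Tm lam L"
proof -
  show neg: "Tm lam L < 0" if "lam < 0"
    using seg_neg(1,3)[OF L that] that by (simp add: mult_pos_pos)
  show "Tm lam L \<le> 0" if "lam \<le> 0"
    using that neg seg_zero(2)[OF L] by (cases "lam = 0") auto
  show "0 < Tm lam L" if "0 < lam" "lam \<in> seg L n"
    using seg_pos(1,2,5)[OF L that] that by (auto intro!: mult_pos_pos tan_gt_zero)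
qed

text \<open>The value \<open>2 / L\<close> at \<open>lam = 0\<close> separates the two signs of
  \<open>lam\<close> and later glues the monotonicity proofs. The last bound supplies the blow-up at
  \<open>-\<infinity>\<close>.\<close>

lemma Tp_signs:
  assumes L: "0 < L"
  shows "lam < 0 \<Longrightarrow> 2 / L < Tp lam L" "0 < lam \<Longrightarrow> lam \<in> seg L 0 \<Longrightarrow> Tp lam L < 2 / L"
    "lam \<in> seg L n \<Longrightarrow> 0 < Tp lam L" "lam < 0 \<Longrightarrow> sqrt (- lam) \<le> Tp lam L"
proof -
  show n: "2 / L < Tp lam L" if l: "lam < 0"
  proof -
    let ?y = "sqrt (- lam) * L / 2"
    note s = seg_neg[OF L l]
    have t: "0 < tanh ?y" using s(1) by simp
    have "tanh ?y < ?y" using sinh_less_x_cosh[OF s(1)] by (simp add: tanh_def pos_divide_less_eq cosh_real_pos)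
    then have "2 / L * tanh ?y < sqrt (- lam)" using L by (simp add: field_simps)
    then show ?thesis using t unfolding s(4) by (simp add: pos_less_divide_eq)
  qed
  show "Tp lam L < 2 / L" if l: "0 < lam" "lam \<in> seg L 0"
  proof -
    let ?y = "(sqrt lam * L - real 0 * pi) / 2"
    note s = seg_pos[OF L l]
    have t: "0 < tan ?y" using s(1,2) by (rule tan_gt_zero)
    have c: "0 < cos ?y" using s(1,2) by (intro cos_gt_zero) auto
    have "?y < tan ?y" using x_cos_less_sin[of ?y] s(1,2) c by (simp add: tan_def pos_less_divide_eq)
    then have "sqrt lam < 2 / L * tan ?y" using L by (simp add: field_simps)
    then show ?thesis using t unfolding s(6) by (simp add: pos_divide_less_eq)
  qed
  show "0 < Tp lam L" if l: "lam \<in> seg L n"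
  proof (cases lam "0::real" rule: linorder_cases)
    case less
    then show ?thesis using n L by (meson divide_pos_pos order.strict_trans zero_less_numeral)
  next
    case equal
    then show ?thesis using seg_zero(3)[OF L] L by simp
  next
    case greater
    then show ?thesis using seg_pos(1,2,6)[OF L greater l] by (auto intro!: divide_pos_pos tan_gt_zero)
  qed
  show "sqrt (- lam) \<le> Tp lam L" if l: "lam < 0"
  proof -
    note s = seg_neg[OF L l]
    have t: "0 < tanh (sqrt (- lam) * L / 2)" "tanh (sqrt (- lam) * L / 2) < 1"
      using s(1) by (auto simp: tanh_real_lt_1)
    have "sqrt (- lam) * tanh (sqrt (- lam) * L / 2) \<le> sqrt (- lam) * 1" using t l by (intro mult_left_mono) auto
    then show ?thesis unfolding s(4) using t by (simp add: pos_le_divide_eq)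
  qed
qed

text \<open>For positive \<open>lam\<close> both factors of \<open>k * tan y\<close> increase; for
  negative \<open>lam\<close> both factors of \<open>k * tanh y\<close> decrease; the sign change at
  \<open>0\<close> joins the two ranges.\<close>

lemma Tm_strict_mono:
  assumes L: "0 < L" and x: "x \<in> seg L n" and y: "y \<in> seg L n" and xy: "x < y"
  shows "Tm x L < Tm y L"
proof -
  consider "0 < x" | "x \<le> 0" "0 < y" | "y = 0" | "y < 0" using xy by linarith
  then show ?thesis
  proof cases
    case 1
    then have y0: "0 < y" using xy by simp
    note sx = seg_pos[OF L 1 x] and sy = seg_pos[OF L y0 y]
    have "sqrt x < sqrt y" using xy by simp
    then have "(sqrt x * L - real n * pi) / 2 < (sqrt y * L - real n * pi) / 2" using L by simp
    then have "tan ((sqrt x * L - real n * pi) / 2) < tan ((sqrt y * L - real n * pi) / 2)"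
      using sx(1) sy(2) pi_gt_zero by (intro tan_monotone) linarith+
    then show ?thesis unfolding sx(5) sy(5)
      using \<open>sqrt x < sqrt y\<close> tan_gt_zero[OF sx(1,2)] 1 by (intro mult_strict_mono) auto
  next
    case 2
    then show ?thesis using Tm_signs(1)[OF L, of x] Tm_signs(3)[OF L 2(2) y] by linarith
  next
    case 3
    then show ?thesis using Tm_signs(2)[OF L, of x] xy seg_zero(2)[OF L] by simp
  next
    case 4
    then have x0: "x < 0" using xy by simp
    note sx = seg_neg[OF L x0] and sy = seg_neg[OF L 4]
    have k: "sqrt (- y) < sqrt (- x)" using xy by simp
    then have "tanh (sqrt (- y) * L / 2) < tanh (sqrt (- x) * L / 2)" using L by simp
    then have "sqrt (- y) * tanh (sqrt (- y) * L / 2) < sqrt (- x) * tanh (sqrt (- x) * L / 2)"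
      using k sy(1) 4 by (intro mult_strict_mono) auto
    then show ?thesis unfolding sx(3) sy(3) by simp
  qed
qed

text \<open>Here \<open>k\<close> and \<open>cot y\<close> compete. Writing
  \<open>L * k = 2 * y + n * pi\<close> splits the product into \<open>2 * (y / tan y)\<close>,
  which decreases strictly, and \<open>n * pi / tan y\<close>, which does not increase.\<close>

lemma Tp_strict_antimono:
  assumes L: "0 < L" and x: "x \<in> seg L n" and y: "y \<in> seg L n" and xy: "x < y"
  shows "Tp y L < Tp x L"
proof -
  consider "0 < x" | "x \<le> 0" "0 < y" | "y = 0" | "y < 0" using xy by linarith
  then show ?thesis
  proof cases
    case 1
    then have y0: "0 < y" using xy by simp
    note sx = seg_pos[OF L 1 x] and sy = seg_pos[OF L y0 y]
    let ?u = "(sqrt x * L - real n * pi) / 2" and ?v = "(sqrt y * L - real n * pi) / 2"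
    have uv: "?u < ?v" using L xy by simp
    then have t: "tan ?u < tan ?v"
      using sx(1) sy(2) pi_gt_zero by (intro tan_monotone) linarith+
    have tp: "0 < tan ?u" using sx(1,2) by (rule tan_gt_zero)
    have 1: "?v / tan ?v < ?u / tan ?u" by (rule x_over_tan_decreasing[OF sx(1) uv sy(2)])
    have 2: "real n * pi / tan ?v \<le> real n * pi / tan ?u" using t tp by (intro divide_left_mono) auto
    have e: "L * (sqrt z / tan w) = 2 * (w / tan w) + real n * pi / tan w" if "w = (sqrt z * L - real n * pi) / 2" for z w
    proof -
      have "L * sqrt z = 2 * w + real n * pi" using that by (simp add: field_simps)
      then have "L * sqrt z / tan w = (2 * w + real n * pi) / tan w" by simp
      then show ?thesis by (simp add: add_divide_distrib)
    qed
    have "L * (sqrt y / tan ?v) < L * (sqrt x / tan ?u)"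
      unfolding e[OF refl] using 1 2 by linarith
    then show ?thesis unfolding sx(6) sy(6) using mult_less_cancel_left_pos[OF L] by blast
  next
    case 2
    then have "n = 0" using seg_nonpos_iff[OF L _ x] by simp
    then have "Tp y L < 2 / L" using Tp_signs(2)[OF L 2(2)] y by simp
    moreover have "2 / L \<le> Tp x L" using Tp_signs(1)[OF L, of x] seg_zero(3)[OF L] 2(1) by (cases "x = 0") auto
    ultimately show ?thesis by simp
  next
    case 3
    then show ?thesis using Tp_signs(1)[OF L, of x] xy seg_zero(3)[OF L] by simp
  next
    case 4
    then have x0: "x < 0" using xy by simp
    note sx = seg_neg[OF L x0] and sy = seg_neg[OF L 4]
    let ?u = "sqrt (- x) * L / 2" and ?v = "sqrt (- y) * L / 2"
    have "?v < ?u" using L xy by simp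
    then have 1: "?v / tanh ?v < ?u / tanh ?u" by (rule x_over_tanh_increasing[OF sy(1)])
    have e: "L * (sqrt z / tanh w) = 2 * (w / tanh w)" if "w = sqrt z * L / 2" for z w
      using that by (simp add: mult.commute)
    have "L * (sqrt (- y) / tanh ?v) < L * (sqrt (- x) / tanh ?u)"
      unfolding e[OF refl] using 1 by linarith
    then show ?thesis unfolding sx(4) sy(4) using mult_less_cancel_left_pos[OF L] by blast
  qed
qed

text \<open>Every half angle occurs on every interval, which turns the choice of a point into the
  choice of a tangent.\<close>

lemma seg_of_angle:
  fixes n :: nat
  assumes L: "0 < L" and y: "0 < y" "y < pi / 2"
  defines "k \<equiv> (2 * y + real n * pi) / L"
  shows "0 < k" "k\<^sup>2 \<in> seg L n" "0 < k\<^sup>2" "Tm (k\<^sup>2) L = k * tan y" "Tp (k\<^sup>2) L = k / tan y"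
proof -
  show k: "0 < k" unfolding k_def using L y by (intro divide_pos_pos add_pos_nonneg) auto
  then show k2: "0 < k\<^sup>2" by simp
  have "k < real (Suc n) * pi / L" unfolding k_def using L y by (intro divide_strict_right_mono) (auto simp: algebra_simps)
  moreover have "real n * pi / L < k" unfolding k_def using L y by (intro divide_strict_right_mono) auto
  ultimately show s: "k\<^sup>2 \<in> seg L n" using k L by (auto simp: seg_def intro!: power_strict_mono)
  have sk: "sqrt (k\<^sup>2) = k" using k by simp
  moreover have "(sqrt (k\<^sup>2) * L - real n * pi) / 2 = y" unfolding sk using L by (simp add: k_def)
  ultimately show "Tm (k\<^sup>2) L = k * tan y" "Tp (k\<^sup>2) L = k / tan y"
    using seg_pos(5,6)[OF L k2 s] by simp_all
qed

lemma Tm_unbounded: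
  assumes L: "0 < L" and x: "x \<in> seg L n"
  obtains z where "z \<in> seg L n" "x < z" "0 < z" "K < Tm z L"
proof -
  \<comment> \<open>The angle parametrisation covers positive \<open>lam\<close> only; on the first
    interval a positive starting point is taken at the arbitrary angle
    \<open>pi / 4\<close>.\<close>
  have "\<exists>x1\<in>seg L n. x \<le> x1 \<and> 0 < x1"
  proof (cases "0 < x")
    case False
    then have "n = 0" using seg_nonpos_iff[OF L _ x] by simp
    then show ?thesis using seg_of_angle(2,3)[OF L, of "pi / 4" n] False by (intro bexI) (auto intro: order_trans[of x 0])
  qed (use x in auto)
  then obtain x1 where x1: "x1 \<in> seg L n" "x \<le> x1" "0 < x1" by blast
  note s = seg_pos[OF L x1(3,1)]
  let ?y = "(sqrt x1 * L - real n * pi) / 2"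
  \<comment> \<open>The first bound pushes the new angle beyond that of \<open>x1\<close>; the
    second gives \<open>k * T > \<bar>K\<bar>\<close> because \<open>k > sqrt x1\<close>.\<close>
  define T where "T = max (tan ?y) (\<bar>K\<bar> / sqrt x1) + 1"
  have tp: "0 < tan ?y" using s(1,2) by (rule tan_gt_zero)
  obtain w where w: "0 \<le> w" "w < pi / 2" "tan w = T"
    using tan_total_pos[of T] tp by (auto simp: T_def)
  have T: "tan ?y < T" "\<bar>K\<bar> / sqrt x1 < T" by (auto simp: T_def)
  have yw: "?y < w"
  proof (rule ccontr)
    assume "\<not> ?y < w"
    then have "tan w \<le> tan ?y" using w(1) s(2) pi_gt_zero by (intro tan_mono_le) linarith+
    then show False using w(3) T(1) by simp
  qed
  then have w0: "0 < w" using s(1) by simp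
  define k where "k = (2 * w + real n * pi) / L"
  note sk = seg_of_angle[OF L w0 w(2), of n, folded k_def]
  have "sqrt x1 < k" using yw L by (simp add: k_def field_simps)
  then have "(sqrt x1)\<^sup>2 < k\<^sup>2" using x1(3) by (intro power_strict_mono) auto
  then have xk: "x1 < k\<^sup>2" using x1(3) by simp
  have "\<bar>K\<bar> = sqrt x1 * (\<bar>K\<bar> / sqrt x1)" using x1(3) by simp
  also have "\<dots> < k * T" using \<open>sqrt x1 < k\<close> T(2) x1(3) sk(1) by (intro mult_strict_mono) auto
  finally have "K < Tm (k\<^sup>2) L" unfolding sk(4) w(3) by simp
  then show ?thesis using that[of "k\<^sup>2"] sk(2,3) xk x1(2) by simp
qed

text \<open>On the first interval the blow-up is at \<open>-\<infinity>\<close>, where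
  \<open>Tp lam L \<ge> sqrt (- lam)\<close>. On the others it is at the left end, where
  \<open>k\<close> stays above \<open>n * pi / L\<close> and the tangent tends to zero.\<close>

lemma Tp_unbounded:
  assumes L: "0 < L" and x: "x \<in> seg L n"
  obtains z where "z \<in> seg L n" "z < x" "n = 0 \<Longrightarrow> z < 0" "n \<noteq> 0 \<Longrightarrow> 0 < z" "K < Tp z L"
proof (cases "n = 0")
  case True
  \<comment> \<open>At least \<open>1\<close>, so that \<open>k\<^sup>2 \<ge> k\<close> puts
    \<open>- k\<^sup>2\<close> below \<open>x\<close>.\<close>
  define k where "k = \<bar>K\<bar> + \<bar>x\<bar> + 1"
  have k: "1 \<le> k" "\<bar>x\<bar> < k" "K < k" by (auto simp: k_def)
  then have "k * 1 \<le> k * k" by (intro mult_left_mono) auto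
  then have k2: "k \<le> k\<^sup>2" by (simp add: power2_eq_square)
  then have z: "- k\<^sup>2 < x" "- k\<^sup>2 < 0" using k by linarith+
  have "k \<le> Tp (- k\<^sup>2) L" using Tp_signs(4)[OF L z(2)] k by simp
  then show ?thesis using that[of "- k\<^sup>2"] z k seg_nonpos[OF L, of "- k\<^sup>2"] True by simp
next
  case False
  have x0: "0 < x" using seg_nonpos_iff[OF L _ x] False by fastforce
  note s = seg_pos[OF L x0 x]
  let ?y = "(sqrt x * L - real n * pi) / 2"
  define h where "h = real n * pi / L"
  have h: "0 < h" using False L by (simp add: h_def)
  define T where "T = min (tan ?y) (h / (\<bar>K\<bar> + 1)) / 2"
  have tp: "0 < tan ?y" using s(1,2) by (rule tan_gt_zero)
  have T: "0 < T" "T < tan ?y" "T < h / (\<bar>K\<bar> + 1)"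
    using tp h by (auto simp: T_def min_def divide_simps)
  obtain w where w: "0 \<le> w" "w < pi / 2" "tan w = T"
    using tan_total_pos[of T] T by auto
  have w0: "0 < w" using w T(1) by (cases "w = 0") auto
  have yw: "w < ?y"
  proof (rule ccontr)
    assume "\<not> w < ?y"
    then have "tan ?y \<le> tan w" using w(2) s(1) pi_gt_zero by (intro tan_mono_le) linarith+
    then show False using w(3) T(2) by simp
  qed
  define k where "k = (2 * w + real n * pi) / L"
  note sk = seg_of_angle[OF L w0 w(2), of n, folded k_def]
  have "k < sqrt x" using yw L by (simp add: k_def field_simps)
  then have "k\<^sup>2 < (sqrt x)\<^sup>2" using sk(1) by (intro power_strict_mono) auto
  then have xk: "k\<^sup>2 < x" using x0 by simp
  have "h < k" unfolding h_def k_def using w0 L by (intro divide_strict_right_mono) auto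
  have "(\<bar>K\<bar> + 1) * T < h" using T(3) by (simp add: pos_less_divide_eq mult.commute)
  then have "\<bar>K\<bar> + 1 < k / T" using \<open>h < k\<close> T(1) by (simp add: pos_less_divide_eq)
  then have "K < Tp (k\<^sup>2) L" unfolding sk(5) w(3) by simp
  then show ?thesis using that[of "k\<^sup>2"] sk(2,3) xk False by simp
qed

section \<open>Continuity in the spectral parameter and bounds near Dirichlet eigenvalues\<close>

lemma continuous_on_quotient_at_zero:
  fixes f :: "real \<Rightarrow> real"
  assumes f: "(f has_real_derivative 1) (at 0)" "f 0 = 0" "continuous_on UNIV f"
  shows "continuous_on UNIV (\<lambda>t. if t = 0 then 1 else f t / t)"
proof -
  let ?g = "\<lambda>t. if t = 0 then 1 else f t / t"
  have "isCont ?g t" for t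
  proof (cases "t = 0")
    case True
    have "((\<lambda>h. (f (0 + h) - f 0) / h) \<longlongrightarrow> 1) (at 0)" using f(1) unfolding DERIV_def .
    then have "(?g \<longlongrightarrow> 1) (at 0)"
      by (rule Lim_transform_eventually) (auto simp: f(2) eventually_at_filter)
    then show ?thesis using True by (simp add: isCont_def)
  next
    case False
    have "isCont (\<lambda>t. f t / t) t"
      using f(3) False by (intro continuous_intros) (auto simp: continuous_on_eq_continuous_at)
    moreover have "eventually (\<lambda>s. f s / s = ?g s) (nhds t)"
      using t1_space_nhds[OF False] by eventually_elim auto
    ultimately show ?thesis using isCont_cong[of "\<lambda>t. f t / t" ?g t] by blast
  qed
  then show ?thesis by (simp add: continuous_at_imp_continuous_on)
qed

lemma sn_continuous [continuous_intros]:
  assumes L: "0 < L"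
  shows "continuous_on A (\<lambda>lam. sn lam L)"
proof -
  let ?f = "\<lambda>t::real. if t = 0 then 1 else sin t / t" and ?g = "\<lambda>t::real. if t = 0 then 1 else sinh t / t"
  have f: "continuous_on UNIV ?f"
    by (rule continuous_on_quotient_at_zero) (auto intro!: derivative_eq_intros continuous_intros)
  have g: "continuous_on UNIV ?g"
    by (rule continuous_on_quotient_at_zero) (auto intro!: derivative_eq_intros continuous_intros)
  \<comment> \<open>At least one of the two arguments is \<open>0\<close>, where the quotient is set
    to \<open>1\<close>; subtracting \<open>1\<close> leaves the active branch.\<close>
  have "sn lam L = L * (?f (sqrt (max lam 0) * L) + ?g (sqrt (max (- lam) 0) * L) - 1)" for lam
    using L by (cases lam "0::real" rule: linorder_cases) (auto simp: sn_def max_def)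
  moreover have "continuous_on A (\<lambda>lam. L * (?f (sqrt (max lam 0) * L) + ?g (sqrt (max (- lam) 0) * L) - 1))"
    by (intro continuous_intros continuous_on_compose2[OF f] continuous_on_compose2[OF g]) auto
  ultimately show ?thesis by simp
qed

lemma cs_continuous [continuous_intros]: "continuous_on A (\<lambda>lam. cs lam L)"
proof -
  have "cs lam L = cos (sqrt (max lam 0) * L) + cosh (sqrt (max (- lam) 0) * L) - 1" for lam
    by (auto simp: cs_def max_def)
  moreover have "continuous_on A (\<lambda>lam. cos (sqrt (max lam 0) * L) + cosh (sqrt (max (- lam) 0) * L) - 1)"
    by (intro continuous_intros)
  ultimately show ?thesis by simp
qed

text \<open>Multiplying by \<open>\<bar>sn lam L\<bar>\<close> turns \<open>Tm\<close> and
  \<open>Tp\<close> into \<open>1\<close> plus or minus a cosine, so a large value of either forces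
  \<open>sn lam L\<close> to be small.\<close>

lemma sn_bounds:
  assumes L: "0 < L" and lam: "0 < lam" "lam \<in> seg L n"
  shows "\<bar>sn lam L\<bar> \<le> L" "\<bar>sn lam L\<bar> * Tm lam L \<le> 2" "\<bar>sn lam L\<bar> * Tp lam L \<le> 2"
proof -
  have "\<bar>sin (sqrt lam * L)\<bar> \<le> \<bar>sqrt lam * L\<bar>" by (rule abs_sin_x_le_abs_x)
  then show "\<bar>sn lam L\<bar> \<le> L" using lam L by (simp add: sn_def abs_mult pos_divide_le_eq mult.commute)
  have s0: "sn lam L \<noteq> 0" by (rule seg_sn_nonzero[OF L lam(2)])
  have c: "\<bar>cs lam L\<bar> \<le> 1" using lam by (simp add: cs_def)
  have q: "\<bar>\<bar>sn lam L\<bar> * (cs lam L / sn lam L)\<bar> \<le> 1" using s0 c by (simp add: abs_mult abs_divide)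
  have "\<bar>sn lam L\<bar> * (1 / \<bar>sn lam L\<bar>) = 1" using s0 by simp
  then show "\<bar>sn lam L\<bar> * Tm lam L \<le> 2" "\<bar>sn lam L\<bar> * Tp lam L \<le> 2"
    unfolding Tm_def Tp_def right_diff_distrib distrib_left using q by linarith+
qed

text \<open>\<open>Tm\<close> is \<open>2 / \<bar>sn lam L\<bar>\<close> minus \<open>Tp\<close>,
  with \<open>sn lam L \<ge> L\<close> and \<open>Tp lam L \<ge> sqrt (- lam)\<close>. Hence
  \<open>Tm\<close> tends to \<open>-\<infinity>\<close> on the left.\<close>

lemma Tm_upper_bound_neg:
  assumes L: "0 < L" and lam: "lam < 0"
  shows "Tm lam L \<le> 2 / L - sqrt (- lam)"
proof -
  note s = seg_neg[OF L lam]
  have k: "0 < sqrt (- lam)" using lam by simp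
  have "sqrt (- lam) * L < sinh (sqrt (- lam) * L)" using k L by (intro sinh_gt_self mult_pos_pos) auto
  then have "L \<le> sn lam L" using lam k by (simp add: sn_def pos_le_divide_eq mult.commute)
  then have "1 / \<bar>sn lam L\<bar> \<le> 1 / L" using L by (intro divide_left_mono) auto
  moreover have "Tm lam L = 2 * (1 / \<bar>sn lam L\<bar>) - Tp lam L" by (simp add: Tm_def Tp_def)
  ultimately show ?thesis using Tp_signs(4)[OF L lam] by simp
qed

subsection \<open>Gaps and defect bands\<close>

text \<open>The resolvent conditions solved for \<open>\<gamma>\<close>:
  \<open>Gm < \<gamma>\<close> says that the diagonal exceeds the Schur bound,
  \<open>Gp < - \<gamma>\<close> that it lies below its negative.\<close>

definition Gm :: "real \<Rightarrow> real \<Rightarrow> real \<Rightarrow> real" where "Gm a b lam = 2 * (Tm lam a + Tm lam b)"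
definition Gp :: "real \<Rightarrow> real \<Rightarrow> real \<Rightarrow> real" where "Gp a b lam = 2 * (Tp lam a + Tp lam b)"

lemma gap_functions:
  fixes a b lam :: real
  defines "H \<equiv> 2 * cs lam a / sn lam a + 2 * cs lam b / sn lam b"
    and "M \<equiv> 2 / \<bar>sn lam a\<bar> + 2 / \<bar>sn lam b\<bar>"
  shows "Gm a b lam = M - H" "Gp a b lam = M + H" "0 \<le> M"
  by (simp_all add: Gm_def Gp_def Tm_def Tp_def H_def M_def)

text \<open>The chain moves the diagonal further from zero on the side where it already lies, so
  \<open>\<bar>\<gamma> + H0\<bar>\<close> is a lower bound at every vertex.\<close>

lemma not_in_spectrum_chain:
  assumes ab: "0 < a" "0 < b" and s: "sn lam a \<noteq> 0" "sn lam b \<noteq> 0"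
    and g: "Gm a b lam < \<gamma> \<and> \<gamma> \<le> \<gamma>t \<or> Gp a b lam < - \<gamma> \<and> \<gamma>t \<le> \<gamma>"
  shows "lam \<notin> spectrum_lattice a b (\<lambda>m n. if m = 0 then \<gamma>t else \<gamma>)"
proof -
  interpret lattice a b lam using ab by unfold_locales
  note G = gap_functions[where a = a and b = b and lam = lam]
  let ?M = "2 / \<bar>sn lam a\<bar> + 2 / \<bar>sn lam b\<bar>"
  consider "?M < \<gamma> + H0" "\<gamma> \<le> \<gamma>t" | "\<gamma> + H0 < - ?M" "\<gamma>t \<le> \<gamma>" using g unfolding G(1,2) by force
  note cases = this
  show ?thesis
  proof (rule not_in_spectrum[OF s, where r = "\<bar>\<gamma> + H0\<bar>"])
    show "?M < \<bar>\<gamma> + H0\<bar>" using cases G(3) by cases linarith+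
    fix m :: int
    define c where "c = (if m = 0 then \<gamma>t else \<gamma>)"
    have c: "c = \<gamma> \<or> c = \<gamma>t" by (simp add: c_def)
    have "\<bar>\<gamma> + H0\<bar> \<le> \<bar>c + H0\<bar>" using cases
    proof cases
      case 1
      then have "\<gamma> \<le> c" using c by auto
      then show ?thesis using 1 G(3) by linarith
    next
      case 2
      then have "c \<le> \<gamma>" using c by auto
      then show ?thesis using 2 G(3) by linarith
    qed
    then show "\<bar>\<gamma> + H0\<bar> \<le> \<bar>(if m = 0 then \<gamma>t else \<gamma>) + 2 * cs lam a / sn lam a + 2 * cs lam b / sn lam b\<bar>"
      unfolding c_def[symmetric] by (simp only: add.assoc)
  qed
qed

text \<open>The plane waves sit at \<open>m \<ge> 1\<close>, off the chain, so the unperturbed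
  spectrum survives any change of \<open>\<gamma>t\<close>.\<close>

lemma in_spectrum_chain:
  assumes ab: "0 < a" "0 < b"
    and g: "sn lam a = 0 \<or> sn lam b = 0 \<or> \<gamma> \<le> Gm a b lam \<and> - \<gamma> \<le> Gp a b lam"
  shows "lam \<in> spectrum_lattice a b (\<lambda>m n. if m = 0 then \<gamma>t else \<gamma>)"
proof -
  interpret lattice a b lam using ab by unfold_locales
  note G = gap_functions[where a = a and b = b and lam = lam]
  show ?thesis
  proof (cases "sn lam a = 0 \<or> sn lam b = 0")
    case True
    then show ?thesis by (rule special_in_spectrum)
  next
    case False
    then have s: "sn lam a \<noteq> 0" "sn lam b \<noteq> 0" by auto
    have "\<bar>\<gamma> + H0\<bar> \<le> 2 / \<bar>sn lam a\<bar> + 2 / \<bar>sn lam b\<bar>" using g s G by linarith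
    then show ?thesis by (intro band_in_spectrum[OF s, of "\<lambda>m. if m = 0 then \<gamma>t else \<gamma>"]) auto
  qed
qed

lemma sigma_H_eq_pert: "sigma_H a b \<gamma> = spectrum_lattice a b (\<lambda>m n. if m = 0 then \<gamma> else \<gamma>)"
  by (simp add: sigma_H_def)

lemma sigma_H_iff:
  assumes ab: "0 < a" "0 < b"
  shows "lam \<in> sigma_H a b \<gamma> \<longleftrightarrow> sn lam a = 0 \<or> sn lam b = 0 \<or> \<gamma> \<le> Gm a b lam \<and> - \<gamma> \<le> Gp a b lam"
  unfolding sigma_H_eq_pert
  using in_spectrum_chain[OF ab, of lam \<gamma> \<gamma>] not_in_spectrum_chain[OF ab, of lam \<gamma> \<gamma>] by force

lemma sigma_H_subset_pert:
  assumes ab: "0 < a" "0 < b"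
  shows "sigma_H a b \<gamma> \<subseteq> sigma_H_pert a b \<gamma> \<gamma>t"
  unfolding sigma_H_pert_def using sigma_H_iff[OF ab, of _ \<gamma>] in_spectrum_chain[OF ab, of _ \<gamma> \<gamma>t] by blast

lemma new_spectrum:
  assumes ab: "0 < a" "0 < b" and s: "sn lam a \<noteq> 0" "sn lam b \<noteq> 0" and d: "\<gamma> \<noteq> \<gamma>t"
    and le: "\<bar>\<gamma> + (2 * cs lam a / sn lam a + 2 * cs lam b / sn lam b) - sgn (\<gamma> - \<gamma>t) * sqrt ((\<gamma> - \<gamma>t)\<^sup>2 + 4 / (sn lam a)\<^sup>2)\<bar> \<le> 2 / \<bar>sn lam b\<bar>"
  shows "lam \<in> sigma_H_pert a b \<gamma> \<gamma>t"
proof -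
  interpret lattice a b lam using ab by unfold_locales
  show ?thesis unfolding sigma_H_pert_def by (rule defect_in_spectrum[OF s d le])
qed

section \<open>Locating band edges and defect bands by intermediate values\<close>

text \<open>Either \<open>y\<close> itself works, or \<open>g\<close> changes sign between
  \<open>x\<close> and \<open>y\<close>; at a zero of \<open>g\<close> the inequality
  \<open>g \<le> h\<close> gives the rest.\<close>

lemma ivt_pair:
  fixes g h :: "real \<Rightarrow> real"
  assumes I: "is_interval I" and c: "continuous_on I g" and le: "\<And>z. z \<in> I \<Longrightarrow> g z \<le> h z"
    and x: "x \<in> I" "g x \<le> 0" and y: "y \<in> I" "0 \<le> h y"
  obtains z where "z \<in> I" "g z \<le> 0" "0 \<le> h z"
proof (cases "g y \<le> 0")
  case True
  then show ?thesis using that y by blast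
next
  case False
  have "is_interval (g ` I)" using I c by (simp add: is_interval_connected_1 connected_continuous_image)
  then have "0 \<in> g ` I" using x y False unfolding is_interval_1 by (metis imageI less_eq_real_def linorder_not_less)
  then obtain z where "z \<in> I" "g z = 0" by auto
  then show ?thesis using that le[of z] by auto
qed

text \<open>On squaring the right side, the cross term is
  \<open>16 / (\<bar>s\<bar> * \<bar>t\<bar>)\<close>, which absorbs
  \<open>\<delta>\<^sup>2\<close>; hence the constant \<open>16\<close>. A small product thus beats
  any fixed perturbation.\<close>

lemma sqrt_defect_le:
  fixes s t \<delta> :: real
  assumes "s \<noteq> 0" "t \<noteq> 0" "\<bar>s\<bar> * \<bar>t\<bar> * \<delta>\<^sup>2 \<le> 16"
  shows "sqrt (\<delta>\<^sup>2 + 4 / s\<^sup>2) \<le> 2 / \<bar>s\<bar> + 4 / \<bar>t\<bar>"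
proof (rule real_le_lsqrt)
  have p: "0 < \<bar>s\<bar> * \<bar>t\<bar>" using assms by simp
  have "\<delta>\<^sup>2 * (\<bar>s\<bar> * \<bar>t\<bar>) \<le> 16" using assms(3) by (simp add: mult_ac)
  then have "\<delta>\<^sup>2 \<le> 16 / (\<bar>s\<bar> * \<bar>t\<bar>)" using p by (simp add: pos_le_divide_eq)
  moreover have "(2 / \<bar>s\<bar> + 4 / \<bar>t\<bar>)\<^sup>2 = 4 / s\<^sup>2 + 16 / (\<bar>s\<bar> * \<bar>t\<bar>) + 16 / t\<^sup>2"
    by (simp add: power2_sum power_divide)
  moreover have "0 \<le> 16 / t\<^sup>2" by simp
  ultimately show "\<delta>\<^sup>2 + 4 / s\<^sup>2 \<le> (2 / \<bar>s\<bar> + 4 / \<bar>t\<bar>)\<^sup>2" by linarith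
  show "0 \<le> 2 / \<bar>s\<bar> + 4 / \<bar>t\<bar>" by simp
qed

lemma sqrt_defect_gt:
  fixes s \<delta> :: real
  assumes "s \<noteq> 0" "\<delta> \<noteq> 0"
  shows "2 / \<bar>s\<bar> < sqrt (\<delta>\<^sup>2 + 4 / s\<^sup>2)"
  using assms by (intro real_less_rsqrt) (simp add: power_divide)

lemma sqrt_defect_le_add:
  fixes s \<delta> :: real
  shows "sqrt (\<delta>\<^sup>2 + 4 / s\<^sup>2) \<le> \<bar>\<delta>\<bar> + 2 / \<bar>s\<bar>"
  using sqrt_add_le_add_sqrt[of "\<delta>\<^sup>2" "4 / s\<^sup>2"] by (simp add: real_sqrt_divide)

text \<open>One of the two factors is at most \<open>2 / K\<close> because a half-angle function is
  large, the other at most \<open>a + b\<close>; \<open>K\<close> is calibrated so that the product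
  is at most \<open>16 / (\<delta>\<^sup>2 + 1)\<close>.\<close>

lemma product_small:
  assumes ab: "0 < a" "0 < b" and y: "0 < y" "y \<in> seg a n" "y \<in> seg b m"
    and K: "K = (a + b) * (\<delta>\<^sup>2 + 1) / 8"
    and T: "K < Tm y a \<or> K < Tp y a \<or> K < Tm y b \<or> K < Tp y b"
  shows "\<bar>sn y a\<bar> * \<bar>sn y b\<bar> * \<delta>\<^sup>2 \<le> 16"
proof -
  note A = sn_bounds[OF ab(1) y(1,2)] and B = sn_bounds[OF ab(2) y(1,3)]
  have K0: "0 \<le> K" using ab by (simp add: K)
  have "\<bar>sn y a\<bar> * K \<le> 2 \<or> \<bar>sn y b\<bar> * K \<le> 2"
    using T A(2,3) B(2,3) by (smt (verit) abs_ge_zero mult_left_mono)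
  then have "\<bar>sn y a\<bar> * \<bar>sn y b\<bar> * K \<le> 2 * (a + b)"
  proof
    assume "\<bar>sn y a\<bar> * K \<le> 2"
    then have "(\<bar>sn y a\<bar> * K) * \<bar>sn y b\<bar> \<le> 2 * (a + b)" using B(1) ab by (intro mult_mono) auto
    then show ?thesis by (simp add: mult_ac)
  next
    assume "\<bar>sn y b\<bar> * K \<le> 2"
    then have "(\<bar>sn y b\<bar> * K) * \<bar>sn y a\<bar> \<le> 2 * (a + b)" using A(1) ab by (intro mult_mono) auto
    then show ?thesis by (simp add: mult_ac)
  qed
  then have "(a + b) * (\<bar>sn y a\<bar> * \<bar>sn y b\<bar> * (\<delta>\<^sup>2 + 1)) \<le> (a + b) * 16" by (simp add: K algebra_simps)
  then have "\<bar>sn y a\<bar> * \<bar>sn y b\<bar> * (\<delta>\<^sup>2 + 1) \<le> 16"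
    using mult_le_cancel_left_pos[of "a + b"] ab by (simp only: add_pos_pos)
  moreover have "\<bar>sn y a\<bar> * \<bar>sn y b\<bar> * \<delta>\<^sup>2 \<le> \<bar>sn y a\<bar> * \<bar>sn y b\<bar> * (\<delta>\<^sup>2 + 1)" by (intro mult_left_mono) auto
  ultimately show ?thesis by linarith
qed

lemma Gm_continuous:
  assumes ab: "0 < a" "0 < b"
  shows "continuous_on (seg a n \<inter> seg b m) (Gm a b)" "continuous_on (seg a n \<inter> seg b m) (Gp a b)"
  unfolding Gm_def Gp_def Tm_def Tp_def
  by (intro continuous_intros sn_continuous[OF ab(1)] sn_continuous[OF ab(2)] ballI; use seg_sn_nonzero ab in auto)+

lemma defect_functions_continuous:
  assumes ab: "0 < a" "0 < b"
  shows "continuous_on (seg a n \<inter> seg b m) (\<lambda>lam. 2 * cs lam a / sn lam a + 2 * cs lam b / sn lam b)"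
    "continuous_on (seg a n \<inter> seg b m) (\<lambda>lam. 2 / \<bar>sn lam b\<bar> + sqrt (\<delta>\<^sup>2 + 4 / (sn lam a)\<^sup>2))"
  by (intro continuous_intros sn_continuous[OF ab(1)] sn_continuous[OF ab(2)] ballI; use seg_sn_nonzero ab in auto)+

lemma is_interval_segs:
  "is_interval {z \<in> seg a n \<inter> seg b m. z < e}" "is_interval {z \<in> seg a n \<inter> seg b m. e < z}"
  unfolding is_interval_1 by (auto intro: seg_convex)

lemma IVT_value:
  fixes g :: "real \<Rightarrow> real"
  assumes "continuous_on {x..y} g" "x \<le> y" "g x \<le> v \<and> v \<le> g y \<or> g y \<le> v \<and> v \<le> g x"
  obtains z where "x \<le> z" "z \<le> y" "g z = v"
  using assms IVT'[of g x v y] IVT2'[of g y v x] by blast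

text \<open>\<open>Gm\<close> increases on the common interval and blows up at whichever right end
  comes first, so it crosses \<open>\<gamma>\<close> at a band edge, and everything to the left of
  it up to the Dirichlet end lies in the resolvent set.\<close>

lemma lower_gap_edge:
  assumes ab: "0 < a" "0 < b" and x: "x \<in> seg a n" "x \<in> seg b m" and g: "Gm a b x < \<gamma>"
  obtains e where "x < e" "e \<in> seg a n" "e \<in> seg b m" "Gm a b e = \<gamma>"
    "\<And>z. z \<in> seg a n \<Longrightarrow> z \<in> seg b m \<Longrightarrow> z < e \<Longrightarrow> Gm a b z < \<gamma>"
proof -
  have mono: "Gm a b y < Gm a b z" if "y \<in> seg a n" "y \<in> seg b m" "z \<in> seg a n" "z \<in> seg b m" "y < z" for y z
    using Tm_strict_mono[OF ab(1) that(1,3,5)] Tm_strict_mono[OF ab(2) that(2,4,5)] by (simp add: Gm_def)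
  \<comment> \<open>One summand of \<open>Gm\<close> exceeds \<open>K\<close>; the absolute values
    at \<open>x\<close> compensate the other summand, which may be negative but only grows.\<close>
  define K where "K = \<bar>\<gamma>\<bar> + \<bar>Tm x a\<bar> + \<bar>Tm x b\<bar>"
  obtain za where za: "za \<in> seg a n" "x < za" "K < Tm za a" using Tm_unbounded[OF ab(1) x(1)] by blast
  obtain zb where zb: "zb \<in> seg b m" "x < zb" "K < Tm zb b" using Tm_unbounded[OF ab(2) x(2)] by blast
  define y where "y = min za zb"
  have y: "x < y" "y \<in> seg a n" "y \<in> seg b m"
    using za zb seg_convex[OF x(1) za(1), of y] seg_convex[OF x(2) zb(1), of y] by (auto simp: y_def)
  have ya: "Tm x a < Tm y a" "Tm x b < Tm y b"
    using Tm_strict_mono[OF ab(1) x(1) y(2,1)] Tm_strict_mono[OF ab(2) x(2) y(3,1)] by auto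
  have abs: "\<gamma> \<le> \<bar>\<gamma>\<bar>" "0 \<le> \<bar>\<gamma>\<bar>" "- Tm x a \<le> \<bar>Tm x a\<bar>" "- Tm x b \<le> \<bar>Tm x b\<bar>" "0 \<le> \<bar>Tm x a\<bar>" "0 \<le> \<bar>Tm x b\<bar>"
    by simp_all
  have "\<gamma> \<le> Gm a b y"
  proof (cases "za \<le> zb")
    case True
    then have "K < Tm y a" using za(3) by (simp add: y_def)
    then show ?thesis using ya abs unfolding Gm_def K_def distrib_left by linarith
  next
    case False
    then have "K < Tm y b" using zb(3) by (simp add: y_def)
    then show ?thesis using ya abs unfolding Gm_def K_def distrib_left by linarith
  qed
  moreover have "continuous_on {x..y} (Gm a b)"
    by (rule continuous_on_subset[OF Gm_continuous(1)[OF ab, of n m]])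
       (use seg_convex[OF x(1) y(2)] seg_convex[OF x(2) y(3)] in auto)
  ultimately obtain e where e: "x \<le> e" "e \<le> y" "Gm a b e = \<gamma>"
    using IVT_value[of x y "Gm a b" \<gamma>] y(1) g by (metis less_eq_real_def)
  have es: "e \<in> seg a n" "e \<in> seg b m" using seg_convex[OF x(1) y(2)] seg_convex[OF x(2) y(3)] e by auto
  show ?thesis
  proof (rule that[OF _ es e(3)])
    show "x < e" using e g by (cases "x = e") auto
    show "Gm a b z < \<gamma>" if "z \<in> seg a n" "z \<in> seg b m" "z < e" for z
      using mono[OF that(1,2) es that(3)] e(3) by simp
  qed
qed

text \<open>The mirror image, with the blow-up on the left; positivity of \<open>Tp\<close> makes
  \<open>\<bar>\<gamma>\<bar>\<close> a sufficient threshold.\<close>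

lemma upper_gap_edge:
  assumes ab: "0 < a" "0 < b" and x: "x \<in> seg a n" "x \<in> seg b m" and g: "Gp a b x < - \<gamma>"
  obtains e where "e < x" "e \<in> seg a n" "e \<in> seg b m" "Gp a b e = - \<gamma>"
    "\<And>z. z \<in> seg a n \<Longrightarrow> z \<in> seg b m \<Longrightarrow> e < z \<Longrightarrow> Gp a b z < - \<gamma>"
proof -
  have mono: "Gp a b z < Gp a b y" if "y \<in> seg a n" "y \<in> seg b m" "z \<in> seg a n" "z \<in> seg b m" "y < z" for y z
    using Tp_strict_antimono[OF ab(1) that(1,3,5)] Tp_strict_antimono[OF ab(2) that(2,4,5)] by (simp add: Gp_def)
  define K where "K = \<bar>\<gamma>\<bar>"
  obtain za where za: "za \<in> seg a n" "za < x" "K < Tp za a" using Tp_unbounded[OF ab(1) x(1)] by blast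
  obtain zb where zb: "zb \<in> seg b m" "zb < x" "K < Tp zb b" using Tp_unbounded[OF ab(2) x(2)] by blast
  define y where "y = max za zb"
  have y: "y < x" "y \<in> seg a n" "y \<in> seg b m"
    using za zb seg_convex[OF za(1) x(1), of y] seg_convex[OF zb(1) x(2), of y] by (auto simp: y_def)
  have yp: "0 < Tp y a" "0 < Tp y b" using Tp_signs(3)[OF ab(1) y(2)] Tp_signs(3)[OF ab(2) y(3)] by auto
  have abs: "- \<gamma> \<le> \<bar>\<gamma>\<bar>" "0 \<le> \<bar>\<gamma>\<bar>" by simp_all
  have "- \<gamma> \<le> Gp a b y"
  proof (cases "zb \<le> za")
    case True
    then have "K < Tp y a" using za(3) by (simp add: y_def)
    then show ?thesis using yp abs unfolding Gp_def K_def distrib_left by linarith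
  next
    case False
    then have "K < Tp y b" using zb(3) by (simp add: y_def)
    then show ?thesis using yp abs unfolding Gp_def K_def distrib_left by linarith
  qed
  moreover have "continuous_on {y..x} (Gp a b)"
    by (rule continuous_on_subset[OF Gm_continuous(2)[OF ab, of n m]])
       (use seg_convex[OF y(2) x(1)] seg_convex[OF y(3) x(2)] in auto)
  ultimately obtain e where e: "y \<le> e" "e \<le> x" "Gp a b e = - \<gamma>"
    using IVT_value[of y x "Gp a b" "- \<gamma>"] y(1) g by (metis less_eq_real_def)
  have es: "e \<in> seg a n" "e \<in> seg b m" using seg_convex[OF y(2) x(1)] seg_convex[OF y(3) x(2)] e by auto
  show ?thesis
  proof (rule that[OF _ es e(3)])
    show "e < x" using e g by (cases "x = e") auto
    show "Gp a b z < - \<gamma>" if "z \<in> seg a n" "z \<in> seg b m" "e < z" for z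
      using mono[OF es that(1,2,3)] e(3) by simp
  qed
qed

text \<open>The defect equation is solvable at \<open>z\<close> for some transversal quasimomentum iff \<open>g z \<le> 0 \<le> h z\<close>.
  At the gap edge \<open>e\<close> the first function is negative.\<close>

lemma defect_band:
  fixes a b \<gamma> \<gamma>t :: real
  defines "s \<equiv> sgn (\<gamma> - \<gamma>t)"
    and "F \<equiv> \<lambda>z. sgn (\<gamma> - \<gamma>t) * (\<gamma> + (2 * cs z a / sn z a + 2 * cs z b / sn z b))"
    and "R \<equiv> \<lambda>z. sqrt ((\<gamma> - \<gamma>t)\<^sup>2 + 4 / (sn z a)\<^sup>2)"
  assumes ab: "0 < a" "0 < b" and d: "\<gamma> \<noteq> \<gamma>t"
    and I: "is_interval I" "is_interval (insert e I)" "insert e I \<subseteq> seg a n \<inter> seg b m"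
    and e: "F e = 2 / \<bar>sn e a\<bar> + 2 / \<bar>sn e b\<bar>"
    and x: "x \<in> I" and y: "y \<in> I" "0 \<le> F y + 2 / \<bar>sn y b\<bar> - R y"
  obtains z where "z \<in> I" "z \<in> sigma_H_pert a b \<gamma> \<gamma>t"
proof -
  define g where "g = (\<lambda>z. F z - (2 / \<bar>sn z b\<bar> + R z))"
  define h where "h = (\<lambda>z. F z + 2 / \<bar>sn z b\<bar> - R z)"
  have nz: "sn z a \<noteq> 0" "sn z b \<noteq> 0" if "z \<in> insert e I" for z
    using seg_sn_nonzero ab that I(3) by blast+
  have "continuous_on (seg a n \<inter> seg b m) g"
    unfolding g_def F_def R_def
    by (intro continuous_on_diff continuous_on_mult continuous_on_add continuous_on_const defect_functions_continuous ab)
  then have cg: "continuous_on (insert e I) g" using I(3) by (rule continuous_on_subset)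
  have ge: "g e < 0" using e sqrt_defect_gt[OF nz(1), of e "\<gamma> - \<gamma>t"] d by (simp add: g_def R_def)
  \<comment> \<open>If \<open>g x > 0\<close>, a zero of \<open>g\<close> lies between
    \<open>e\<close> and \<open>x\<close>; it is not \<open>e\<close>, where \<open>g\<close> is
    negative, so it belongs to \<open>I\<close>.\<close>
  have "\<exists>x\<in>I. g x \<le> 0"
  proof (cases "g x \<le> 0")
    case False
    have "is_interval (g ` insert e I)"
      using I(2) cg by (simp only: is_interval_connected_1 connected_continuous_image)
    then have "0 \<in> g ` insert e I"
      using ge x False unfolding is_interval_1 by (metis imageI insertI1 insertI2 less_eq_real_def linorder_not_less)
    then show ?thesis using ge by force
  qed (use x in blast)
  then obtain x' where x': "x' \<in> I" "g x' \<le> 0" by blast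
  have cI: "continuous_on I g" using cg by (rule continuous_on_subset) auto
  have gh: "g z \<le> h z" for z
  proof -
    have "0 \<le> 2 / \<bar>sn z b\<bar>" by simp
    then show ?thesis unfolding g_def h_def by linarith
  qed
  have hy: "0 \<le> h y" using y(2) by (simp add: h_def)
  obtain z where z: "z \<in> I" "g z \<le> 0" "0 \<le> h z"
    using ivt_pair[of I g h x' y, OF I(1) cI gh x' y(1) hy] by blast
  let ?X = "\<gamma> + (2 * cs z a / sn z a + 2 * cs z b / sn z b)"
  have le: "\<bar>F z - R z\<bar> \<le> 2 / \<bar>sn z b\<bar>" using z(2,3) unfolding g_def h_def by linarith
  have "s * s = 1" "\<bar>s\<bar> = 1" using d by (auto simp: s_def sgn_real_def)
  then have "\<bar>?X - s * R z\<bar> = \<bar>s * (s * ?X - R z)\<bar>" by (simp add: right_diff_distrib flip: mult.assoc)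
  also have "\<dots> = \<bar>F z - R z\<bar>" using \<open>\<bar>s\<bar> = 1\<close> by (simp only: abs_mult F_def s_def mult_1_left)
  finally have "z \<in> sigma_H_pert a b \<gamma> \<gamma>t"
    using le nz[of z] z(1) d by (intro new_spectrum[OF ab]) (auto simp: s_def R_def)
  then show ?thesis using that z(1) by blast
qed

text \<open>What remains to be supplied to \<open>defect_band\<close> is a point with a nonnegative
  upper function; it is sought near the left end of the gap.\<close>

lemma new_spectrum_below:
  assumes ab: "0 < a" "0 < b" and d: "\<gamma>t < \<gamma>"
    and x: "x \<in> seg a n" "x \<in> seg b m" "x < e" and e: "e \<in> seg a n" "e \<in> seg b m" "Gm a b e = \<gamma>"
    and lt: "\<And>z. z \<in> seg a n \<Longrightarrow> z \<in> seg b m \<Longrightarrow> z < e \<Longrightarrow> Gm a b z < \<gamma>"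
  obtains z where "z \<in> seg a n" "z \<in> seg b m" "z < e" "z \<in> sigma_H_pert a b \<gamma> \<gamma>t"
proof -
  define \<delta> where "\<delta> = \<gamma> - \<gamma>t"
  let ?I = "{z \<in> seg a n \<inter> seg b m. z < e}"
  let ?H = "\<lambda>z. 2 * cs z a / sn z a + 2 * cs z b / sn z b"
  let ?R = "\<lambda>z. sqrt (\<delta>\<^sup>2 + 4 / (sn z a)\<^sup>2)"
  have FG: "\<gamma> + ?H z - (2 / \<bar>sn z a\<bar> + 2 / \<bar>sn z b\<bar>) = \<gamma> - Gm a b z" for z
    unfolding gap_functions by simp
  define K where "K = (a + b) * (\<delta>\<^sup>2 + 1) / 8"
  have "\<exists>y\<in>?I. 0 \<le> \<gamma> + ?H y + 2 / \<bar>sn y b\<bar> - ?R y"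
  \<comment> \<open>On the bottom interval there is no Dirichlet end: far down, \<open>Tp\<close>
    grows without bound while \<open>sqrt_defect_le_add\<close> caps the loss by
    \<open>\<bar>\<delta>\<bar>\<close>.\<close>
  proof (cases "n = 0 \<and> m = 0")
    case True
    obtain y where y: "y \<in> seg b m" "y < x" "m = 0 \<Longrightarrow> y < 0" "(\<bar>\<delta>\<bar> + \<bar>\<gamma>\<bar>) < Tp y b"
      using Tp_unbounded[OF ab(2) x(2)] by metis
    have y0: "y < 0" using y(3) True by simp
    have ya: "y \<in> seg a n" using True seg_nonpos[OF ab(1), of y] y0 by simp
    have "Tm y a \<le> 0" using Tm_signs(1)[OF ab(1), of y] y0 by simp
    moreover have "\<gamma> + ?H y + 2 / \<bar>sn y b\<bar> - ?R y = \<gamma> - 2 * Tm y a + 2 * Tp y b + 2 / \<bar>sn y a\<bar> - ?R y"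
      unfolding Tm_def Tp_def by simp
    ultimately have "0 \<le> \<gamma> + ?H y + 2 / \<bar>sn y b\<bar> - ?R y"
      using y(4) sqrt_defect_le_add[of \<delta> "sn y a"] by linarith
    then show ?thesis using ya y(1,2) x(3) by (intro bexI[of _ y]) auto
  next
    case False
    obtain za where za: "za \<in> seg a n" "za < x" "n \<noteq> 0 \<Longrightarrow> 0 < za" "K < Tp za a"
      using Tp_unbounded[OF ab(1) x(1)] by metis
    obtain zb where zb: "zb \<in> seg b m" "zb < x" "m \<noteq> 0 \<Longrightarrow> 0 < zb" "K < Tp zb b"
      using Tp_unbounded[OF ab(2) x(2)] by metis
    define y where "y = max za zb"
    have y0: "0 < y" using za(3) zb(3) False by (auto simp: y_def)
    have y: "y < e" "y \<in> seg a n" "y \<in> seg b m"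
      using za zb x(3) seg_convex[OF za(1) x(1), of y] seg_convex[OF zb(1) x(2), of y] by (auto simp: y_def)
    have nz: "sn y a \<noteq> 0" "sn y b \<noteq> 0" using seg_sn_nonzero ab y by auto
    have "K < Tp y a \<or> K < Tp y b" using za(4) zb(4) by (auto simp: y_def max_def)
    then have "\<bar>sn y a\<bar> * \<bar>sn y b\<bar> * \<delta>\<^sup>2 \<le> 16" using product_small[OF ab y0 y(2,3) K_def] by blast
    \<comment> \<open>In the gap \<open>\<gamma> + ?H y\<close> exceeds
      \<open>2 / \<bar>sn y a\<bar> + 2 / \<bar>sn y b\<bar>\<close>, and another
      \<open>2 / \<bar>sn y b\<bar>\<close> is available; together they dominate the square
      root.\<close>
    then have "0 \<le> \<gamma> + ?H y + 2 / \<bar>sn y b\<bar> - ?R y"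
      using FG[of y] lt[OF y(2,3,1)] sqrt_defect_le[OF nz] by fastforce
    then show ?thesis using y by (intro bexI[of _ y]) auto
  qed
  then obtain y where y: "y \<in> ?I" "0 \<le> \<gamma> + ?H y + 2 / \<bar>sn y b\<bar> - ?R y" by blast
  have s: "sgn (\<gamma> - \<gamma>t) = 1" using d by simp
  obtain z where "z \<in> ?I" "z \<in> sigma_H_pert a b \<gamma> \<gamma>t"
  proof (rule defect_band[where I = ?I and e = e and x = x and y = y and n = n and m = m, OF ab])
    show "\<gamma> \<noteq> \<gamma>t" using d by simp
    show "is_interval (insert e ?I)" unfolding is_interval_1 using e(1,2) by (auto intro: seg_convex)
    show "insert e ?I \<subseteq> seg a n \<inter> seg b m" using e by auto
    show "sgn (\<gamma> - \<gamma>t) * (\<gamma> + ?H e) = 2 / \<bar>sn e a\<bar> + 2 / \<bar>sn e b\<bar>" using FG[of e] e(3) s by simp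
    show "x \<in> ?I" using x by simp
    show "0 \<le> sgn (\<gamma> - \<gamma>t) * (\<gamma> + ?H y) + 2 / \<bar>sn y b\<bar> - sqrt ((\<gamma> - \<gamma>t)\<^sup>2 + 4 / (sn y a)\<^sup>2)"
      using y(2) s by (simp add: \<delta>_def)
  qed (use y(1) is_interval_segs that in blast)+
  then show ?thesis using that by blast
qed

text \<open>Here the far end of the gap is the right one, always a Dirichlet eigenvalue, so a single
  case suffices.\<close>

lemma new_spectrum_above:
  assumes ab: "0 < a" "0 < b" and d: "\<gamma> < \<gamma>t"
    and x: "x \<in> seg a n" "x \<in> seg b m" "e < x" and e: "e \<in> seg a n" "e \<in> seg b m" "Gp a b e = - \<gamma>"
    and lt: "\<And>z. z \<in> seg a n \<Longrightarrow> z \<in> seg b m \<Longrightarrow> e < z \<Longrightarrow> Gp a b z < - \<gamma>"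
  obtains z where "z \<in> seg a n" "z \<in> seg b m" "e < z" "z \<in> sigma_H_pert a b \<gamma> \<gamma>t"
proof -
  define \<delta> where "\<delta> = \<gamma> - \<gamma>t"
  let ?I = "{z \<in> seg a n \<inter> seg b m. e < z}"
  let ?H = "\<lambda>z. 2 * cs z a / sn z a + 2 * cs z b / sn z b"
  have FG: "- (\<gamma> + ?H z) - (2 / \<bar>sn z a\<bar> + 2 / \<bar>sn z b\<bar>) = - \<gamma> - Gp a b z" for z
    unfolding gap_functions by simp
  define K where "K = (a + b) * (\<delta>\<^sup>2 + 1) / 8"
  obtain za where za: "za \<in> seg a n" "x < za" "0 < za" "K < Tm za a"
    using Tm_unbounded[OF ab(1) x(1)] by metis
  obtain zb where zb: "zb \<in> seg b m" "x < zb" "0 < zb" "K < Tm zb b"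
    using Tm_unbounded[OF ab(2) x(2)] by metis
  define y where "y = min za zb"
  have y0: "0 < y" using za(3) zb(3) by (auto simp: y_def)
  have y: "e < y" "y \<in> seg a n" "y \<in> seg b m"
    using za zb x(3) seg_convex[OF x(1) za(1), of y] seg_convex[OF x(2) zb(1), of y] by (auto simp: y_def)
  have nz: "sn y a \<noteq> 0" "sn y b \<noteq> 0" using seg_sn_nonzero ab y by auto
  have "K < Tm y a \<or> K < Tm y b" using za(4) zb(4) by (auto simp: y_def min_def)
  then have p: "\<bar>sn y a\<bar> * \<bar>sn y b\<bar> * \<delta>\<^sup>2 \<le> 16" using product_small[OF ab y0 y(2,3) K_def] by blast
  have hy: "0 \<le> - (\<gamma> + ?H y) + 2 / \<bar>sn y b\<bar> - sqrt (\<delta>\<^sup>2 + 4 / (sn y a)\<^sup>2)"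
    using FG[of y] lt[OF y(2,3,1)] sqrt_defect_le[OF nz p] by simp
  have s: "sgn (\<gamma> - \<gamma>t) = -1" using d by simp
  obtain z where "z \<in> ?I" "z \<in> sigma_H_pert a b \<gamma> \<gamma>t"
  proof (rule defect_band[where I = ?I and e = e and x = x and y = y and n = n and m = m, OF ab])
    show "\<gamma> \<noteq> \<gamma>t" using d by simp
    show "is_interval (insert e ?I)" unfolding is_interval_1 using e(1,2) by (auto intro: seg_convex)
    show "insert e ?I \<subseteq> seg a n \<inter> seg b m" using e by auto
    show "sgn (\<gamma> - \<gamma>t) * (\<gamma> + ?H e) = 2 / \<bar>sn e a\<bar> + 2 / \<bar>sn e b\<bar>" using FG[of e] e(3) s by simp
    show "x \<in> ?I" "y \<in> ?I" using x y by simp_all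
    show "0 \<le> sgn (\<gamma> - \<gamma>t) * (\<gamma> + ?H y) + 2 / \<bar>sn y b\<bar> - sqrt ((\<gamma> - \<gamma>t)\<^sup>2 + 4 / (sn y a)\<^sup>2)"
      using hy s by (simp add: \<delta>_def)
  qed (use is_interval_segs that in blast)+
  then show ?thesis using that by blast
qed

section \<open>Gaps and the bottom of the spectrum\<close>

lemma resolvent_cases:
  assumes ab: "0 < a" "0 < b" and x: "x \<notin> sigma_H a b \<gamma>"
  obtains n m where "x \<in> seg a n" "x \<in> seg b m" "sn x a \<noteq> 0" "sn x b \<noteq> 0"
    "Gm a b x < \<gamma> \<or> Gp a b x < - \<gamma>"
proof -
  have s: "sn x a \<noteq> 0" "sn x b \<noteq> 0" and g: "Gm a b x < \<gamma> \<or> Gp a b x < - \<gamma>"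
    using x sigma_H_iff[OF ab, of x \<gamma>] by auto
  obtain n where "x \<in> seg a n" using in_seg[OF ab(1) s(1)] .
  moreover obtain m where "x \<in> seg b m" using in_seg[OF ab(2) s(2)] .
  ultimately show ?thesis using that s g by blast
qed

lemma not_in_sigma_H:
  assumes ab: "0 < a" "0 < b" and z: "z \<in> seg a n" "z \<in> seg b m" and g: "Gm a b z < \<gamma> \<or> Gp a b z < - \<gamma>"
  shows "z \<notin> sigma_H a b \<gamma>"
  using sigma_H_iff[OF ab, of z \<gamma>] seg_sn_nonzero[OF ab(1) z(1)] seg_sn_nonzero[OF ab(2) z(2)] g by auto

text \<open>A Dirichlet eigenvalue of the horizontal edges. Together with the lower bound of the
  spectrum it makes \<open>Inf\<close> meaningful.\<close>

lemma sigma_H_nonempty: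
  assumes ab: "0 < a" "0 < b"
  shows "(pi / a)\<^sup>2 \<in> sigma_H a b \<gamma>"
proof -
  have "0 < (pi / a)\<^sup>2" using ab by simp
  moreover have "sqrt ((pi / a)\<^sup>2) * a = pi" using ab by simp
  ultimately have "sn ((pi / a)\<^sup>2) a = 0" unfolding sn_def by simp
  then show ?thesis using sigma_H_iff[OF ab] by blast
qed

lemma Gm_less_at_minus_infinity:
  assumes ab: "0 < a" "0 < b"
  obtains x where "x < 0" "\<And>z. z \<le> x \<Longrightarrow> Gm a b z < \<gamma>"
proof -
  define k where "k = \<bar>\<gamma>\<bar> + 2 / a + 2 / b + 1"
  have "0 < 2 / a" "0 < 2 / b" using ab by auto
  then have k: "0 < k" using abs_ge_zero[of \<gamma>] unfolding k_def by linarith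
  show ?thesis
  proof (rule that[of "- k\<^sup>2"])
    show "- k\<^sup>2 < 0" using k by simp
    fix z assume z: "z \<le> - k\<^sup>2"
    then have z0: "z < 0" using k by (smt (verit) zero_less_power)
    have kz: "k \<le> sqrt (- z)" using z by (intro real_le_rsqrt) simp
    have p: "0 < 2 / a" "0 < 2 / b" using ab by auto
    show "Gm a b z < \<gamma>"
      using Tm_upper_bound_neg[OF ab(1) z0] Tm_upper_bound_neg[OF ab(2) z0] kz p abs_ge_minus_self[of \<gamma>]
      unfolding Gm_def k_def distrib_left by linarith
  qed
qed

lemma sigma_H_bdd_below:
  assumes ab: "0 < a" "0 < b"
  shows "bdd_below (sigma_H a b \<gamma>)"
proof -
  obtain x where x: "x < 0" "\<And>z. z \<le> x \<Longrightarrow> Gm a b z < \<gamma>" using Gm_less_at_minus_infinity[OF ab] by blast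
  show ?thesis
  proof (rule bdd_belowI)
    fix z assume z: "z \<in> sigma_H a b \<gamma>"
    show "x \<le> z"
    proof (rule ccontr)
      assume "\<not> x \<le> z"
      then have "z \<notin> sigma_H a b \<gamma>"
        using x by (intro not_in_sigma_H[OF ab seg_nonpos[OF ab(1)] seg_nonpos[OF ab(2)]]) auto
      then show False using z by simp
    qed
  qed
qed

text \<open>For \<open>\<gamma> < 0\<close> the condition \<open>Gm < \<gamma>\<close> forces
  \<open>x < 0\<close>, and on the negative half-line \<open>Gm\<close> increases, so no spectrum
  lies to the left of \<open>x\<close>. A gap above the infimum is therefore of the
  \<open>Gp\<close> type.\<close>

lemma le_Inf_sigma_H:
  assumes ab: "0 < a" "0 < b" and \<gamma>: "\<gamma> < 0" and s: "sn x a \<noteq> 0" "sn x b \<noteq> 0" and g: "Gm a b x < \<gamma>"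
  shows "x \<le> Inf (sigma_H a b \<gamma>)"
proof (rule cInf_greatest)
  show "sigma_H a b \<gamma> \<noteq> {}" using sigma_H_nonempty[OF ab] by blast
  fix z assume z: "z \<in> sigma_H a b \<gamma>"
  obtain n where n: "x \<in> seg a n" using in_seg[OF ab(1) s(1)] .
  obtain m where m: "x \<in> seg b m" using in_seg[OF ab(2) s(2)] .
  have x0: "x < 0"
  proof (rule ccontr)
    assume "\<not> x < 0"
    then have "0 \<le> Tm x a" "0 \<le> Tm x b"
      using Tm_signs(3)[OF ab(1) _ n] Tm_signs(3)[OF ab(2) _ m] seg_zero(2)[OF ab(1)] seg_zero(2)[OF ab(2)]
      by (cases "x = 0"; force)+
    then show False using g \<gamma> by (simp add: Gm_def)
  qed
  show "x \<le> z"
  proof (rule ccontr)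
    assume "\<not> x \<le> z"
    then have zx: "z < x" by simp
    then have sz: "z \<in> seg a 0" "z \<in> seg b 0" using x0 seg_nonpos[OF ab(1)] seg_nonpos[OF ab(2)] by auto
    have sx: "x \<in> seg a 0" "x \<in> seg b 0" using x0 seg_nonpos[OF ab(1)] seg_nonpos[OF ab(2)] by auto
    have "Gm a b z < Gm a b x"
      using Tm_strict_mono[OF ab(1) sz(1) sx(1) zx] Tm_strict_mono[OF ab(2) sz(2) sx(2) zx] by (simp add: Gm_def)
    then have "z \<notin> sigma_H a b \<gamma>" using g by (intro not_in_sigma_H[OF ab sz]) auto
    then show False using z by simp
  qed
qed

lemma gap_contains:
  assumes J: "gap S J" and I: "is_interval I" "I \<subseteq> - S" and x: "x \<in> I" "x \<in> J"
  shows "I \<subseteq> J"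
proof -
  obtain x0 where "J = connected_component_set (- S) x0" using J unfolding gap_def by blast
  then have "J = connected_component_set (- S) x" using x(2) connected_component_eq by metis
  then show ?thesis using connected_component_maximal[OF x(1) _ I(2)] I(1) by (simp add: is_interval_connected_1)
qed

lemma gap_point:
  assumes "gap S J"
  obtains x where "x \<in> J"
proof -
  obtain x where "x \<notin> S" "J = connected_component_set (- S) x" using assms unfolding gap_def by blast
  then have "x \<in> J" by (simp add: connected_component_refl_eq)
  then show ?thesis by (rule that)
qed

lemma gap_disjoint: "gap S J \<Longrightarrow> x \<in> J \<Longrightarrow> x \<notin> S"
  unfolding gap_def using connected_component_subset by fastforce

text \<open>\<open>absent\<close> applies when the perturbation pushes the diagonal outward,
  \<open>below\<close> and \<open>above\<close> when it pushes inward. Which of \<open>Gm\<close>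
  and \<open>Gp\<close> governs a gap is settled by the sign of \<open>\<gamma>\<close> and the
  position relative to the infimum.\<close>

theorem theorem3p17:
  fixes a b \<gamma> \<gamma>t :: real
  assumes "a > 0" and "b > 0"
  shows
   "(\<gamma> < 0 \<and> \<gamma>t < \<gamma> \<longrightarrow>
       (\<forall>J. gap (sigma_H a b \<gamma>) J \<and> J \<subseteq> {Inf (sigma_H a b \<gamma>)<..} \<longrightarrow>
            J \<inter> sigma_H_pert a b \<gamma> \<gamma>t = {}) \<and>
       {..<Inf (sigma_H a b \<gamma>)} \<inter> sigma_H_pert a b \<gamma> \<gamma>t \<noteq> {}) \<and>
    (\<gamma> < 0 \<and> \<gamma>t > \<gamma> \<longrightarrow>
       {..<Inf (sigma_H a b \<gamma>)} \<inter> sigma_H_pert a b \<gamma> \<gamma>t = {} \<and>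
       (\<forall>J. gap (sigma_H a b \<gamma>) J \<and> J \<subseteq> {Inf (sigma_H a b \<gamma>)<..} \<longrightarrow>
            J \<inter> sigma_H_pert a b \<gamma> \<gamma>t \<noteq> {})) \<and>
    (\<gamma> > 0 \<and> \<gamma>t < \<gamma> \<longrightarrow>
       (\<forall>J. gap (sigma_H a b \<gamma>) J \<longrightarrow> J \<inter> sigma_H_pert a b \<gamma> \<gamma>t \<noteq> {})) \<and>
    (\<gamma> > 0 \<and> \<gamma>t > \<gamma> \<longrightarrow>
       (\<forall>J. gap (sigma_H a b \<gamma>) J \<longrightarrow> J \<inter> sigma_H_pert a b \<gamma> \<gamma>t = {}) \<and>
       sigma_H_pert a b \<gamma> \<gamma>t = sigma_H a b \<gamma>)"
proof -
  note ab = assms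
  let ?\<sigma> = "sigma_H a b \<gamma>" and ?\<tau> = "sigma_H_pert a b \<gamma> \<gamma>t"
  have ne: "?\<sigma> \<noteq> {}" using sigma_H_nonempty[OF ab] by blast
  have absent: "x \<notin> ?\<tau>"
    if "sn x a \<noteq> 0" "sn x b \<noteq> 0" "Gm a b x < \<gamma> \<and> \<gamma> \<le> \<gamma>t \<or> Gp a b x < - \<gamma> \<and> \<gamma>t \<le> \<gamma>" for x
    unfolding sigma_H_pert_def by (rule not_in_spectrum_chain[OF ab that])
  have below: "J \<inter> ?\<tau> \<noteq> {}" if J: "gap ?\<sigma> J" and x: "x \<in> J" and g: "Gm a b x < \<gamma>" and d: "\<gamma>t < \<gamma>" for J x
  proof -
    obtain n m where nm: "x \<in> seg a n" "x \<in> seg b m"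
      using resolvent_cases[OF ab gap_disjoint[OF J x]] by metis
    obtain e where e: "x < e" "e \<in> seg a n" "e \<in> seg b m" "Gm a b e = \<gamma>"
      "\<And>z. z \<in> seg a n \<Longrightarrow> z \<in> seg b m \<Longrightarrow> z < e \<Longrightarrow> Gm a b z < \<gamma>"
      using lower_gap_edge[OF ab nm g] by metis
    obtain z where z: "z \<in> seg a n" "z \<in> seg b m" "z < e" "z \<in> ?\<tau>"
      by (rule new_spectrum_below[OF ab d nm e(1-4)]) (blast intro: e(5), blast)
    have "{z \<in> seg a n \<inter> seg b m. z < e} \<subseteq> J"
      by (rule gap_contains[OF J is_interval_segs(1)]) (use e nm x not_in_sigma_H[OF ab] in auto)
    then show ?thesis using z by auto
  qed
  have above: "J \<inter> ?\<tau> \<noteq> {}" if J: "gap ?\<sigma> J" and x: "x \<in> J" and g: "Gp a b x < - \<gamma>" and d: "\<gamma> < \<gamma>t" for J x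
  proof -
    obtain n m where nm: "x \<in> seg a n" "x \<in> seg b m"
      using resolvent_cases[OF ab gap_disjoint[OF J x]] by metis
    obtain e where e: "e < x" "e \<in> seg a n" "e \<in> seg b m" "Gp a b e = - \<gamma>"
      "\<And>z. z \<in> seg a n \<Longrightarrow> z \<in> seg b m \<Longrightarrow> e < z \<Longrightarrow> Gp a b z < - \<gamma>"
      using upper_gap_edge[OF ab nm g] by metis
    obtain z where z: "z \<in> seg a n" "z \<in> seg b m" "e < z" "z \<in> ?\<tau>"
      by (rule new_spectrum_above[OF ab d nm e(1-4)]) (blast intro: e(5), blast)
    have "{z \<in> seg a n \<inter> seg b m. e < z} \<subseteq> J"
      by (rule gap_contains[OF J is_interval_segs(2)]) (use e nm x not_in_sigma_H[OF ab] in auto)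
    then show ?thesis using z by auto
  qed
  have upper: "Gp a b x < - \<gamma> \<and> sn x a \<noteq> 0 \<and> sn x b \<noteq> 0"
    if \<gamma>: "\<gamma> < 0" and J: "gap ?\<sigma> J" "J \<subseteq> {Inf ?\<sigma><..}" and x: "x \<in> J" for J x
    using resolvent_cases[OF ab gap_disjoint[OF J(1) x]] le_Inf_sigma_H[OF ab \<gamma>, of x] J(2) x
    by (metis greaterThan_iff linorder_not_less subsetD)
  have lower: "Gm a b x < \<gamma> \<and> sn x a \<noteq> 0 \<and> sn x b \<noteq> 0" if \<gamma>: "\<gamma> > 0" and J: "gap ?\<sigma> J" and x: "x \<in> J" for J x
  proof -
    obtain n m where nm: "x \<in> seg a n" "x \<in> seg b m" "sn x a \<noteq> 0" "sn x b \<noteq> 0" "Gm a b x < \<gamma> \<or> Gp a b x < - \<gamma>"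
      using resolvent_cases[OF ab gap_disjoint[OF J x]] by metis
    \<comment> \<open>Positivity excludes the alternative \<open>Gp a b x < - \<gamma>\<close> when
      \<open>\<gamma> > 0\<close>.\<close>
    have "0 < Gp a b x" using Tp_signs(3)[OF ab(1) nm(1)] Tp_signs(3)[OF ab(2) nm(2)] by (simp add: Gp_def)
    then show ?thesis using nm \<gamma> by auto
  qed
  have i: "J \<inter> ?\<tau> = {}" if "\<gamma> < 0" "\<gamma>t < \<gamma>" "gap ?\<sigma> J" "J \<subseteq> {Inf ?\<sigma><..}" for J
    using upper[OF that(1,3,4)] absent that(2) by (auto simp: less_imp_le)
  have i': "{..<Inf ?\<sigma>} \<inter> ?\<tau> \<noteq> {}" if "\<gamma> < 0" and d: "\<gamma>t < \<gamma>"
  proof -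
    obtain x where x: "x < 0" "\<And>z. z \<le> x \<Longrightarrow> Gm a b z < \<gamma>" using Gm_less_at_minus_infinity[OF ab] by blast
    have sx: "x \<in> seg a 0" "x \<in> seg b 0" using seg_nonpos[OF ab(1)] seg_nonpos[OF ab(2)] x(1) by auto
    obtain e where e: "x < e" "e \<in> seg a 0" "e \<in> seg b 0" "Gm a b e = \<gamma>"
      "\<And>z. z \<in> seg a 0 \<Longrightarrow> z \<in> seg b 0 \<Longrightarrow> z < e \<Longrightarrow> Gm a b z < \<gamma>"
      using lower_gap_edge[OF ab sx x(2)[OF order_refl]] by metis
    obtain z where z: "z < e" "z \<in> ?\<tau>"
      by (rule new_spectrum_below[OF ab d sx e(1-4)]) (blast intro: e(5), blast)
    \<comment> \<open>Every \<open>w < e\<close> lies in the first interval of either edge length,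
      where \<open>Gm\<close> is still below \<open>\<gamma>\<close>.\<close>
    have "e \<le> Inf ?\<sigma>"
    proof (rule cInf_greatest[OF ne])
      fix w assume w: "w \<in> ?\<sigma>"
      show "e \<le> w"
      proof (rule ccontr)
        assume "\<not> e \<le> w"
        then have we: "w < e" by simp
        then have ws: "w \<in> seg a 0" "w \<in> seg b 0" using e(2,3) by (auto simp: seg_def)
        then have "w \<notin> ?\<sigma>" using e(5)[OF ws we] by (intro not_in_sigma_H[OF ab ws]) auto
        then show False using w by simp
      qed
    qed
    then show ?thesis using z by force
  qed
  have ii: "{..<Inf ?\<sigma>} \<inter> ?\<tau> = {}" if "\<gamma> < 0" "\<gamma>t > \<gamma>"
  proof -
    have "x \<notin> ?\<tau>" if x: "x < Inf ?\<sigma>" for x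
    proof -
      have xs: "x \<notin> ?\<sigma>" using x cInf_lower[OF _ sigma_H_bdd_below[OF ab]] by force
      obtain n m where nm: "x \<in> seg a n" "x \<in> seg b m" "sn x a \<noteq> 0" "sn x b \<noteq> 0" "Gm a b x < \<gamma> \<or> Gp a b x < - \<gamma>"
        using resolvent_cases[OF ab xs] by metis
      \<comment> \<open>Otherwise a band edge \<open>e\<close> would lie to the left of
        \<open>x\<close>, giving spectrum below the infimum.\<close>
      have "\<not> Gp a b x < - \<gamma>"
      proof
        assume "Gp a b x < - \<gamma>"
        then obtain e where e: "e < x" "e \<in> seg a n" "e \<in> seg b m" "Gp a b e = - \<gamma>"
          using upper_gap_edge[OF ab nm(1,2)] by metis
        \<comment> \<open>\<open>Gm\<close> and \<open>Gp\<close> add up to twice the Schur bound,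
          which is nonnegative.\<close>
        have "\<gamma> \<le> Gm a b e" using gap_functions[where a = a and b = b and lam = e] e(4) by linarith
        then have "e \<in> ?\<sigma>" using sigma_H_iff[OF ab] e(4) by auto
        then show False using cInf_lower[OF _ sigma_H_bdd_below[OF ab]] e(1) x by force
      qed
      then show ?thesis using absent nm \<open>\<gamma>t > \<gamma>\<close> by auto
    qed
    then show ?thesis by auto
  qed
  have ii': "J \<inter> ?\<tau> \<noteq> {}" if "\<gamma> < 0" "\<gamma>t > \<gamma>" "gap ?\<sigma> J" "J \<subseteq> {Inf ?\<sigma><..}" for J
    using gap_point[OF that(3)] upper[OF that(1,3,4)] above[OF that(3)] that(2) by metis
  have iii: "J \<inter> ?\<tau> \<noteq> {}" if "\<gamma> > 0" "\<gamma>t < \<gamma>" "gap ?\<sigma> J" for J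
    using gap_point[OF that(3)] lower[OF that(1,3)] below[OF that(3)] that(2) by metis
  have iv: "J \<inter> ?\<tau> = {}" if "\<gamma> > 0" "\<gamma>t > \<gamma>" "gap ?\<sigma> J" for J
    using lower[OF that(1,3)] absent that(2) by (auto simp: less_imp_le)
  have iv': "?\<tau> = ?\<sigma>" if "\<gamma> > 0" "\<gamma>t > \<gamma>"
  proof
    show "?\<tau> \<subseteq> ?\<sigma>"
    proof (rule ccontr)
      assume "\<not> ?\<tau> \<subseteq> ?\<sigma>"
      then obtain x where x: "x \<in> ?\<tau>" "x \<notin> ?\<sigma>" by blast
      \<comment> \<open>Any point off the unperturbed spectrum spans a gap, to which
        \<open>iv\<close> applies.\<close>
      define J where "J = connected_component_set (- ?\<sigma>) x"
      have J: "gap ?\<sigma> J" "x \<in> J" using x by (auto simp: gap_def J_def connected_component_refl_eq)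
      then show False using iv[OF that J(1)] x(1) by blast
    qed
    show "?\<sigma> \<subseteq> ?\<tau>" by (rule sigma_H_subset_pert[OF ab])
  qed
  show ?thesis using i i' ii ii' iii iv iv' by blast
qed

end
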